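(* Let $q\in\mathbb{C}$ be nonzero and not a root of unity, let $n\ge 1$ be an integer, let $x\in\mathbb{C}$, and fix a sign $\pm$. For all $u,v,w\in\mathbb{C}$, the operators $\check R^{\pm,(n)}$ defined in the context satisfy the (twisted) Yang–Baxter equation $$(\check R^{\pm,(n)}(v,w;x)\otimes I)(I\otimes \check R^{\pm,(n)}(u,w;q^nx))(\check R^{\pm,(n)}(u,v;x)\otimes I)=(I\otimes \check R^{\pm,(n)}(u,v;q^nx))(\check R^{\pm,(n)}(u,w;x)\otimes I)(I\otimes \check R^{\pm,(n)}(v,w;q^nx))$$ as an identity of endomorphisms of $V_{\pm,x}\otimes V_{\pm,q^nx}\otimes V_{\pm,q^{2n}x}$.
   Context: Throughout, $q\in\mathbb{C}$, $q\neq 0$, and $q^r\neq 1$ for every positive integer $r$. Tensor products are ordinary (not $\mathbb{Z}_2$-graded) tensor products over $\mathbb{C}$, and $I$ denotes the identity operator on the relevant space. Let $e_1,\dots,e_4$ be the standard basis of $\mathbb{C}^4$. Put $\theta(1)=\theta(2)=0$, $\theta(3)=\theta(4)=1$. **The basic operator.** For $x\in\mathbb{C}$ write $V_x=\mathbb{C}^4$. Define subspaces of $V_x\otimes V_{qx}=\mathbb{C}^4\otimes\mathbb{C}^4$ by $$V_x^{(1)}=\mathbb{C}(e_3\otimes e_3)\oplus\mathbb{C}(e_4\otimes e_4)\oplus\bigoplus_{i<j}\mathbb{C}\bigl(e_i\otimes e_j-(-1)^{\theta(i)\theta(j)}q\,e_j\otimes e_i+\delta_{i1}\delta_{j2}(q^3x\,e_3\otimes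 e_4+x\,e_4\otimes e_3)\bigr),$$ $$V_x^{(2)}=\mathbb{C}(e_1\otimes e_1)\oplus\mathbb{C}(e_2\otimes e_2)\oplus\bigoplus_{i<j}\mathbb{C}\bigl(e_i\otimes e_j+(-1)^{\theta(i)\theta(j)}q^{-1}e_j\otimes e_i\bigr).$$ Then $\mathbb{C}^4\otimes\mathbb{C}^4=V_x^{(1)}\oplus V_x^{(2)}$; let $P_x^{(i)}$ be the projection onto $V_x^{(i)}$ along the other summand, and put $$\check R^{\Box}(u,v;x)=(q^2u-v)P_x^{(1)}+(q^2v-u)P_x^{(2)},\qquad u,v\in\mathbb{C}.$$ These satisfy $(\check R^{\Box}(v,w;x)\otimes I)(I\otimes \check R^{\Box}(u,w;qx))(\check R^{\Box}(u,v;x)\otimes I)=(I\otimes \check R^{\Box}(u,v;qx))(\check R^{\Box}(u,w;x)\otimes I)(I\otimes \check R^{\Box}(v,w;qx))$. **Operators indexed by permutations.** For $m\ge 1$ let $W_x^{(m)}=V_x\otimes V_{qx}\otimes\cdots\otimes V_{q^{m-1}x}$ and, for $1\le i\le m-1$, $$\check R_i(u,v;x)=I^{\otimes (i-1)}\otimes\check R^{\Box}(u,v;q^{i-1}x)\otimes I^{\otimes (m-i-1)}\in\mathrm{End}(W_x^{(m)}).$$ Let $\sigma_i=(i,i+1)\in S_m$ and let $\ell$ be the length function on $S_m$ with respect to $\sigma_1,\dots,\sigma_{m-1}$. For $a\in\mathbb{C}^m$ and $\sigma\in S_m$ put $\sigma[a]=(a_{\sigma^{-1}(1)},\dots,a_{\sigma^{-1}(m)})$.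 The operators $\check R(a;x|\sigma)\in\mathrm{End}(W_x^{(m)})$ are (well-)defined inductively by $\check R(a;x|1)=I^{\otimes m}$, $\check R(a;x|\sigma_i)=\check R_i(a_i,a_{i+1};x)$, and $\check R(a;x|\sigma'\sigma)=\check R(\sigma[a];x|\sigma')\,\check R(a;x|\sigma)$ whenever $\ell(\sigma'\sigma)=\ell(\sigma')+\ell(\sigma)$. **Hecke algebra.** $H=H_n(q^2)$ is the associative $\mathbb{C}$-algebra with generators $h_i$ ($1\le i\le n-1$) and relations $(h_i-q^2)(h_i+1)=0$, $h_ih_{i+1}h_i=h_{i+1}h_ih_{i+1}$, $h_ih_j=h_jh_i$ ($|i-j|\ge 2$). It has a $\mathbb{C}$-basis $\{h(\sigma)\mid\sigma\in S_n\}$ with $h(1)=1$, $h(\sigma_i)=h_i$, and $h(\sigma'\sigma)=h(\sigma')h(\sigma)$ if $\ell(\sigma'\sigma)=\ell(\sigma')+\ell(\sigma)$. Put $$e_+=\sum_{\sigma\in S_n}h(\sigma),\qquad e_-=\sum_{\sigma\in S_n}(-q^{-2})^{\ell(\sigma)}h(\sigma).$$ There is a unique representation $\pi_x^{(n)}:H\to\mathrm{End}(W_x^{(n)})$ with $\check R_i(u,v;x)=\pi_x^{(n)}(uh_i-vq^2h_i^{-1})$ for all $u,v\in\mathbb{C}$ and $1\le i\le n-1$. Put $V_{\pm,x}=\pi_x^{(n)}(e_\pm)W_x^{(n)}$. **The fused operator.** Let $p_\pm=(1,q^{\mp2},\dots,q^{\mp2(n-1)})\in\mathbb{C}^n$;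 let $\gamma_n\in S_n$ be $\gamma_n(i)=n-i+1$; let $\tau\in S_{2n}$ be $\tau(i)=i+n$, $\tau(n+i)=i$ ($1\le i\le n$). For $g,h\in\mathbb{C}^n$ let $g\cup h=(g_1,\dots,g_n,h_1,\dots,h_n)\in\mathbb{C}^{2n}$. For $u,v\in\mathbb{C}$, the operator $\check R(\gamma_n[up_\pm]\cup\gamma_n[vp_\pm];x|\tau)$ on $W_x^{(2n)}=W_x^{(n)}\otimes W_{q^nx}^{(n)}$ preserves the subspace $V_{\pm,x}\otimes V_{\pm,q^nx}$, and one defines $$\check R^{\pm,(n)}(u,v;x)=\check R(\gamma_n[up_\pm]\cup\gamma_n[vp_\pm];x|\tau)\big|_{V_{\pm,x}\otimes V_{\pm,q^nx}}\in\mathrm{End}(V_{\pm,x}\otimes V_{\pm,q^nx}).$$ In all formulas the upper signs, or the lower signs, are taken consistently. *)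

theory Defs
  imports
    Complex_Main
    "HOL-Algebra.QuotRing"
    "HOL-Combinatorics.Permutations"
    "HOL-Library.Function_Algebras"
begin

section \<open>Tensors\<close>

text \<open>
  A function on words stands for a formal linear combination of words. The word
  \<open>[i, j, \<dots>]\<close> is the basis vector \<open>e_i \<otimes> e_j \<otimes> \<dots>\<close> of the tensor algebra of the
  4-dimensional space with basis \<open>e_1, \<dots>, e_4\<close>. The same type also carries the free
  associative algebra from which the Hecke algebra is built below; there the words are monomials
  in the generators.
\<close>

type_synonym tensor = "nat list \<Rightarrow> complex"

definition scale :: "complex \<Rightarrow> tensor \<Rightarrow> tensor" where
  "scale c t = (\<lambda>w. c * t w)"

interpretation tensor: vector_space scale
  by unfold_locales (auto simp: scale_def fun_eq_iff algebra_simps)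

definition basis :: "nat list \<Rightarrow> tensor" where
  "basis w = (\<lambda>v. if v = w then 1 else 0)"

text \<open>
  Bilinear extension of concatenation of words. For homogeneous elements of the tensor algebra
  this is \<open>s \<otimes> t\<close>.
\<close>

definition conc :: "tensor \<Rightarrow> tensor \<Rightarrow> tensor" where
  "conc s t = (\<lambda>w. \<Sum>k\<le>length w. s (take k w) * t (drop k w))"

text \<open>
  The \<open>m\<close>-th tensor power of \<open>\<complex>\<^sup>4\<close>. It is the underlying space of \<open>W_x\<^sup>(\<^sup>m\<^sup>)\<close> for every \<open>x\<close>; the
  parameter only enters the operators.
\<close>

definition W :: "nat \<Rightarrow> tensor set" where
  "W m = {t. \<forall>w. t w \<noteq> 0 \<longrightarrow> length w = m \<and> set w \<subseteq> {1..4}}"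

definition tensor_space :: "tensor set \<Rightarrow> tensor set \<Rightarrow> tensor set" where
  "tensor_space A B = tensor.span {conc s t | s t. s \<in> A \<and> t \<in> B}"

section \<open>Linear operators on subspaces\<close>

text \<open>
  Operators on a subspace \<open>U\<close> are extensional functions (\<^term>\<open>undefined\<close> off \<open>U\<close>), so that equality
  of operators is equality on \<open>U\<close>. Their product is \<^term>\<open>compose U\<close>.
\<close>

definition endos :: "tensor set \<Rightarrow> (tensor \<Rightarrow> tensor) set" where
  "endos U = {F \<in> U \<rightarrow>\<^sub>E U.
     (\<forall>s\<in>U. \<forall>t\<in>U. F (s + t) = F s + F t) \<and> (\<forall>c. \<forall>t\<in>U. F (scale c t) = scale c (F t))}"

definition ident :: "tensor set \<Rightarrow> tensor \<Rightarrow> tensor" where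
  "ident U = (\<lambda>t\<in>U. t)"

definition endo_ring :: "tensor set \<Rightarrow> (tensor \<Rightarrow> tensor) ring" where
  "endo_ring U = \<lparr>carrier = endos U, monoid.mult = compose U, one = ident U,
     zero = (\<lambda>t\<in>U. 0), add = (\<lambda>F G. \<lambda>t\<in>U. F t + G t)\<rparr>"

text \<open>
  \<open>op_tensor A F B G\<close> is \<open>F \<otimes> G\<close> for \<open>F \<in> End(A)\<close> and \<open>G \<in> End(B)\<close>. The spaces have to be passed
  explicitly, since they cannot be recovered from the functions.
\<close>

definition op_tensor ::
  "tensor set \<Rightarrow> (tensor \<Rightarrow> tensor) \<Rightarrow> tensor set \<Rightarrow> (tensor \<Rightarrow> tensor) \<Rightarrow> tensor \<Rightarrow> tensor" where
  "op_tensor A F B G = (THE T. T \<in> endos (tensor_space A B) \<and>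
     (\<forall>s\<in>A. \<forall>t\<in>B. T (conc s t) = conc (F s) (G t)))"

text \<open>Projection of \<open>U = A \<oplus> B\<close> onto \<open>A\<close> along \<open>B\<close>.\<close>

definition proj_along :: "tensor set \<Rightarrow> tensor set \<Rightarrow> tensor set \<Rightarrow> tensor \<Rightarrow> tensor" where
  "proj_along U A B = (\<lambda>t\<in>U. THE a. a \<in> A \<and> t - a \<in> B)"

section \<open>The basic operator\<close>

definition theta :: "nat \<Rightarrow> nat" where
  "theta i = (if i \<in> {3, 4} then 1 else 0)"

definition V1 :: "complex \<Rightarrow> complex \<Rightarrow> tensor set" where
  "V1 q x = tensor.span ({basis [3, 3], basis [4, 4]} \<union>
     {basis [i, j] - scale ((-1) ^ (theta i * theta j) * q) (basis [j, i])
       + (if i = 1 \<and> j = 2 then scale (q ^ 3 * x) (basis [3, 4]) + scale x (basis [4, 3]) else 0)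
      | i j. 1 \<le> i \<and> i < j \<and> j \<le> 4})"

definition V2 :: "complex \<Rightarrow> tensor set" where
  "V2 q = tensor.span ({basis [1, 1], basis [2, 2]} \<union>
     {basis [i, j] + scale ((-1) ^ (theta i * theta j) * inverse q) (basis [j, i])
      | i j. 1 \<le> i \<and> i < j \<and> j \<le> 4})"

definition R_box :: "complex \<Rightarrow> complex \<Rightarrow> complex \<Rightarrow> complex \<Rightarrow> tensor \<Rightarrow> tensor" where
  "R_box q u v x = (\<lambda>t\<in>W 2.
     scale (q\<^sup>2 * u - v) (proj_along (W 2) (V1 q x) (V2 q) t) +
     scale (q\<^sup>2 * v - u) (proj_along (W 2) (V2 q) (V1 q x) t))"

section \<open>Operators indexed by permutations\<close>

text \<open>
  The group \<open>S_m\<close> consists of the functions \<open>\<sigma>\<close> with \<open>\<sigma> permutes {1..m}\<close>, and its product is \<open>\<circ>\<close>.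
  A vector \<open>a \<in> \<complex>\<^sup>m\<close> is a function on indices of which only the values on \<open>{1..m}\<close> matter.
\<close>

definition adj :: "nat \<Rightarrow> nat \<Rightarrow> nat" where
  "adj i = transpose i (i + 1)"

definition perm_length :: "nat \<Rightarrow> (nat \<Rightarrow> nat) \<Rightarrow> nat" where
  "perm_length m \<sigma> =
     (LEAST k. \<exists>is. length is = k \<and> set is \<subseteq> {1..<m} \<and> \<sigma> = foldr (\<circ>) (map adj is) id)"

definition act :: "(nat \<Rightarrow> nat) \<Rightarrow> (nat \<Rightarrow> complex) \<Rightarrow> nat \<Rightarrow> complex" where
  "act \<sigma> a = (\<lambda>i. a (inv_into UNIV \<sigma> i))"

definition R_adj ::
  "nat \<Rightarrow> complex \<Rightarrow> nat \<Rightarrow> complex \<Rightarrow> complex \<Rightarrow> complex \<Rightarrow> tensor \<Rightarrow> tensor" where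
  "R_adj m q i u v x =
     op_tensor (W (i - 1)) (ident (W (i - 1))) (W (m - i + 1))
       (op_tensor (W 2) (R_box q u v (q ^ (i - 1) * x)) (W (m - i - 1)) (ident (W (m - i - 1))))"

text \<open>
  The relation records all ways of building an operator for \<open>\<sigma>\<close>; by the Yang--Baxter equation of
  \<^const>\<open>R_box\<close> the result depends only on \<open>a\<close> and \<open>\<sigma>\<close>. The same pattern is used for the basis
  \<open>h(\<sigma>)\<close> of the Hecke algebra.
\<close>

inductive R_perm_rel ::
  "nat \<Rightarrow> complex \<Rightarrow> complex \<Rightarrow> (nat \<Rightarrow> complex) \<Rightarrow> (nat \<Rightarrow> nat) \<Rightarrow> (tensor \<Rightarrow> tensor) \<Rightarrow> bool"
  for m :: nat and q x :: complex where
  one: "R_perm_rel m q x a id (ident (W m))"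
| adj: "i \<in> {1..<m} \<Longrightarrow> R_perm_rel m q x a (adj i) (R_adj m q i (a i) (a (i + 1)) x)"
| mult: "R_perm_rel m q x a \<sigma> A \<Longrightarrow> R_perm_rel m q x (act \<sigma> a) \<sigma>' B \<Longrightarrow>
    perm_length m (\<sigma>' \<circ> \<sigma>) = perm_length m \<sigma>' + perm_length m \<sigma> \<Longrightarrow>
    R_perm_rel m q x a (\<sigma>' \<circ> \<sigma>) (compose (W m) B A)"

definition R_perm ::
  "nat \<Rightarrow> complex \<Rightarrow> (nat \<Rightarrow> complex) \<Rightarrow> complex \<Rightarrow> (nat \<Rightarrow> nat) \<Rightarrow> tensor \<Rightarrow> tensor" where
  "R_perm m q a x \<sigma> = (THE A. R_perm_rel m q x a \<sigma> A)"

section \<open>The Hecke algebra\<close>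

definition free_alg :: "nat \<Rightarrow> tensor ring" where
  "free_alg n = \<lparr>carrier = {f. finite {w. f w \<noteq> 0} \<and> (\<forall>w. f w \<noteq> 0 \<longrightarrow> set w \<subseteq> {1..<n})},
     monoid.mult = conc, one = basis [], zero = 0, add = (+)\<rparr>"

definition hecke_relators :: "nat \<Rightarrow> complex \<Rightarrow> tensor set" where
  "hecke_relators n q =
     {conc (basis [i] - scale (q\<^sup>2) (basis [])) (basis [i] + basis []) | i. i \<in> {1..<n}} \<union>
     {basis [i, i + 1, i] - basis [i + 1, i, i + 1] | i. i \<in> {1..<n} \<and> i + 1 \<in> {1..<n}} \<union>
     {basis [i, j] - basis [j, i] | i j. i \<in> {1..<n} \<and> j \<in> {1..<n} \<and> (i + 2 \<le> j \<or> j + 2 \<le> i)}"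

definition hecke_ideal :: "nat \<Rightarrow> complex \<Rightarrow> tensor set" where
  "hecke_ideal n q = Idl\<^bsub>free_alg n\<^esub> (hecke_relators n q)"

text \<open>
  \<open>H_n(q\<^sup>2)\<close>. Its scalar multiplication is multiplication by the (central) classes of multiples of
  the unit.
\<close>

definition hecke :: "nat \<Rightarrow> complex \<Rightarrow> tensor set ring" where
  "hecke n q = free_alg n Quot hecke_ideal n q"

definition hecke_class :: "nat \<Rightarrow> complex \<Rightarrow> tensor \<Rightarrow> tensor set" where
  "hecke_class n q f = hecke_ideal n q +>\<^bsub>free_alg n\<^esub> f"

definition hecke_gen :: "nat \<Rightarrow> complex \<Rightarrow> nat \<Rightarrow> tensor set" where
  "hecke_gen n q i = hecke_class n q (basis [i])"

definition hecke_scale :: "nat \<Rightarrow> complex \<Rightarrow> complex \<Rightarrow> tensor set \<Rightarrow> tensor set" where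
  "hecke_scale n q c h = hecke_class n q (scale c (basis [])) \<otimes>\<^bsub>hecke n q\<^esub> h"

inductive hecke_basis_rel :: "nat \<Rightarrow> complex \<Rightarrow> (nat \<Rightarrow> nat) \<Rightarrow> tensor set \<Rightarrow> bool"
  for n :: nat and q :: complex where
  one: "hecke_basis_rel n q id \<one>\<^bsub>hecke n q\<^esub>"
| adj: "i \<in> {1..<n} \<Longrightarrow> hecke_basis_rel n q (adj i) (hecke_gen n q i)"
| mult: "hecke_basis_rel n q \<sigma>' h' \<Longrightarrow> hecke_basis_rel n q \<sigma> h \<Longrightarrow>
    perm_length n (\<sigma>' \<circ> \<sigma>) = perm_length n \<sigma>' + perm_length n \<sigma> \<Longrightarrow>
    hecke_basis_rel n q (\<sigma>' \<circ> \<sigma>) (h' \<otimes>\<^bsub>hecke n q\<^esub> h)"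

definition hecke_basis :: "nat \<Rightarrow> complex \<Rightarrow> (nat \<Rightarrow> nat) \<Rightarrow> tensor set" where
  "hecke_basis n q \<sigma> = (THE h. hecke_basis_rel n q \<sigma> h)"

datatype sign = Plus | Minus

definition hecke_e :: "sign \<Rightarrow> nat \<Rightarrow> complex \<Rightarrow> tensor set" where
  "hecke_e s n q = (\<Oplus>\<^bsub>hecke n q\<^esub>\<sigma>\<in>{\<sigma>. \<sigma> permutes {1..n}}.
     hecke_scale n q (case s of Plus \<Rightarrow> 1 | Minus \<Rightarrow> (- inverse (q\<^sup>2)) ^ perm_length n \<sigma>)
       (hecke_basis n q \<sigma>))"

definition hecke_rep :: "nat \<Rightarrow> complex \<Rightarrow> complex \<Rightarrow> tensor set \<Rightarrow> tensor \<Rightarrow> tensor" where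
  "hecke_rep n q x = (THE \<pi>.
     \<pi> \<in> extensional (carrier (hecke n q)) \<and>
     \<pi> \<in> ring_hom (hecke n q) (endo_ring (W n)) \<and>
     (\<forall>c. \<forall>h\<in>carrier (hecke n q). \<forall>t\<in>W n. \<pi> (hecke_scale n q c h) t = scale c (\<pi> h t)) \<and>
     (\<forall>i\<in>{1..<n}. \<forall>u v. R_adj n q i u v x =
        \<pi> (hecke_scale n q u (hecke_gen n q i) \<ominus>\<^bsub>hecke n q\<^esub>
             hecke_scale n q (v * q\<^sup>2) (inv\<^bsub>hecke n q\<^esub> (hecke_gen n q i)))))"

section \<open>The fused operator\<close>

definition fused_space :: "sign \<Rightarrow> nat \<Rightarrow> complex \<Rightarrow> complex \<Rightarrow> tensor set" where
  "fused_space s n q x = hecke_rep n q x (hecke_e s n q) ` W n"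

definition p_vec :: "sign \<Rightarrow> complex \<Rightarrow> nat \<Rightarrow> complex" where
  "p_vec s q = (\<lambda>i. (case s of Plus \<Rightarrow> inverse (q\<^sup>2) | Minus \<Rightarrow> q\<^sup>2) ^ (i - 1))"

definition gamma_perm :: "nat \<Rightarrow> nat \<Rightarrow> nat" where
  "gamma_perm n = (\<lambda>i. if i \<in> {1..n} then n - i + 1 else i)"

definition tau_perm :: "nat \<Rightarrow> nat \<Rightarrow> nat" where
  "tau_perm n = (\<lambda>i. if i \<in> {1..n} then i + n else if i \<in> {n+1..2*n} then i - n else i)"

definition join :: "nat \<Rightarrow> (nat \<Rightarrow> complex) \<Rightarrow> (nat \<Rightarrow> complex) \<Rightarrow> nat \<Rightarrow> complex" where
  "join n g h = (\<lambda>i. if i \<le> n then g i else h (i - n))"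

definition fused_R ::
  "sign \<Rightarrow> nat \<Rightarrow> complex \<Rightarrow> complex \<Rightarrow> complex \<Rightarrow> complex \<Rightarrow> tensor \<Rightarrow> tensor" where
  "fused_R s n q u v x = restrict
     (R_perm (2 * n) q
        (join n (act (gamma_perm n) (\<lambda>i. u * p_vec s q i))
                (act (gamma_perm n) (\<lambda>i. v * p_vec s q i)))
        x (tau_perm n))
     (tensor_space (fused_space s n q x) (fused_space s n q (q ^ n * x)))"

end

theory Submission
  imports Defs
begin

text \<open>
  Let \<open>h\<close> be the operator on \<open>\<complex>\<^sup>4 \<otimes> \<complex>\<^sup>4\<close> that is \<open>q\<^sup>2\<close> on \<open>V_x\<^sup>(\<^sup>1\<^sup>)\<close> and \<open>-1\<close> on \<open>V_x\<^sup>(\<^sup>2\<^sup>)\<close>. The basic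
  operator is \<open>(u - v) h + v (q\<^sup>2 - 1)\<close>, and the operators \<open>h_i\<close> satisfy the relations of the Hecke
  algebra; the braid relation for the parameters \<open>x\<close> and \<open>q x\<close> is a finite computation
  (\<open>cross_braid\<close>). Hence the basic operator satisfies the Yang--Baxter equation, and by Matsumoto's
  theorem (\<open>run_reduced_unique\<close>) the ordered product along a reduced word depends only on the
  permutation of the word and on the initial spectral parameters (\<open>R_perm_eq\<close>).

  Given this, the fused equation is an identity between two reduced words. Let \<open>\<omega>\<close> reverse the
  order of three blocks of \<open>n\<close> strands. Let \<open>A\<close> be a reduced word for the exchange \<open>\<tau>\<close> of the first
  two blocks, and \<open>B\<close> its shift by \<open>n\<close>, which exchanges the last two. Then both \<open>ABA\<close> and \<open>BAB\<close>
  represent \<open>\<omega>\<close>, and they have \<open>3n\<^sup>2\<close> letters, which is the number of inversions of \<open>\<omega>\<close>. So both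
  words are reduced (\<open>block_words_reduced\<close>), and the two sides of the equation are the products
  along them.

  It remains to see that the product along \<open>A\<close> preserves \<open>V\<^sub>\<plusminus> \<otimes> V\<^sub>\<plusminus>\<close>. The image of \<open>e\<^sub>\<plusminus>\<close> consists
  of common eigenvectors of all \<open>h_i\<close>, with eigenvalue \<open>\<lambda> = q\<^sup>2\<close> or \<open>\<lambda> = -1\<close>. Conversely, \<open>e\<^sub>\<plusminus>\<close>
  multiplies such an eigenvector by the Poincare polynomial of the symmetric group at \<open>q\<^sup>2\<close> or
  \<open>q\<^sup>-\<^sup>2\<close>, which is not zero as \<open>q\<close> is not a root of unity. So \<open>V\<^sub>\<plusminus>\<close> is the common eigenspace
  (\<open>fused_space_eigenspace\<close>), and \<open>V\<^sub>\<plusminus> \<otimes> V\<^sub>\<plusminus>\<close> is the common eigenspace of the \<open>h_i\<close> with \<open>i \<noteq> n\<close>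
  (\<open>tensor_fused_eigenspace\<close>). Consecutive parameters within a block have ratio \<open>q\<^sup>\<plusminus>\<^sup>2\<close>, and
  there the basic operator is a multiple of \<open>h_i - \<lambda>\<close>. For \<open>i \<noteq> n\<close> one has \<open>\<tau> \<sigma>\<^sub>i = \<sigma>\<^sub>j \<tau>\<close> with
  \<open>j = \<tau>(i)\<close>, and both sides have length \<open>\<ell>(\<tau>) + 1\<close>; thus the product along \<open>A\<close> intertwines
  \<open>h_i - \<lambda>\<close> and \<open>h_j - \<lambda>\<close> up to factors (\<open>run_tau_word_invariant\<close>). These factors vanish with
  \<open>u\<close> or \<open>v\<close>. To cover that case the two parameters of a crossing are divided by the common
  factor \<open>u\<close> or \<open>v\<close> whenever both strands belong to one block, which keeps the Yang--Baxter equation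
  (\<open>yang_baxter_blocks\<close>) and does not affect \<open>A\<close>, where only strands of different blocks cross.
\<close>

section \<open>Tensors and linear operators on spaces of tensors\<close>

lemma scale_apply: "scale c t w = c * t w"
  by (simp add: scale_def)

lemmas tensor_apply = plus_fun_apply zero_fun_apply minus_apply uminus_apply scale_apply

text \<open>
  Tensors are functions, so terms of this type may occur in eta-expanded form. The pointwise rules
  would rewrite inside such expansions and are therefore applied on request only.
\<close>

declare plus_fun_apply [simp del] zero_fun_apply [simp del] minus_apply [simp del]
  uminus_apply [simp del]

lemma scale_one [simp]: "scale 1 t = t" by (simp add: fun_eq_iff tensor_apply)
lemma scale_zero [simp]: "scale 0 t = 0" by (simp add: fun_eq_iff tensor_apply)
lemma sum_tensor_apply: "(\<Sum>i\<in>S. f i) w = (\<Sum>i\<in>S. (f i :: tensor) w)"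
  by (induction S rule: infinite_finite_induct) (auto simp: tensor_apply)

lemma conc_Nil [simp]: "conc s t [] = s [] * t []"
  by (simp add: conc_def)

lemma conc_Cons: "conc s t (a # w) = s [] * t (a # w) + conc (\<lambda>v. s (a # v)) t w"
proof -
  have "conc s t (a # w) = (\<Sum>k\<le>Suc (length w). s (take k (a # w)) * t (drop k (a # w)))"
    by (simp add: conc_def)
  also have "\<dots> = s [] * t (a # w) + (\<Sum>k\<le>length w. s (a # take k w) * t (drop k w))"
    by (subst sum.atMost_Suc_shift) simp
  finally show ?thesis by (simp add: conc_def)
qed

lemma conc_add_left: "conc (s + s') t = conc s t + conc s' t"
  by (simp add: conc_def fun_eq_iff tensor_apply algebra_simps sum.distrib)
lemma conc_add_right: "conc s (t + t') = conc s t + conc s t'"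
  by (simp add: conc_def fun_eq_iff tensor_apply algebra_simps sum.distrib)
lemma conc_scale_left: "conc (scale c s) t = scale c (conc s t)"
  by (simp add: conc_def fun_eq_iff tensor_apply algebra_simps sum_distrib_left)
lemma conc_scale_right: "conc s (scale c t) = scale c (conc s t)"
  by (simp add: conc_def fun_eq_iff tensor_apply algebra_simps sum_distrib_left)
lemma conc_zero_left [simp]: "conc 0 t = 0"
  by (simp add: conc_def fun_eq_iff tensor_apply)
lemma conc_zero_right [simp]: "conc s 0 = 0"
  by (simp add: conc_def fun_eq_iff tensor_apply)
lemma conc_sum_left: "conc (\<Sum>i\<in>S. f i) t = (\<Sum>i\<in>S. conc (f i) t)"
  by (induction S rule: infinite_finite_induct) (auto simp: conc_add_left)
lemma conc_sum_right: "conc t (\<Sum>i\<in>S. f i) = (\<Sum>i\<in>S. conc t (f i))"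
  by (induction S rule: infinite_finite_induct) (auto simp: conc_add_right)

lemma conc_assoc: "conc (conc s t) u = conc s (conc t u)"
proof
  fix w show "conc (conc s t) u w = conc s (conc t u) w"
  proof (induction w arbitrary: s)
    case (Cons a w)
    have "(\<lambda>v. conc s t (a # v)) = scale (s []) (\<lambda>v. t (a # v)) + conc (\<lambda>v. s (a # v)) t"
      by (simp add: fun_eq_iff conc_Cons tensor_apply)
    then show ?case
      by (simp add: conc_Cons Cons.IH conc_add_left conc_scale_left tensor_apply algebra_simps)
  qed simp
qed

lemma basis_apply: "basis w v = (if v = w then 1 else 0)"
  by (simp add: basis_def)

lemma conc_basis: "conc (basis u) (basis v) = basis (u @ v)"
proof
  fix w show "conc (basis u) (basis v) w = basis (u @ v) w"
  proof (induction w arbitrary: u)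
    case Nil
    then show ?case by (simp add: basis_def)
  next
    case (Cons a w)
    show ?case
    proof (cases u)
      case Nil
      have "(\<lambda>v. basis [] (a # v)) = 0" by (simp add: basis_def fun_eq_iff tensor_apply)
      then show ?thesis using Nil by (simp add: conc_Cons basis_apply tensor_apply)
    next
      case (Cons b u')
      have "(\<lambda>v. basis (b # u') (a # v)) = (if a = b then basis u' else 0)"
        by (simp add: basis_def fun_eq_iff tensor_apply)
      with Cons Cons.IH[of u'] show ?thesis by (simp add: conc_Cons) (auto simp: basis_def tensor_apply)
    qed
  qed
qed

lemma conc_basis_Nil_left [simp]: "conc (basis []) t = t"
proof
  fix w show "conc (basis []) t w = t w"
  proof (cases w)
    case (Cons a v)
    have "(\<lambda>v. basis [] (a # v)) = 0" by (simp add: basis_def fun_eq_iff tensor_apply)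
    then show ?thesis using Cons by (simp add: conc_Cons basis_apply tensor_apply)
  qed (simp add: basis_def)
qed

lemma conc_basis_Nil_right [simp]: "conc t (basis []) = t"
proof
  fix w show "conc t (basis []) w = t w"
    by (induction w arbitrary: t) (auto simp: conc_Cons basis_apply)
qed

text \<open>Only one cut contributes to a product whose left factor is homogeneous.\<close>

lemma conc_homogeneous:
  assumes "s \<in> W a"
  shows "conc s t w = (if a \<le> length w then s (take a w) * t (drop a w) else 0)"
proof -
  have *: "s (take k w) * t (drop k w) = 0" if "k \<le> length w" "k \<noteq> a" for k
    using assms that by (force simp: W_def)
  show ?thesis
  proof (cases "a \<le> length w")
    case True
    have "conc s t w = (\<Sum>k\<in>{a}. s (take k w) * t (drop k w))"
      unfolding conc_def by (rule sum.mono_neutral_right) (use True * in auto)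
    then show ?thesis using True by simp
  next
    case False
    then have "conc s t w = 0" unfolding conc_def using * by (intro sum.neutral) auto
    then show ?thesis using False by simp
  qed
qed

lemma subspace_W: "tensor.subspace (W m)"
proof (rule tensor.subspaceI)
  show "0 \<in> W m" by (simp add: W_def tensor_apply)
  show "s + t \<in> W m" if "s \<in> W m" "t \<in> W m" for s t
    unfolding W_def
  proof (intro CollectI allI impI)
    fix w assume "(s + t) w \<noteq> 0"
    then have "s w \<noteq> 0 \<or> t w \<noteq> 0" by (auto simp: tensor_apply)
    then show "length w = m \<and> set w \<subseteq> {1..4}" using that by (auto simp: W_def)
  qed
  show "scale c t \<in> W m" if "t \<in> W m" for c t
    using that by (auto simp: W_def tensor_apply)
qed

text \<open>
  The words indexing the standard basis of \<^term>\<open>W m\<close>.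
\<close>

definition words :: "nat \<Rightarrow> nat list set" where
  "words m = {w. length w = m \<and> set w \<subseteq> {1..4}}"

lemma finite_words: "finite (words m)"
  using finite_lists_length_eq[of "{1..4::nat}" m] by (simp add: words_def conj_commute)

lemma basis_in_W: "basis w \<in> W m \<longleftrightarrow> w \<in> words m"
  by (auto simp: W_def words_def basis_def)

lemma W_iff: "t \<in> W m \<longleftrightarrow> (\<forall>w. w \<notin> words m \<longrightarrow> t w = 0)"
  unfolding W_def words_def by blast

lemma W_support: "t \<in> W m \<Longrightarrow> w \<notin> words m \<Longrightarrow> t w = 0"
  by (simp add: W_iff)

lemma W_expand:
  assumes "t \<in> W m"
  shows "t = (\<Sum>w\<in>words m. scale (t w) (basis w))"
proof
  fix v
  have "(\<Sum>w\<in>words m. scale (t w) (basis w)) v = (\<Sum>w\<in>words m. if w = v then t v else 0)"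
    by (auto simp: sum_tensor_apply basis_def scale_apply intro!: sum.cong)
  also have "\<dots> = t v"
    using assms by (simp add: finite_words) (auto simp: W_def words_def)
  finally show "t v = (\<Sum>w\<in>words m. scale (t w) (basis w)) v" by simp
qed

lemma W_eqI:
  assumes "s \<in> W m" "t \<in> W m" "\<And>w. w \<in> words m \<Longrightarrow> s w = t w"
  shows "s = t"
proof
  fix w show "s w = t w"
    using assms by (cases "w \<in> words m") (simp_all add: W_support[of s m] W_support[of t m])
qed

lemma conc_in_W:
  assumes "s \<in> W a" "t \<in> W b" shows "conc s t \<in> W (a + b)"
  unfolding W_def
proof (intro CollectI allI impI)
  fix w assume "conc s t w \<noteq> 0"
  then have a: "a \<le> length w" and "s (take a w) \<noteq> 0" "t (drop a w) \<noteq> 0"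
    by (auto simp: conc_homogeneous[OF assms(1)] split: if_splits)
  then have s: "set (take a w) \<subseteq> {1..4}" and "length (drop a w) = b \<and> set (drop a w) \<subseteq> {1..4}"
    using assms unfolding W_def by blast+
  then have "length w = a + b" "set (drop a w) \<subseteq> {1..4}" using a by auto
  moreover have "set w = set (take a w) \<union> set (drop a w)"
    by (simp flip: set_append)
  ultimately show "length w = a + b \<and> set w \<subseteq> {1..4}" using s by simp
qed

lemma subspace_tensor_space: "tensor.subspace (tensor_space A B)"
  by (simp add: tensor_space_def)

lemma conc_in_tensor_space: "s \<in> A \<Longrightarrow> t \<in> B \<Longrightarrow> conc s t \<in> tensor_space A B"
  unfolding tensor_space_def by (rule tensor.span_base) auto

lemma tensor_space_minimal:
  assumes "tensor.subspace U" "\<And>s t. s \<in> A \<Longrightarrow> t \<in> B \<Longrightarrow> conc s t \<in> U"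
  shows "tensor_space A B \<subseteq> U"
  unfolding tensor_space_def by (rule tensor.span_minimal) (use assms in auto)

lemma tensor_space_W: "tensor_space (W a) (W b) = W (a + b)"
proof
  show "tensor_space (W a) (W b) \<subseteq> W (a + b)"
    by (rule tensor_space_minimal) (auto simp: subspace_W conc_in_W)
  show "W (a + b) \<subseteq> tensor_space (W a) (W b)"
  proof
    fix t assume t: "t \<in> W (a + b)"
    have "basis w \<in> tensor_space (W a) (W b)" if "w \<in> words (a + b)" for w
    proof -
      have "basis w = conc (basis (take a w)) (basis (drop a w))" by (simp add: conc_basis)
      moreover have "set w = set (take a w) \<union> set (drop a w)"
        by (simp flip: set_append)
      then have "take a w \<in> words a" "drop a w \<in> words b" using that
        by (auto simp: words_def)
      ultimately show ?thesis by (simp add: conc_in_tensor_space basis_in_W)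
    qed
    then have "(\<Sum>w\<in>words (a+b). scale (t w) (basis w)) \<in> tensor_space (W a) (W b)"
      by (intro tensor.subspace_sum tensor.subspace_scale subspace_tensor_space)
    then show "t \<in> tensor_space (W a) (W b)" using W_expand[OF t] by simp
  qed
qed

lemma tensor_space_assoc:
  "tensor_space (tensor_space A B) C = tensor_space A (tensor_space B C)"
proof
  have sub: "tensor.subspace {r. conc r c \<in> U}" "tensor.subspace {r. conc c r \<in> U}"
    if "tensor.subspace U" for c U
    using that by (auto simp: tensor.subspace_def conc_add_left conc_scale_left
        conc_add_right conc_scale_right)
  show "tensor_space (tensor_space A B) C \<subseteq> tensor_space A (tensor_space B C)"
  proof (rule tensor_space_minimal[OF subspace_tensor_space])
    fix s c assume s: "s \<in> tensor_space A B" and c: "c \<in> C"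
    have "tensor_space A B \<subseteq> {r. conc r c \<in> tensor_space A (tensor_space B C)}"
      by (rule tensor_space_minimal[OF sub(1)[OF subspace_tensor_space]])
        (auto simp: conc_assoc c intro!: conc_in_tensor_space)
    with s show "conc s c \<in> tensor_space A (tensor_space B C)" by auto
  qed
  show "tensor_space A (tensor_space B C) \<subseteq> tensor_space (tensor_space A B) C"
  proof (rule tensor_space_minimal[OF subspace_tensor_space])
    fix s c assume s: "s \<in> tensor_space B C" and c: "c \<in> A"
    have "tensor_space B C \<subseteq> {r. conc c r \<in> tensor_space (tensor_space A B) C}"
      by (rule tensor_space_minimal[OF sub(2)[OF subspace_tensor_space]])
        (auto simp: conc_assoc[symmetric] c intro!: conc_in_tensor_space)
    with s show "conc c s \<in> tensor_space (tensor_space A B) C" by auto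
  qed
qed

text \<open>Operators are handled as linear maps on all tensors, restricted to the subspace at hand.\<close>

definition lin :: "(tensor \<Rightarrow> tensor) \<Rightarrow> bool" where
  "lin L \<longleftrightarrow> (\<forall>s t. L (s + t) = L s + L t) \<and> (\<forall>c t. L (scale c t) = scale c (L t))"

lemma linD: "lin L \<Longrightarrow> L (s + t) = L s + L t" "lin L \<Longrightarrow> L (scale c t) = scale c (L t)"
  by (auto simp: lin_def)

lemma lin_zero: "lin L \<Longrightarrow> L 0 = 0"
  using linD(2)[of L 0 0] by simp

lemma lin_diff: "lin L \<Longrightarrow> L (s - t) = L s - L t"
  using linD(1)[of L "s - t" t] by simp

lemma lin_sum: "lin L \<Longrightarrow> L (\<Sum>i\<in>S. f i) = (\<Sum>i\<in>S. L (f i))"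
  by (induction S rule: infinite_finite_induct) (auto simp: linD lin_zero)

lemma lin_compose: "lin L \<Longrightarrow> lin M \<Longrightarrow> lin (\<lambda>t. L (M t))"
  by (auto simp: lin_def)
lemma lin_id: "lin (\<lambda>t. t)" by (auto simp: lin_def)
lemma lin_lincomb: "lin L \<Longrightarrow> lin M \<Longrightarrow> lin (\<lambda>t. scale a (L t) + scale b (M t))"
  by (auto simp: lin_def fun_eq_iff algebra_simps tensor_apply)

lemma subspace_lin_vimage: "lin L \<Longrightarrow> tensor.subspace U \<Longrightarrow> tensor.subspace {t. L t \<in> U}"
  by (auto simp: tensor.subspace_def linD lin_zero)

lemma subspace_lin_eq: "lin L \<Longrightarrow> lin M \<Longrightarrow> tensor.subspace {t. L t = M t}"
  by (auto simp: tensor.subspace_def linD lin_zero)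

lemma restrict_in_endos:
  assumes "tensor.subspace U" "lin L" "\<And>t. t \<in> U \<Longrightarrow> L t \<in> U"
  shows "restrict L U \<in> endos U"
  using assms by (auto simp: endos_def linD tensor.subspace_add tensor.subspace_scale)

lemma endos_span_eqI:
  assumes "F \<in> endos (tensor.span S)" "G \<in> endos (tensor.span S)" "\<And>t. t \<in> S \<Longrightarrow> F t = G t"
  shows "F = G"
proof
  fix t
  have add: "F (a + b) = F a + F b" "G (a + b) = G a + G b"
    if "a \<in> tensor.span S" "b \<in> tensor.span S" for a b
    using assms(1,2) that by (auto simp: endos_def)
  have sc: "F (scale c a) = scale c (F a)" "G (scale c a) = scale c (G a)"
    if "a \<in> tensor.span S" for a c
    using assms(1,2) that by (auto simp: endos_def)
  show "F t = G t"
  proof (cases "t \<in> tensor.span S")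
    case True
    then have "t \<in> tensor.span S \<and> F t = G t"
    proof (induction rule: tensor.span_induct_alt)
      case base
      show ?case using sc[of 0 0] by (simp add: tensor.span_zero)
    next
      case (step c x y)
      have x: "x \<in> tensor.span S" using step by (simp add: tensor.span_base)
      have cx: "scale c x \<in> tensor.span S" using x by (rule tensor.span_scale)
      from step x cx show ?case
        by (auto simp: add sc assms(3) tensor.span_add)
    qed
    then show ?thesis ..
  next
    case False
    then show ?thesis using assms(1,2) by (auto simp: endos_def PiE_def extensional_def)
  qed
qed

lemma op_tensor_eqI:
  assumes "T \<in> endos (tensor_space A B)"
    and "\<And>s t. s \<in> A \<Longrightarrow> t \<in> B \<Longrightarrow> T (conc s t) = conc (F s) (G t)"
  shows "op_tensor A F B G = T"
  unfolding op_tensor_def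
proof (rule the_equality)
  show "T \<in> endos (tensor_space A B) \<and> (\<forall>s\<in>A. \<forall>t\<in>B. T (conc s t) = conc (F s) (G t))"
    using assms by auto
next
  fix T' assume *: "T' \<in> endos (tensor_space A B) \<and> (\<forall>s\<in>A. \<forall>t\<in>B. T' (conc s t) = conc (F s) (G t))"
  show "T' = T"
    by (rule endos_span_eqI[of _ "{conc s t | s t. s \<in> A \<and> t \<in> B}"])
      (use * assms in \<open>auto simp: tensor_space_def\<close>)
qed

lemma compose_in_endos:
  assumes "tensor.subspace U" "F \<in> endos U" "G \<in> endos U"
  shows "compose U F G \<in> endos U"
  using assms(2,3) tensor.subspace_add[OF assms(1)] tensor.subspace_scale[OF assms(1)]
  by (auto simp: endos_def compose_def PiE_def Pi_def)

lemma compose_restrict: "(\<And>t. t \<in> U \<Longrightarrow> G t \<in> U) \<Longrightarrow> compose U (restrict F U) (restrict G U) = restrict (\<lambda>t. F (G t)) U"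
  by (auto simp: compose_def restrict_def fun_eq_iff)

section \<open>Inversions, reduced words and Matsumoto's theorem\<close>

text \<open>Composition and identity are kept folded, so that products of permutations stay recognisable.\<close>

declare comp_apply [simp del] id_apply [simp del]

text \<open>
  Inversions of a permutation of an initial segment of the positive integers. All other numbers are
  fixed and occur in no inversion, so the segment need not be mentioned. Their number is the length.
\<close>

definition inversions :: "(nat \<Rightarrow> nat) \<Rightarrow> (nat \<times> nat) set" where
  "inversions \<sigma> = {(i, j). i < j \<and> \<sigma> j < \<sigma> i}"

definition inv_count :: "(nat \<Rightarrow> nat) \<Rightarrow> nat" where
  "inv_count \<sigma> = card (inversions \<sigma>)"

lemma adj_simps [simp]: "adj i i = i + 1" "adj i (i + 1) = i" "adj i (Suc i) = i"
  by (simp_all add: adj_def)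

lemma adj_apply: "adj i j = (if j = i then i + 1 else if j = i + 1 then i else j)"
  by (simp add: adj_def transpose_def)

lemma adj_adj [simp]: "adj i (adj i j) = j"
  by (simp add: adj_def)

lemma adj_comp_adj: "adj i \<circ> adj i = id"
  by (simp add: fun_eq_iff comp_apply id_apply)

lemma comp_adj_adj: "\<sigma> \<circ> adj i \<circ> adj i = \<sigma>"
  by (simp add: fun_eq_iff comp_apply id_apply)

lemma adj_permutes: "i \<in> {1..<m} \<Longrightarrow> adj i permutes {1..m}"
  unfolding adj_def by (rule permutes_swap_id) auto

lemma inv_adj [simp]: "inv_into UNIV (adj i) = adj i"
  by (rule inv_unique_comp) (simp_all add: adj_comp_adj)

lemma finite_inversions:
  assumes "\<sigma> permutes {1..m}" shows "finite (inversions \<sigma>)"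
proof (rule finite_subset)
  show "inversions \<sigma> \<subseteq> {1..m} \<times> {1..m}"
  proof (rule subrelI)
    fix i j assume "(i, j) \<in> inversions \<sigma>"
    then have ij: "i < j" "\<sigma> j < \<sigma> i" by (simp_all add: inversions_def)
    have inside: "1 \<le> \<sigma> k \<and> \<sigma> k \<le> m" if "1 \<le> k" "k \<le> m" for k
      using permutes_in_image[OF assms, of k] that by simp
    have outside: "\<sigma> k = k" if "\<not> (1 \<le> k \<and> k \<le> m)" for k
      using permutes_not_in[OF assms, of k] that by simp
    show "(i, j) \<in> {1..m} \<times> {1..m}"
    proof (cases "1 \<le> i \<and> i \<le> m")
      case True
      then show ?thesis using ij inside[of i] outside[of j] by (cases "j \<le> m") auto
    next
      case False
      then have "\<sigma> j < i" using ij outside[of i] by simp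
      then show ?thesis using ij False outside[of j] inside[of j] by (cases "j \<le> m") auto
    qed
  qed
qed simp

lemma inversions_comp_adj:
  assumes "\<sigma> i < \<sigma> (i + 1)"
  shows "inversions (\<sigma> \<circ> adj i) = insert (i, i + 1) (map_prod (adj i) (adj i) ` inversions \<sigma>)"
proof -
  have mono: "adj i a < adj i b" if "a < b" "(a, b) \<noteq> (i, i + 1)" for a b
    using that by (auto simp: adj_apply)
  show ?thesis
  proof (intro equalityI subsetI)
    fix p assume p: "p \<in> inversions (\<sigma> \<circ> adj i)"
    obtain a b where ab: "p = (a, b)" by (cases p)
    show "p \<in> insert (i, i + 1) (map_prod (adj i) (adj i) ` inversions \<sigma>)"
    proof (cases "p = (i, i + 1)")
      case False
      then have "(adj i a, adj i b) \<in> inversions \<sigma>" using p ab mono by (auto simp: inversions_def comp_apply id_apply)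
      moreover have "p = map_prod (adj i) (adj i) (adj i a, adj i b)" using ab by simp
      ultimately show ?thesis by blast
    qed simp
  next
    fix p assume "p \<in> insert (i, i + 1) (map_prod (adj i) (adj i) ` inversions \<sigma>)"
    then consider "p = (i, i + 1)"
      | a b where "(a, b) \<in> inversions \<sigma>" "p = (adj i a, adj i b)" by auto
    then show "p \<in> inversions (\<sigma> \<circ> adj i)"
    proof cases
      case 1
      then show ?thesis using assms by (simp add: inversions_def comp_apply)
    next
      case 2
      then have "(a, b) \<noteq> (i, i + 1)" using assms by (auto simp: inversions_def comp_apply id_apply)
      with 2 mono show ?thesis by (auto simp: inversions_def comp_apply id_apply)
    qed
  qed
qed

lemma inv_count_up:
  assumes "\<sigma> permutes {1..m}" "\<sigma> i < \<sigma> (i + 1)"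
  shows "inv_count (\<sigma> \<circ> adj i) = Suc (inv_count \<sigma>)"
proof -
  have "(i, i + 1) \<notin> map_prod (adj i) (adj i) ` inversions \<sigma>"
  proof
    assume "(i, i + 1) \<in> map_prod (adj i) (adj i) ` inversions \<sigma>"
    then obtain a b where "a < b" and ab: "adj i a = i" "adj i b = i + 1"
      unfolding inversions_def by force
    have "a = i + 1" "b = i" using adj_adj[of i a] adj_adj[of i b] by (simp_all add: ab)
    with \<open>a < b\<close> show False by simp
  qed
  moreover have "inj_on (map_prod (adj i) (adj i)) (inversions \<sigma>)"
    by (rule inj_on_inverseI[of _ "map_prod (adj i) (adj i)"]) auto
  ultimately show ?thesis
    unfolding inv_count_def inversions_comp_adj[OF assms(2)]
    using finite_inversions[OF assms(1)] by (simp add: card_image)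
qed

lemma inv_count_down:
  assumes "\<sigma> permutes {1..m}" "i \<in> {1..<m}" "\<sigma> (i + 1) < \<sigma> i"
  shows "Suc (inv_count (\<sigma> \<circ> adj i)) = inv_count \<sigma>"
proof -
  have "\<sigma> \<circ> adj i permutes {1..m}"
    using assms adj_permutes permutes_compose by blast
  from inv_count_up[OF this, of i] show ?thesis using assms(3) by (simp add: comp_adj_adj comp_apply)
qed

text \<open>
  The permutation represented by a word in the adjacent transpositions. The head of the word is the
  factor that is applied first.
\<close>

primrec word_perm :: "nat list \<Rightarrow> nat \<Rightarrow> nat" where
  "word_perm [] = id"
| "word_perm (i # is) = word_perm is \<circ> adj i"

lemma word_perm_append: "word_perm (is @ js) = word_perm js \<circ> word_perm is"
  by (induction "is") (auto simp: o_assoc)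

lemma word_perm_foldr: "foldr (\<circ>) (map adj is) id = word_perm (rev is)"
  by (induction "is") (simp_all add: word_perm_append comp_apply[where f = "(\<circ>) _"] id_apply)

lemma word_perm_permutes: "set is \<subseteq> {1..<m} \<Longrightarrow> word_perm is permutes {1..m}"
proof (induction "is")
  case (Cons i "is")
  then have "i \<in> {1..<m}" "set is \<subseteq> {1..<m}" by simp_all
  with Cons.IH show ?case
    unfolding word_perm.simps by (intro permutes_compose adj_permutes)
qed (simp add: permutes_id)

lemma comp_adj_cases:
  assumes "\<sigma> permutes {1..m}" "i \<in> {1..<m}"
  obtains "\<sigma> i < \<sigma> (i + 1)" "inv_count (\<sigma> \<circ> adj i) = Suc (inv_count \<sigma>)"
  | "\<sigma> (i + 1) < \<sigma> i" "Suc (inv_count (\<sigma> \<circ> adj i)) = inv_count \<sigma>"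
proof -
  have "\<sigma> i \<noteq> \<sigma> (i + 1)" by (simp add: inj_eq[OF permutes_inj[OF assms(1)]])
  then consider "\<sigma> i < \<sigma> (i + 1)" | "\<sigma> (i + 1) < \<sigma> i" by linarith
  then show ?thesis
  proof cases
    case 1
    show ?thesis by (rule that(1)[OF 1 inv_count_up[OF assms(1) 1]])
  next
    case 2
    show ?thesis by (rule that(2)[OF 2 inv_count_down[OF assms 2]])
  qed
qed

lemma inv_count_id: "inv_count id = 0"
proof -
  have "inversions id = {}" by (auto simp: inversions_def comp_apply id_apply)
  then show ?thesis by (simp add: inv_count_def)
qed

lemma inv_count_word_perm_le: "set is \<subseteq> {1..<m} \<Longrightarrow> inv_count (word_perm is) \<le> length is"
proof (induction "is")
  case (Cons i "is")
  then have "set is \<subseteq> {1..<m}" "i \<in> {1..<m}" by simp_all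
  with Cons.IH show ?case
    by (cases rule: comp_adj_cases[OF word_perm_permutes[OF \<open>set is \<subseteq> _\<close>] \<open>i \<in> _\<close>]) auto
qed (simp add: inv_count_id)

lemma permutes_no_descent_eq_id:
  assumes "\<sigma> permutes {1..m::nat}" "\<And>i. i \<in> {1..<m} \<Longrightarrow> \<sigma> i < \<sigma> (i + 1)"
  shows "\<sigma> = id"
proof -
  have "i \<le> m \<longrightarrow> i \<le> \<sigma> i" for i :: nat
  proof (induction i)
    case (Suc i)
    show ?case
    proof (cases "i = 0")
      case True
      then show ?thesis using permutes_in_image[OF assms(1), of 1] by auto
    next
      case False
      then show ?thesis using Suc assms(2)[of i] by auto
    qed
  qed simp
  then show ?thesis by (intro permutes_natset_ge[OF assms(1)]) auto
qed

lemma reduced_word_exists: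
  assumes "\<sigma> permutes {1..m}"
  shows "\<exists>is. set is \<subseteq> {1..<m} \<and> word_perm is = \<sigma> \<and> length is = inv_count \<sigma>"
  using assms
proof (induction "inv_count \<sigma>" arbitrary: \<sigma>)
  case 0
  have "\<sigma> = id"
  proof (rule permutes_no_descent_eq_id[OF "0.prems"])
    fix i assume "i \<in> {1..<m}"
    from comp_adj_cases[OF "0.prems" this] show "\<sigma> i < \<sigma> (i + 1)" using "0.hyps" by fastforce
  qed
  then show ?case using "0.hyps" by (intro exI[of _ "[]"]) simp
next
  case (Suc k)
  have "\<sigma> \<noteq> id" using Suc.hyps(2) inv_count_id by auto
  then obtain i where i: "i \<in> {1..<m}" "\<not> \<sigma> i < \<sigma> (i + 1)"
    using permutes_no_descent_eq_id[OF Suc.prems] by blast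
  then have count: "Suc (inv_count (\<sigma> \<circ> adj i)) = inv_count \<sigma>"
    using comp_adj_cases[OF Suc.prems i(1)] by metis
  moreover have "\<sigma> \<circ> adj i permutes {1..m}"
    using Suc.prems i(1) adj_permutes permutes_compose by blast
  ultimately obtain "is" where "set is \<subseteq> {1..<m}" "word_perm is = \<sigma> \<circ> adj i"
      "length is = inv_count (\<sigma> \<circ> adj i)"
    using Suc.hyps by (metis Suc_inject)
  with i(1) count show ?case
    by (intro exI[of _ "i # is"]) (auto simp: comp_adj_adj)
qed

lemma perm_length_eq_inv_count:
  assumes "\<sigma> permutes {1..m}" shows "perm_length m \<sigma> = inv_count \<sigma>"
  unfolding perm_length_def
proof (rule Least_equality)
  obtain "is" where "set is \<subseteq> {1..<m}" "word_perm is = \<sigma>" "length is = inv_count \<sigma>"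
    using reduced_word_exists[OF assms] by blast
  then show "\<exists>is. length is = inv_count \<sigma> \<and> set is \<subseteq> {1..<m} \<and> \<sigma> = foldr (\<circ>) (map adj is) id"
    by (intro exI[of _ "rev is"]) (auto simp: word_perm_foldr)
next
  fix k assume "\<exists>is. length is = k \<and> set is \<subseteq> {1..<m} \<and> \<sigma> = foldr (\<circ>) (map adj is) id"
  then obtain "is" where is_word: "length is = k" "set is \<subseteq> {1..<m}" "\<sigma> = word_perm (rev is)"
    by (auto simp: word_perm_foldr)
  then show "inv_count \<sigma> \<le> k"
    using inv_count_word_perm_le[of "rev is" m] by auto
qed

text \<open>
  Reduced words for \<open>\<sigma>\<close> in the generators of the symmetric group on \<open>m\<close> letters.
\<close>

definition reduced_word :: "nat \<Rightarrow> nat list \<Rightarrow> (nat \<Rightarrow> nat) \<Rightarrow> bool" where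
  "reduced_word m is \<sigma> \<longleftrightarrow> set is \<subseteq> {1..<m} \<and> word_perm is = \<sigma> \<and> length is = inv_count \<sigma>"

lemma reduced_word_permutes: "reduced_word m is \<sigma> \<Longrightarrow> \<sigma> permutes {1..m}"
  using word_perm_permutes by (auto simp: reduced_word_def)

lemma reduced_word_Cons:
  "reduced_word m (i # is) \<sigma> \<longleftrightarrow>
    \<sigma> permutes {1..m} \<and> i \<in> {1..<m} \<and> \<sigma> (i + 1) < \<sigma> i \<and> reduced_word m is (\<sigma> \<circ> adj i)"
proof
  assume L: "reduced_word m (i # is) \<sigma>"
  then have w: "set is \<subseteq> {1..<m}" "i \<in> {1..<m}" "word_perm is \<circ> adj i = \<sigma>"
    "Suc (length is) = inv_count \<sigma>" by (auto simp: reduced_word_def)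
  have \<sigma>: "word_perm is = \<sigma> \<circ> adj i" using w(3) comp_adj_adj by metis
  have p: "word_perm is permutes {1..m}" using w(1) by (rule word_perm_permutes)
  have "inv_count (word_perm is) \<le> length is" using w(1) by (rule inv_count_word_perm_le)
  with comp_adj_cases[OF p w(2)] w(3,4)
  have "word_perm is i < word_perm is (i + 1)" "inv_count (word_perm is) = length is"
    by fastforce+
  then show "\<sigma> permutes {1..m} \<and> i \<in> {1..<m} \<and> \<sigma> (i + 1) < \<sigma> i \<and> reduced_word m is (\<sigma> \<circ> adj i)"
    using w(1,2) reduced_word_permutes[OF L] by (auto simp: \<sigma> reduced_word_def comp_apply)
next
  assume R: "\<sigma> permutes {1..m} \<and> i \<in> {1..<m} \<and> \<sigma> (i + 1) < \<sigma> i \<and> reduced_word m is (\<sigma> \<circ> adj i)"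
  then have "Suc (inv_count (\<sigma> \<circ> adj i)) = inv_count \<sigma>" using inv_count_down by blast
  with R show "reduced_word m (i # is) \<sigma>"
    by (auto simp: reduced_word_def comp_adj_adj)
qed

lemma reduced_word_ex: "\<sigma> permutes {1..m} \<Longrightarrow> \<exists>is. reduced_word m is \<sigma>"
  using reduced_word_exists by (auto simp: reduced_word_def)

lemma reduced_word_appendI:
  assumes "reduced_word m is \<sigma>" "reduced_word m js \<rho>"
    and "inv_count (\<rho> \<circ> \<sigma>) = inv_count \<rho> + inv_count \<sigma>"
  shows "reduced_word m (is @ js) (\<rho> \<circ> \<sigma>)"
  using assms by (auto simp: reduced_word_def word_perm_append)

text \<open>
  The ordered product along a word of operations depending on the labels of the two strands
  that cross. The labels travel with the strands.
\<close>

primrec run :: "('c \<Rightarrow> 'c \<Rightarrow> nat \<Rightarrow> 's \<Rightarrow> 's) \<Rightarrow> (nat \<Rightarrow> 'c) \<Rightarrow> nat list \<Rightarrow> 's \<Rightarrow> 's" where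
  "run step a [] y = y"
| "run step a (i # is) y = run step (a \<circ> adj i) is (step (a i) (a (i + 1)) i y)"

lemma act_adj: "act (adj i) a = a \<circ> adj i"
  by (simp add: act_def fun_eq_iff comp_apply id_apply)

lemma run_append:
  assumes "set is \<subseteq> {1..<m}"
  shows "run step a (is @ js) y = run step (a \<circ> inv_into UNIV (word_perm is)) js (run step a is y)"
  using assms
proof (induction "is" arbitrary: a y)
  case (Cons i "is")
  have "inv_into UNIV (word_perm is \<circ> adj i) = adj i \<circ> inv_into UNIV (word_perm is)"
    using Cons.prems word_perm_permutes[of "is" m] adj_permutes[of i m]
    by (subst o_inv_distrib) (auto simp: permutes_bij)
  then show ?case using Cons by (simp add: o_assoc)
qed simp

lemma run_cong:
  assumes "set is \<subseteq> {1..<m}" "\<And>i. i \<in> {1..m} \<Longrightarrow> a i = b i"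
  shows "run step a is y = run step b is y"
  using assms
proof (induction "is" arbitrary: a b y)
  case (Cons i "is")
  have "run step (a \<circ> adj i) is z = run step (b \<circ> adj i) is z" for z
    using Cons.prems permutes_in_image[OF adj_permutes[of i m]] by (intro Cons.IH) (auto simp: comp_apply)
  then show ?case using Cons.prems by auto
qed simp

text \<open>
  Operations on a set of states that satisfy the labelled braid relation, that is, the Yang--Baxter
  equation, and that commute when they involve disjoint pairs of strands.
\<close>

locale word_action =
  fixes m :: nat and S :: "'s set" and step :: "'c \<Rightarrow> 'c \<Rightarrow> nat \<Rightarrow> 's \<Rightarrow> 's"
  assumes step_closed: "i \<in> {1..<m} \<Longrightarrow> y \<in> S \<Longrightarrow> step a b i y \<in> S"
    and step_braid: "i \<in> {1..<m} \<Longrightarrow> i + 1 \<in> {1..<m} \<Longrightarrow> y \<in> S \<Longrightarrow>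
      step b c i (step a c (i + 1) (step a b i y)) =
      step a b (i + 1) (step a c i (step b c (i + 1) y))"
    and step_commute: "i \<in> {1..<m} \<Longrightarrow> j \<in> {1..<m} \<Longrightarrow> i + 2 \<le> j \<Longrightarrow> y \<in> S \<Longrightarrow>
      step a b i (step c d j y) = step c d j (step a b i y)"
begin

lemma run_closed: "set is \<subseteq> {1..<m} \<Longrightarrow> y \<in> S \<Longrightarrow> run step a is y \<in> S"
  by (induction "is" arbitrary: a y) (auto simp: step_closed)

text \<open>
  Matsumoto's theorem. If two reduced words of \<open>\<sigma>\<close> start with different letters \<open>i\<close> and \<open>j\<close>, then
  \<open>\<sigma>\<close> descends at both places, so it also has reduced words starting with either side of the
  commutation or braid relation between \<open>i\<close> and \<open>j\<close>.
\<close>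

theorem run_reduced_unique:
  assumes "reduced_word m is \<sigma>" "reduced_word m js \<sigma>" "y \<in> S"
  shows "run step a is y = run step a js y"
  using assms
proof (induction "length is" arbitrary: "is" js \<sigma> a y rule: less_induct)
  case less
  have distinct_letters: "run step a (i # ks) y = run step a (j # ls) y"
    if len: "length ks < length is" "length ls < length is" and "i < j"
      and w: "reduced_word m (i # ks) \<sigma>" "reduced_word m (j # ls) \<sigma>" for i j ks ls
  proof -
    note wi = w(1)[unfolded reduced_word_Cons] and wj = w(2)[unfolded reduced_word_Cons]
    have IH: "run step b ks' z = run step b ls' z"
      if "length ks' < length is" "reduced_word m ks' \<rho>" "reduced_word m ls' \<rho>" "z \<in> S"
      for b ks' ls' \<rho> z using less.hyps that by blast
    have \<sigma>: "\<sigma> permutes {1..m}" using wi by blast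
    have i: "i \<in> {1..<m}" "\<sigma> (i + 1) < \<sigma> i" and j: "j \<in> {1..<m}" "\<sigma> (j + 1) < \<sigma> j"
      using wi wj by blast+
    have perm: "\<rho> \<circ> adj k permutes {1..m}" if "\<rho> permutes {1..m}" "k \<in> {1..<m}" for \<rho> k
      using that adj_permutes permutes_compose by blast
    have closed: "step b c k y \<in> S" if "k \<in> {1..<m}" for b c k
      using that less.prems(3) step_closed by blast
    show ?thesis
    proof (cases "j = i + 1")
      case False
      with \<open>i < j\<close> have far: "i + 2 \<le> j" by simp
      have comm: "\<sigma> \<circ> adj i \<circ> adj j = \<sigma> \<circ> adj j \<circ> adj i"
        using far by (auto simp: fun_eq_iff comp_apply id_apply adj_apply)
      \<comment> \<open>\<open>j, ns\<close> continues \<open>i\<close>, and \<open>i, ns\<close> continues \<open>j\<close>, to a reduced word of \<open>\<sigma>\<close>.\<close>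
      obtain ns where ns: "reduced_word m ns (\<sigma> \<circ> adj i \<circ> adj j)"
        using reduced_word_ex perm \<sigma> i j by metis
      have "reduced_word m (j # ns) (\<sigma> \<circ> adj i)"
        using ns j i far perm[OF \<sigma>] by (auto simp: reduced_word_Cons adj_apply comp_apply)
      then have 1: "run step (a \<circ> adj i) ks (step (a i) (a (i + 1)) i y) =
          run step (a \<circ> adj i) (j # ns) (step (a i) (a (i + 1)) i y)"
        using IH[OF len(1)] wi closed by blast
      have "reduced_word m (i # ns) (\<sigma> \<circ> adj j)"
        using ns j i far perm[OF \<sigma>] comm by (auto simp: reduced_word_Cons adj_apply comp_apply)
      then have 2: "run step (a \<circ> adj j) ls (step (a j) (a (j + 1)) j y) =
          run step (a \<circ> adj j) (i # ns) (step (a j) (a (j + 1)) j y)"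
        using IH[OF len(2)] wj closed by blast
      have "a \<circ> adj i \<circ> adj j = a \<circ> adj j \<circ> adj i"
        using far by (auto simp: fun_eq_iff comp_apply id_apply adj_apply)
      then show ?thesis
        using 1 2 far step_commute[OF i(1) j(1) far less.prems(3)] by (simp add: adj_apply comp_apply)
    next
      case True
      let ?k = "i + 1"
      have j': "?k \<in> {1..<m}" "\<sigma> (i + 2) < \<sigma> (i + 1)" using j True by auto
      have braid: "\<sigma> \<circ> adj i \<circ> adj ?k \<circ> adj i = \<sigma> \<circ> adj ?k \<circ> adj i \<circ> adj ?k"
        by (auto simp: fun_eq_iff comp_apply id_apply adj_apply)
      obtain ns where ns: "reduced_word m ns (\<sigma> \<circ> adj i \<circ> adj ?k \<circ> adj i)"
        using reduced_word_ex perm \<sigma> i j' by metis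
      have "reduced_word m (?k # i # ns) (\<sigma> \<circ> adj i)"
        using ns j' i perm[OF \<sigma>] perm[OF perm[OF \<sigma>]] by (auto simp: reduced_word_Cons adj_apply comp_apply)
      then have 1: "run step (a \<circ> adj i) ks (step (a i) (a (i + 1)) i y) =
          run step (a \<circ> adj i) (?k # i # ns) (step (a i) (a (i + 1)) i y)"
        using IH[OF len(1)] wi closed by blast
      have "reduced_word m (i # ?k # ns) (\<sigma> \<circ> adj ?k)"
        using ns j' i perm[OF \<sigma>] perm[OF perm[OF \<sigma>]] braid
        by (auto simp: reduced_word_Cons adj_apply comp_apply)
      then have 2: "run step (a \<circ> adj ?k) ls (step (a ?k) (a (?k + 1)) ?k y) =
          run step (a \<circ> adj ?k) (i # ?k # ns) (step (a ?k) (a (?k + 1)) ?k y)"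
        using IH[OF len(2)] wj closed True by blast
      have "a \<circ> adj i \<circ> adj ?k \<circ> adj i = a \<circ> adj ?k \<circ> adj i \<circ> adj ?k"
        by (auto simp: fun_eq_iff comp_apply id_apply adj_apply)
      then show ?thesis
        using 1 2 True step_braid[OF i(1) j'(1) less.prems(3)] by (simp add: adj_apply comp_apply)
    qed
  qed
  show ?case
  proof (cases "is")
    case Nil
    then have "js = []" using less.prems by (auto simp: reduced_word_def)
    with Nil show ?thesis by simp
  next
    case (Cons i ks)
    have "length js = length is" using less.prems by (auto simp: reduced_word_def)
    then obtain j ls where js: "js = j # ls" using Cons by (cases js) auto
    consider "i = j" | "i < j" | "j < i" by linarith
    then show ?thesis
    proof cases
      case 1
      have "run step (a \<circ> adj i) ks z = run step (a \<circ> adj i) ls z" if "z \<in> S" for z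
        by (rule less.hyps[of ks "\<sigma> \<circ> adj i"])
          (use less.prems Cons js 1 that in \<open>auto simp: reduced_word_Cons\<close>)
      moreover have "i \<in> {1..<m}" using less.prems Cons by (auto simp: reduced_word_def)
      ultimately show ?thesis using Cons js 1 step_closed less.prems by simp
    next
      case 2
      then show ?thesis using distinct_letters[of ks ls i j] less.prems Cons js \<open>length js = _\<close> by simp
    next
      case 3
      then show ?thesis using distinct_letters[of ls ks j i] less.prems Cons js \<open>length js = _\<close> by simp
    qed
  qed
qed

end

section \<open>The Hecke generators in coordinates\<close>

text \<open>
  The operator that is \<open>q\<^sup>2\<close> on \<^term>\<open>V1 q x\<close> and \<open>-1\<close> on \<^term>\<open>V2 q\<close>, acting on coordinates:
  if \<open>F a b\<close> is the coefficient of \<open>e_a \<otimes> e_b\<close> in a tensor, then \<^term>\<open>cross q x F a b\<close> is its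
  coefficient in the image. The last two terms come from the correction proportional to \<open>x\<close> in the
  generator of \<^term>\<open>V1 q x\<close> that belongs to \<open>e_1 \<otimes> e_2\<close>.
\<close>

definition cross :: "complex \<Rightarrow> complex \<Rightarrow> (nat \<Rightarrow> nat \<Rightarrow> complex) \<Rightarrow> nat \<Rightarrow> nat \<Rightarrow> complex" where
  "cross q x F a b =
     (if a = b then (if a \<le> 2 then - 1 else q\<^sup>2) else if b < a then q\<^sup>2 - 1 else 0) * F a b
   + (if a = b then 0 else if 3 \<le> a \<and> 3 \<le> b then q else - q) * F b a
   + (if a = 3 \<and> b = 4 then (q\<^sup>2 - 1) * q * x else if a = 4 \<and> b = 3 then - ((q\<^sup>2 - 1) * x) else 0) * F 1 2
   + (if a = 3 \<and> b = 4 then - ((q\<^sup>2 - 1) * q\<^sup>2 * x) else if a = 4 \<and> b = 3 then (q\<^sup>2 - 1) * q * x else 0) * F 2 1"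

text \<open>
  The action of \<open>h_i\<close>. As it depends on two neighbouring letters only, one definition serves all
  tensor powers; the value \<open>0\<close> on words without an \<open>(i + 1)\<close>-st letter is a convention.
\<close>

definition hop :: "complex \<Rightarrow> complex \<Rightarrow> nat \<Rightarrow> tensor \<Rightarrow> tensor" where
  "hop q x i t = (\<lambda>w. if i < length w
     then cross q (q ^ (i - 1) * x) (\<lambda>a b. t (w[i - 1 := a, i := b])) (w ! (i - 1)) (w ! i) else 0)"

lemma cross_add: "cross q x (\<lambda>a b. F a b + G a b) a b = cross q x F a b + cross q x G a b"
  by (simp add: cross_def algebra_simps)
lemma cross_mult: "cross q x (\<lambda>a b. c * F a b) a b = c * cross q x F a b"
  by (simp add: cross_def algebra_simps)
lemma cross_mult': "cross q x (\<lambda>a b. F a b * c) a b = cross q x F a b * c"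
  by (simp add: cross_def algebra_simps)

lemma cross_form: "\<exists>c0 c1 c2 c3. \<forall>F. cross q x F a b = c0 * F a b + c1 * F b a + c2 * F 1 2 + c3 * F 2 1"
  unfolding cross_def by blast

lemma cross_commute:
  "cross q x (\<lambda>a b. cross q y (\<lambda>c d. F a b c d) c d) a b =
   cross q y (\<lambda>c d. cross q x (\<lambda>a b. F a b c d) a b) c d"
proof -
  obtain c0 c1 c2 c3 where c: "cross q x F a b = c0 * F a b + c1 * F b a + c2 * F 1 2 + c3 * F 2 1" for F
    using cross_form[of q x a b] by blast
  obtain d0 d1 d2 d3 where d: "cross q y F c d = d0 * F c d + d1 * F d c + d2 * F 1 2 + d3 * F 2 1" for F
    using cross_form[of q y c d] by blast
  show ?thesis unfolding c d by (simp add: algebra_simps)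
qed

lemma letter_cases: "a \<in> {1..4::nat} \<Longrightarrow> a = 1 \<or> a = 2 \<or> a = 3 \<or> a = 4"
  by auto

lemma cross_quadratic:
  assumes "a \<in> {1..4}" "b \<in> {1..4}"
  shows "cross q x (cross q x F) a b = (q\<^sup>2 - 1) * cross q x F a b + q\<^sup>2 * F a b"
  using letter_cases[OF assms(1)] letter_cases[OF assms(2)]
  by (elim disjE; hypsubst; simp add: cross_def; simp add: algebra_simps power_numeral_reduce)

text \<open>
  The parameter of the second pair of factors is \<open>q x\<close>, as in the tensor product
  \<open>V_x \<otimes> V_{qx} \<otimes> V_{q\<^sup>2x}\<close>. The identity is checked on each of the 64 words.
\<close>

lemma cross_braid:
  fixes q x :: complex and G :: "nat \<Rightarrow> nat \<Rightarrow> nat \<Rightarrow> complex"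
  assumes "a \<in> {1..4}" "b \<in> {1..4}" "c \<in> {1..4}"
  defines "L \<equiv> \<lambda>y G a b c. cross q y (\<lambda>a b. G a b c) a b"
    and "R \<equiv> \<lambda>y G a b c. cross q y (\<lambda>b c. G a b c) b c"
  shows "L x (R (q * x) (L x G)) a b c = R (q * x) (L x (R (q * x) G)) a b c"
  using letter_cases[OF assms(1)] letter_cases[OF assms(2)] letter_cases[OF assms(3)]
  unfolding L_def R_def
  by (elim disjE; hypsubst; simp add: cross_def; simp add: algebra_simps power2_eq_square)

lemma lin_hop: "lin (hop q x i)"
  unfolding lin_def
  by (auto simp: fun_eq_iff hop_def tensor_apply cross_add cross_mult)

lemma nth_update: "w[i := a] ! j = (if i = j \<and> i < length w then a else w ! j)"
  by (cases "i < length w") (auto simp: nth_list_update list_update_beyond)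

lemma words_nth: "w \<in> words m \<Longrightarrow> i < m \<Longrightarrow> w ! i \<in> {1..4}"
  unfolding words_def by (metis (mono_tags, lifting) mem_Collect_eq nth_mem subset_iff)

lemma words_update: "w \<in> words m \<Longrightarrow> a \<in> {1..4} \<Longrightarrow> w[i := a] \<in> words m"
  using set_update_subset_insert[of w i a] by (auto simp: words_def)

lemma words_updateD:
  assumes "w[i := a, j := b] \<in> words m" "{w ! i, w ! j} \<subseteq> {1..4}"
  shows "w \<in> words m"
proof -
  have "w[i := a, j := b, i := w ! i, j := w ! j] = w"
    by (rule nth_equalityI) (auto simp: nth_update)
  moreover have "w[i := a, j := b, i := w ! i, j := w ! j] \<in> words m"
    using words_update[OF words_update[OF assms(1), of "w ! i" i], of "w ! j" j] assms(2) by simp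
  ultimately show ?thesis by simp
qed

lemma list_update_two:
  "i \<noteq> j \<Longrightarrow> w[i := a, j := b, i := c, j := d] = w[i := c, j := d]"
  by (rule nth_equalityI) (auto simp: nth_update)

lemma hop_in_W:
  assumes "t \<in> W m" "i \<in> {1..<m}"
  shows "hop q x i t \<in> W m"
  unfolding W_iff
proof (intro allI impI)
  fix w assume w: "w \<notin> words m"
  have zero: "t (w[i - 1 := a, i := b]) = 0" if "{w ! (i - 1), w ! i} \<subseteq> {1..4}" for a b
    using words_updateD[of w "i - 1" a i b m] that w W_support[OF assms(1)] by blast
  show "hop q x i t w = 0"
  proof (cases "length w = m")
    case False
    then have "t (w[i - 1 := a, i := b]) = 0" for a b
      by (intro W_support[OF assms(1)]) (simp add: words_def)
    then show ?thesis by (simp add: hop_def cross_def)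
  next
    case True
    show ?thesis
    proof (cases "{w ! (i - 1), w ! i} \<subseteq> {1..4}")
      case True
      then show ?thesis unfolding hop_def cross_def zero[OF True] by simp
    next
      case False
      have *: "t (w[i - 1 := w ! (i - 1), i := w ! i]) = 0" "t (w[i - 1 := w ! i, i := w ! (i - 1)]) = 0"
      proof -
        have "w[i - 1 := w ! (i - 1), i := w ! i] = w" by simp
        then show "t (w[i - 1 := w ! (i - 1), i := w ! i]) = 0"
          using W_support[OF assms(1) w] by simp
        have "(w[i - 1 := w ! i, i := w ! (i - 1)]) ! (i - 1) = w ! i"
          "(w[i - 1 := w ! i, i := w ! (i - 1)]) ! i = w ! (i - 1)"
          using True assms(2) by (auto simp: nth_update)
        then have "w[i - 1 := w ! i, i := w ! (i - 1)] \<notin> words m"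
          using False words_nth[of "w[i - 1 := w ! i, i := w ! (i - 1)]" m] assms(2)
          by (metis (no_types, lifting) atLeastLessThan_iff empty_subsetI insert_subset less_imp_diff_less)
        then show "t (w[i - 1 := w ! i, i := w ! (i - 1)]) = 0" by (rule W_support[OF assms(1)])
      qed
      have "\<not> (w ! (i - 1) = 3 \<and> w ! i = 4)" "\<not> (w ! (i - 1) = 4 \<and> w ! i = 3)"
        using False by auto
      then show ?thesis using * by (auto simp: hop_def cross_def)
    qed
  qed
qed

lemma hop_quadratic:
  assumes "t \<in> W m" "i \<in> {1..<m}"
  shows "hop q x i (hop q x i t) = scale (q\<^sup>2 - 1) (hop q x i t) + scale (q\<^sup>2) t"
proof (rule W_eqI[of _ m])
  show "hop q x i (hop q x i t) \<in> W m" using assms by (simp add: hop_in_W)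
  show "scale (q\<^sup>2 - 1) (hop q x i t) + scale (q\<^sup>2) t \<in> W m"
    using assms by (intro tensor.subspace_add tensor.subspace_scale subspace_W hop_in_W)
  fix w assume w: "w \<in> words m"
  then have len: "length w = m" by (simp add: words_def)
  define F where "F = (\<lambda>a b. t (w[i - 1 := a, i := b]))"
  let ?y = "q ^ (i - 1) * x"
  obtain k where k: "i = Suc k" using assms(2) by (cases i) auto
  have "hop q x i t (w[i - 1 := a, i := b]) = cross q ?y F a b" for a b
    using assms(2) len by (simp add: k hop_def F_def list_update_two nth_update)
  then have "hop q x i (hop q x i t) w = cross q ?y (cross q ?y F) (w ! (i - 1)) (w ! i)"
    using assms(2) len by (simp add: hop_def)
  also have "\<dots> = (q\<^sup>2 - 1) * cross q ?y F (w ! (i - 1)) (w ! i) + q\<^sup>2 * F (w ! (i - 1)) (w ! i)"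
    using words_nth[OF w] assms(2) by (intro cross_quadratic) auto
  also have "\<dots> = (scale (q\<^sup>2 - 1) (hop q x i t) + scale (q\<^sup>2) t) w"
    using assms(2) len by (simp add: hop_def F_def tensor_apply)
  finally show "hop q x i (hop q x i t) w = (scale (q\<^sup>2 - 1) (hop q x i t) + scale (q\<^sup>2) t) w" .
qed

lemma hop_braid:
  assumes "t \<in> W m" "i \<in> {1..<m}" "i + 1 \<in> {1..<m}"
  shows "hop q x i (hop q x (i + 1) (hop q x i t)) = hop q x (i + 1) (hop q x i (hop q x (i + 1) t))"
proof (rule W_eqI[of _ m])
  show "hop q x i (hop q x (i + 1) (hop q x i t)) \<in> W m"
    "hop q x (i + 1) (hop q x i (hop q x (i + 1) t)) \<in> W m"
    using assms by (simp_all add: hop_in_W)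
  fix w assume w: "w \<in> words m"
  then have len: "length w = m" by (simp add: words_def)
  let ?y = "q ^ (i - 1) * x"
  obtain k where k: "i = Suc k" using assms(2) by (cases i) auto
  define p where "p a b c = w[i - 1 := a, i := b, i + 1 := c]" for a b c
  have y': "q ^ (i + 1 - 1) * x = q * ?y"
    using assms(2) by (cases i) auto
  have len_p: "length (p a b c) = m" for a b c by (simp add: p_def len)
  have nth_p: "p a b c ! (i - 1) = a" "p a b c ! i = b" "p a b c ! (i + 1) = c" for a b c
    using assms(2,3) len by (auto simp: p_def nth_list_update)
  have upd: "(p a b c)[i - 1 := a', i := b'] = p a' b' c" "(p a b c)[i := b', i + 1 := c'] = p a b' c'"
    for a b c a' b' c'
    using assms(2) unfolding p_def by (auto intro!: nth_equalityI simp: nth_update)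
  have w_p: "w = p (w ! (i - 1)) (w ! i) (w ! (i + 1))"
    by (simp add: p_def)
  have L: "hop q x i s (p a b c) = cross q ?y (\<lambda>a b. s (p a b c)) a b" for s a b c
    using assms(2) nth_p[of a b c] upd[of a b c] by (simp add: k hop_def len_p)
  have R: "hop q x (i + 1) s (p a b c) = cross q (q * ?y) (\<lambda>b c. s (p a b c)) b c" for s a b c
    using assms(3) nth_p[of a b c] upd[of a b c] unfolding hop_def y' by (simp add: k len_p)
  show "hop q x i (hop q x (i + 1) (hop q x i t)) w =
      hop q x (i + 1) (hop q x i (hop q x (i + 1) t)) w"
    unfolding w_p[THEN arg_cong[of _ _ "hop q x i (hop q x (i + 1) (hop q x i t))"]]
      w_p[THEN arg_cong[of _ _ "hop q x (i + 1) (hop q x i (hop q x (i + 1) t))"]] L R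
    using words_nth[OF w] assms(3) by (intro cross_braid) auto
qed

lemma hop_commute:
  assumes "i \<ge> 1" "i + 2 \<le> j"
  shows "hop q x i (hop q x j t) = hop q x j (hop q x i t)"
proof
  fix w
  show "hop q x i (hop q x j t) w = hop q x j (hop q x i t) w"
  proof (cases "j < length w")
    case True
    obtain k l where kl: "i = Suc k" "j = Suc l" using assms by (cases i; cases j) auto
    have swap: "w[i - 1 := a, i := b, j - 1 := c, j := d] = w[j - 1 := c, j := d, i - 1 := a, i := b]"
      for a b c d
      using assms by (auto intro!: nth_equalityI simp: nth_update)
    show ?thesis
      using True assms swap unfolding hop_def kl
      by (simp add: nth_update)
        (rule cross_commute[where F = "\<lambda>a b c d. t (w[l := c, Suc l := d, k := a, Suc k := b])"])
  next
    case False
    then show ?thesis using assms by (simp add: hop_def cross_def)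
  qed
qed

lemma hop_conc_left:
  assumes "s \<in> W a" "i \<in> {1..<a}"
  shows "hop q x i (conc s t) = conc (hop q x i s) t"
proof
  fix w
  obtain k where k: "i = Suc k" using assms(2) by (cases i) auto
  show "hop q x i (conc s t) w = conc (hop q x i s) t w"
  proof (cases "a \<le> length w")
    case True
    then show ?thesis
      using assms(2) unfolding conc_homogeneous[OF hop_in_W[OF assms]]
      by (simp add: conc_homogeneous[OF assms(1)] hop_def k take_update_swap cross_mult')
  next
    case False
    then have "conc s t v = 0" if "length v = length w" for v
      using that by (simp add: conc_homogeneous[OF assms(1)])
    then have "hop q x i (conc s t) w = 0" by (simp add: hop_def cross_def)
    moreover have "conc (hop q x i s) t w = 0"
      using False by (simp add: conc_homogeneous[OF hop_in_W[OF assms]])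
    ultimately show ?thesis by simp
  qed
qed

lemma hop_conc_right:
  assumes "s \<in> W a" "i \<ge> 1"
  shows "hop q x (a + i) (conc s t) = conc s (hop q (q ^ a * x) i t)"
proof
  fix w
  have "q ^ (a + i - 1) * x = q ^ (i - 1) * (q ^ a * x)"
    using assms(2) by (simp add: power_add[symmetric] add.commute flip: mult.assoc)
  then have e: "q ^ (a + i - Suc 0) * x = q ^ (i - Suc 0) * (q ^ a * x)" by simp
  have "a + i - 1 - a = i - 1" "a \<le> a + i - 1" using assms(2) by auto
  then show "hop q x (a + i) (conc s t) w = conc s (hop q (q ^ a * x) i t) w"
    using assms(2)
    by (auto simp: conc_homogeneous[OF assms(1)] hop_def drop_update_swap take_update_cancel
        cross_mult e)
qed

section \<open>The Yang--Baxter equation for combinations of a Hecke generator and the identity\<close>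

text \<open>
  The operator \<open>\<alpha> h_i + \<beta>\<close>, where the pair \<open>(\<alpha>, \<beta>) = f a b\<close> depends on the labels of the two strands
  that cross.
\<close>

definition strand_op ::
  "complex \<Rightarrow> complex \<Rightarrow> ('c \<Rightarrow> 'c \<Rightarrow> complex \<times> complex) \<Rightarrow> 'c \<Rightarrow> 'c \<Rightarrow> nat \<Rightarrow> tensor \<Rightarrow> tensor" where
  "strand_op q x f a b i t = scale (fst (f a b)) (hop q x i t) + scale (snd (f a b)) t"

text \<open>
  By the Hecke relations the two sides of the Yang--Baxter equation for the strands \<open>a\<close>, \<open>b\<close>, \<open>c\<close>
  differ by a multiple of \<open>h_i - h_{i+1}\<close>. The factor is the difference of the two sides of the
  following equation.
\<close>

definition yang_baxter_coeffs :: "complex \<Rightarrow> ('c \<Rightarrow> 'c \<Rightarrow> complex \<times> complex) \<Rightarrow> bool" where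
  "yang_baxter_coeffs q f \<longleftrightarrow> (\<forall>a b c.
     (q\<^sup>2 - 1) * fst (f b c) * snd (f a c) * fst (f a b) + fst (f b c) * snd (f a c) * snd (f a b)
       + snd (f b c) * snd (f a c) * fst (f a b)
     = snd (f a b) * fst (f a c) * snd (f b c))"

lemma lin_strand_op: "lin (strand_op q x f a b i)"
  unfolding strand_op_def by (rule lin_lincomb[OF lin_hop lin_id])

lemma strand_op_in_W: "t \<in> W m \<Longrightarrow> i \<in> {1..<m} \<Longrightarrow> strand_op q x f a b i t \<in> W m"
  unfolding strand_op_def
  by (intro tensor.subspace_add tensor.subspace_scale subspace_W hop_in_W)

lemmas hop_linear = linD[OF lin_hop]

lemma strand_op_braid:
  assumes f: "yang_baxter_coeffs q f" and t: "t \<in> W m" and i: "i \<in> {1..<m}" "i + 1 \<in> {1..<m}"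
  shows "strand_op q x f b c i (strand_op q x f a c (i + 1) (strand_op q x f a b i t)) =
    strand_op q x f a b (i + 1) (strand_op q x f a c i (strand_op q x f b c (i + 1) t))"
proof
  fix w
  obtain A1 B1 A2 B2 A3 B3 where AB: "f a b = (A1, B1)" "f a c = (A2, B2)" "f b c = (A3, B3)"
    by (metis surj_pair)
  have C: "(q\<^sup>2 - 1) * A3 * B2 * A1 + A3 * B2 * B1 + B3 * B2 * A1 - B1 * A2 * B3 = 0"
    using f[unfolded yang_baxter_coeffs_def, rule_format, of b c a] AB by simp
  let ?h = "hop q x i" and ?g = "hop q x (i + 1)"
  have quad: "?h (?h t) = scale (q\<^sup>2 - 1) (?h t) + scale (q\<^sup>2) t"
    "?g (?g t) = scale (q\<^sup>2 - 1) (?g t) + scale (q\<^sup>2) t"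
    using hop_quadratic[OF t] i by blast+
  have braid: "?h (?g (?h t)) = ?g (?h (?g t))" using hop_braid[OF t i] .
  have "strand_op q x f b c i (strand_op q x f a c (i + 1) (strand_op q x f a b i t)) w -
      strand_op q x f a b (i + 1) (strand_op q x f a c i (strand_op q x f b c (i + 1) t)) w =
      ((q\<^sup>2 - 1) * A3 * B2 * A1 + A3 * B2 * B1 + B3 * B2 * A1 - B1 * A2 * B3) * (?h t w - ?g t w)"
    unfolding strand_op_def AB fst_conv snd_conv hop_linear quad braid tensor_apply
    by (simp add: algebra_simps)
  then show "strand_op q x f b c i (strand_op q x f a c (i + 1) (strand_op q x f a b i t)) w =
      strand_op q x f a b (i + 1) (strand_op q x f a c i (strand_op q x f b c (i + 1) t)) w"
    unfolding C by simp
qed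

lemma word_action_strand_op:
  assumes "yang_baxter_coeffs q f"
  shows "word_action m (W m) (strand_op q x f)"
proof
  fix i j t a b c d
  show "strand_op q x f a b i t \<in> W m" if "i \<in> {1..<m}" "t \<in> W m"
    using that by (simp add: strand_op_in_W)
  show "strand_op q x f b c i (strand_op q x f a c (i + 1) (strand_op q x f a b i t)) =
      strand_op q x f a b (i + 1) (strand_op q x f a c i (strand_op q x f b c (i + 1) t))"
    if "i \<in> {1..<m}" "i + 1 \<in> {1..<m}" "t \<in> W m"
    using strand_op_braid[OF assms that(3,1,2)] .
  show "strand_op q x f a b i (strand_op q x f c d j t) = strand_op q x f c d j (strand_op q x f a b i t)"
    if "i \<in> {1..<m}" "j \<in> {1..<m}" "i + 2 \<le> j" "t \<in> W m"
  proof
    fix w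
    have comm: "hop q x i (hop q x j t) = hop q x j (hop q x i t)"
      using that by (intro hop_commute) auto
    show "strand_op q x f a b i (strand_op q x f c d j t) w = strand_op q x f c d j (strand_op q x f a b i t) w"
      unfolding strand_op_def hop_linear comm tensor_apply by (simp add: algebra_simps)
  qed
qed

lemma lin_run_strand_op: "lin (run (strand_op q x f) a is)"
proof (induction "is" arbitrary: a)
  case Nil
  then show ?case using lin_id by (simp add: id_def)
next
  case (Cons i "is")
  show ?case using lin_compose[OF Cons.IH lin_strand_op] by simp
qed

lemma run_strand_op_in_W: "t \<in> W m \<Longrightarrow> set is \<subseteq> {1..<m} \<Longrightarrow> run (strand_op q x f) a is t \<in> W m"
  by (induction "is" arbitrary: a t) (auto simp: strand_op_in_W)

lemma strand_op_conc_left: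
  assumes "s \<in> W m" "i \<in> {1..<m}"
  shows "strand_op q x f a b i (conc s t) = conc (strand_op q x f a b i s) t"
  by (simp add: strand_op_def hop_conc_left[OF assms] conc_add_left conc_scale_left)

lemma strand_op_conc_right:
  assumes "s \<in> W m" "i \<ge> 1"
  shows "strand_op q x f a b (m + i) (conc s t) = conc s (strand_op q (q ^ m * x) f a b i t)"
  by (simp add: strand_op_def hop_conc_right[OF assms] conc_add_right conc_scale_right)

lemma run_conc_left:
  assumes "s \<in> W m" "set is \<subseteq> {1..<m}"
  shows "run (strand_op q x f) a is (conc s t) = conc (run (strand_op q x f) a is s) t"
  using assms by (induction "is" arbitrary: a s) (auto simp: strand_op_conc_left strand_op_in_W)

lemma run_conc_right:
  assumes "s \<in> W m" "0 \<notin> set is"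
  shows "run (strand_op q x f) a (map ((+) m) is) (conc s t) =
    conc s (run (strand_op q (q ^ m * x) f) (\<lambda>i. a (m + i)) is t)"
  using assms
proof (induction "is" arbitrary: a t)
  case (Cons i "is")
  have "(\<lambda>j. (a \<circ> adj (m + i)) (m + j)) = (\<lambda>j. a (m + j)) \<circ> adj i"
    by (auto simp: fun_eq_iff comp_apply adj_apply)
  moreover have "i \<ge> 1" using Cons.prems(2) by (cases i) auto
  ultimately show ?case using Cons by (simp add: strand_op_conc_right)
qed simp

section \<open>The basic operator and the operators indexed by permutations\<close>

lemma W_2_cases:
  assumes "w \<in> words 2"
  obtains i j where "w = [i, j]" "i \<in> {1..4}" "j \<in> {1..4}"
  using assms by (auto simp: words_def numeral_2_eq_2 length_Suc_conv)

lemma hop_basis: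
  assumes "i \<in> {1..4}" "j \<in> {1..4}"
  shows "hop q x 1 (basis [i, j]) =
    (if i = j then scale (if i \<le> 2 then - 1 else q\<^sup>2) (basis [i, j])
     else scale (if 3 \<le> i \<and> 3 \<le> j then q else - q) (basis [j, i])
       + scale (if j < i then q\<^sup>2 - 1 else 0) (basis [i, j])
       + (if i = 1 \<and> j = 2 then scale ((q\<^sup>2 - 1) * x) (scale q (basis [3, 4]) - basis [4, 3]) else 0)
       + (if i = 2 \<and> j = 1 then scale (- (q\<^sup>2 - 1) * q * x) (scale q (basis [3, 4]) - basis [4, 3]) else 0))"
  (is "_ = ?R")
proof (rule W_eqI[of _ 2])
  have b: "basis [a, b] \<in> W 2" if "a \<in> {1..4}" "b \<in> {1..4}" for a b
    using that by (auto simp: basis_in_W words_def)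
  show "hop q x 1 (basis [i, j]) \<in> W 2" using assms by (intro hop_in_W b) auto
  show "?R \<in> W 2"
    using assms subspace_W[of 2]
    by (auto intro!: tensor.subspace_add tensor.subspace_scale tensor.subspace_diff tensor.subspace_neg b
        simp: tensor.subspace_0)
  fix w assume "w \<in> words 2"
  then obtain a b where w: "w = [a, b]" "a \<in> {1..4}" "b \<in> {1..4}" by (rule W_2_cases)
  have "hop q x 1 (basis [i, j]) w = cross q x (\<lambda>a b. if a = i \<and> b = j then 1 else 0) a b"
    by (simp add: hop_def w basis_def)
  also have "\<dots> = ?R w"
    using letter_cases[OF assms(1)] letter_cases[OF assms(2)] letter_cases[OF w(2)] letter_cases[OF w(3)]
    by (elim disjE; hypsubst; simp add: cross_def tensor_apply basis_def w; simp add: algebra_simps power2_eq_square)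
  finally show "hop q x 1 (basis [i, j]) w = ?R w" .
qed

lemmas hop_basis_Suc = hop_basis[unfolded One_nat_def]

lemma basis_in_W2: "i \<in> {1..4} \<Longrightarrow> j \<in> {1..4} \<Longrightarrow> basis [i, j] \<in> W 2"
  by (auto simp: basis_in_W words_def)

lemma pairs_cases:
  assumes "1 \<le> i" "i < j" "j \<le> (4::nat)"
  shows "(i = 1 \<and> j = 2) \<or> (i = 1 \<and> j = 3) \<or> (i = 1 \<and> j = 4) \<or> (i = 2 \<and> j = 3)
    \<or> (i = 2 \<and> j = 4) \<or> (i = 3 \<and> j = 4)"
  using assms by auto

lemma subspace_eigen: "tensor.subspace {t \<in> W m. hop q x i t = scale c t}"
proof -
  have "lin (scale c)" by (simp add: lin_def tensor.scale_right_distrib mult.commute)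
  then have "tensor.subspace (W m \<inter> {t. hop q x i t = scale c t})"
    by (intro tensor.subspace_inter subspace_W subspace_lin_eq lin_hop)
  then show ?thesis by (simp add: Int_def)
qed

text \<open>
  The spaces \<^term>\<open>V1 q x\<close> and \<^term>\<open>V2 q\<close> consist of eigenvectors of \<open>h\<close>, and \<open>h + 1\<close> and \<open>q\<^sup>2 - h\<close> map
  into them. So the projections are multiples of these two operators.
\<close>

lemma V1_subset_eigen: "V1 q x \<subseteq> {t \<in> W 2. hop q x 1 t = scale (q\<^sup>2) t}"
  unfolding V1_def
proof (rule tensor.span_minimal[OF _ subspace_eigen], rule subsetI)
  fix t assume t: "t \<in> {basis [3, 3], basis [4, 4]} \<union>
     {basis [i, j] - scale ((-1) ^ (theta i * theta j) * q) (basis [j, i])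
       + (if i = 1 \<and> j = 2 then scale (q ^ 3 * x) (basis [3, 4]) + scale x (basis [4, 3]) else 0)
      | i j. 1 \<le> i \<and> i < j \<and> j \<le> 4}"
  then consider "t = basis [3, 3]" | "t = basis [4, 4]" | i j where "1 \<le> i" "i < j" "j \<le> 4"
    "t = basis [i, j] - scale ((-1) ^ (theta i * theta j) * q) (basis [j, i])
       + (if i = 1 \<and> j = 2 then scale (q ^ 3 * x) (basis [3, 4]) + scale x (basis [4, 3]) else 0)"
    by blast
  then show "t \<in> {t \<in> W 2. hop q x 1 t = scale (q\<^sup>2) t}"
  proof cases
    case 3
    have "t \<in> W 2" unfolding 3(4) using 3(1-3)
      by (auto intro!: tensor.subspace_add[OF subspace_W] tensor.subspace_scale[OF subspace_W]
        tensor.subspace_diff[OF subspace_W] tensor.subspace_neg[OF subspace_W] basis_in_W2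
        simp: tensor.subspace_0[OF subspace_W])
    moreover have "hop q x 1 t = scale (q\<^sup>2) t"
    proof
      fix w show "hop q x 1 t w = scale (q\<^sup>2) t w"
        unfolding 3(4) using pairs_cases[OF 3(1-3)]
        by (elim disjE conjE; hypsubst; simp add: hop_basis_Suc lin_diff[OF lin_hop] hop_linear theta_def tensor_apply;
            simp add: algebra_simps power_numeral_reduce)
    qed
    ultimately show ?thesis by simp
  qed (auto simp: basis_in_W2 hop_basis_Suc)
qed

lemma V2_subset_eigen:
  assumes "q \<noteq> 0"
  shows "V2 q \<subseteq> {t \<in> W 2. hop q x 1 t = scale (- 1) t}"
  unfolding V2_def
proof (rule tensor.span_minimal[OF _ subspace_eigen], rule subsetI)
  fix t assume t: "t \<in> {basis [1, 1], basis [2, 2]} \<union>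
     {basis [i, j] + scale ((-1) ^ (theta i * theta j) * inverse q) (basis [j, i])
      | i j. 1 \<le> i \<and> i < j \<and> j \<le> 4}"
  then consider "t = basis [1, 1]" | "t = basis [2, 2]" | i j where "1 \<le> i" "i < j" "j \<le> 4"
    "t = basis [i, j] + scale ((-1) ^ (theta i * theta j) * inverse q) (basis [j, i])"
    by blast
  then show "t \<in> {t \<in> W 2. hop q x 1 t = scale (- 1) t}"
  proof cases
    case 3
    have "t \<in> W 2" unfolding 3(4) using 3(1-3)
      by (auto intro!: tensor.subspace_add[OF subspace_W] tensor.subspace_scale[OF subspace_W]
        tensor.subspace_diff[OF subspace_W] tensor.subspace_neg[OF subspace_W] basis_in_W2)
    moreover have "hop q x 1 t = scale (- 1) t"
    proof
      fix w show "hop q x 1 t w = scale (- 1) t w"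
        unfolding 3(4) using pairs_cases[OF 3(1-3)] assms
        by (elim disjE conjE; hypsubst; simp add: hop_basis_Suc lin_diff[OF lin_hop] hop_linear theta_def tensor_apply;
            simp add: field_simps power_numeral_reduce)
    qed
    ultimately show ?thesis by simp
  qed (auto simp: basis_in_W2 hop_basis_Suc)
qed

lemma V1_gen:
  assumes "1 \<le> i" "i < j" "j \<le> 4"
  shows "basis [i, j] - scale ((-1) ^ (theta i * theta j) * q) (basis [j, i])
       + (if i = 1 \<and> j = 2 then scale (q ^ 3 * x) (basis [3, 4]) + scale x (basis [4, 3]) else 0) \<in> V1 q x"
  unfolding V1_def by (rule tensor.span_base) (use assms in blast)

lemma V2_gen:
  assumes "1 \<le> i" "i < j" "j \<le> 4"
  shows "basis [i, j] + scale ((-1) ^ (theta i * theta j) * inverse q) (basis [j, i]) \<in> V2 q"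
  unfolding V2_def by (rule tensor.span_base) (use assms in blast)

lemma subspace_V1: "tensor.subspace (V1 q x)" and subspace_V2: "tensor.subspace (V2 q)"
  by (simp_all add: V1_def V2_def)

lemma hop_plus_one_basis_in_V1:
  assumes "i \<in> {1..4}" "j \<in> {1..4}"
  shows "hop q x 1 (basis [i, j]) + basis [i, j] \<in> V1 q x"
proof -
  note [intro] = tensor.subspace_scale[OF subspace_V1] tensor.subspace_add[OF subspace_V1]
  have upper: "hop q x 1 (basis [i, j]) + basis [i, j] \<in> V1 q x" if "1 \<le> i" "i < j" "j \<le> 4" for i j
  proof -
    have "hop q x 1 (basis [i, j]) + basis [i, j] =
      (basis [i, j] - scale ((-1) ^ (theta i * theta j) * q) (basis [j, i])
       + (if i = 1 \<and> j = 2 then scale (q ^ 3 * x) (basis [3, 4]) + scale x (basis [4, 3]) else 0))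
      + scale (if i = 1 \<and> j = 2 then - q * x else 0)
        (basis [3, 4] - scale ((-1) ^ (theta 3 * theta 4) * q) (basis [4, 3])
         + (if (3::nat) = 1 \<and> (4::nat) = 2 then scale (q ^ 3 * x) (basis [3, 4]) + scale x (basis [4, 3]) else 0))"
      (is "?l = ?r")
    proof
      fix w show "?l w = ?r w"
        using pairs_cases[OF that]
        by (elim disjE conjE; hypsubst; simp add: hop_basis_Suc theta_def tensor_apply;
            simp add: algebra_simps power_numeral_reduce)
    qed
    also have "\<dots> \<in> V1 q x" using that V1_gen by (intro tensor.subspace_add tensor.subspace_scale subspace_V1 V1_gen) auto
    finally show ?thesis .
  qed
  consider "i < j" | "j < i" | "i = j" "i \<le> 2" | "i = j" "3 \<le> i" by linarith
  then show ?thesis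
  proof cases
    case 1
    then show ?thesis using upper assms by simp
  next
    case 2
    have "hop q x 1 (basis [i, j]) + basis [i, j] =
      scale (- ((-1) ^ (theta i * theta j)) * q) (hop q x 1 (basis [j, i]) + basis [j, i])" (is "?l = ?r")
    proof
      have p: "1 \<le> j" "j < i" "i \<le> 4" using assms 2 by auto
      fix w show "?l w = ?r w"
        using pairs_cases[OF p]
        by (elim disjE conjE; hypsubst; simp add: hop_basis_Suc theta_def tensor_apply;
            simp add: algebra_simps power_numeral_reduce)
    qed
    also have "\<dots> \<in> V1 q x" using 2 assms upper by (intro tensor.subspace_scale subspace_V1) auto
    finally show ?thesis .
  next
    case 3
    then have "hop q x 1 (basis [i, j]) + basis [i, j] = 0" using assms by (simp add: hop_basis_Suc)
    then show ?thesis by (simp add: tensor.subspace_0 subspace_V1)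
  next
    case 4
    then have "hop q x 1 (basis [i, j]) + basis [i, j] = scale (q\<^sup>2 + 1) (basis [i, j])"
      using assms by (simp add: hop_basis_Suc tensor.scale_left_distrib)
    moreover have "basis [i, j] \<in> V1 q x"
    proof -
      have "i = 3 \<or> i = 4" using 4 assms by auto
      then show ?thesis using 4 unfolding V1_def by (intro tensor.span_base) auto
    qed
    ultimately show ?thesis by (simp add: tensor.subspace_scale subspace_V1)
  qed
qed

lemma minus_hop_basis_in_V2:
  assumes "i \<in> {1..4}" "j \<in> {1..4}" "q \<noteq> 0"
  shows "scale (q\<^sup>2) (basis [i, j]) - hop q x 1 (basis [i, j]) \<in> V2 q"
proof -
  have upper: "scale (q\<^sup>2) (basis [i, j]) - hop q x 1 (basis [i, j]) \<in> V2 q" if "1 \<le> i" "i < j" "j \<le> 4" for i j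
  proof -
    have "scale (q\<^sup>2) (basis [i, j]) - hop q x 1 (basis [i, j]) =
      scale (q\<^sup>2) (basis [i, j] + scale ((-1) ^ (theta i * theta j) * inverse q) (basis [j, i]))
      + scale (if i = 1 \<and> j = 2 then - (q\<^sup>2 - 1) * q * x else 0)
        (basis [3, 4] + scale ((-1) ^ (theta 3 * theta 4) * inverse q) (basis [4, 3]))" (is "?l = ?r")
    proof
      fix w show "?l w = ?r w"
        using pairs_cases[OF that] assms(3)
        by (elim disjE conjE; hypsubst; simp add: hop_basis_Suc theta_def tensor_apply;
            simp add: field_simps power_numeral_reduce)
    qed
    also have "\<dots> \<in> V2 q" using that by (intro tensor.subspace_add tensor.subspace_scale subspace_V2 V2_gen) auto
    finally show ?thesis .
  qed
  consider "i < j" | "j < i" | "i = j" "i \<le> 2" | "i = j" "3 \<le> i" by linarith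
  then show ?thesis
  proof cases
    case 1
    then show ?thesis using upper assms by simp
  next
    case 2
    have "scale (q\<^sup>2) (basis [i, j]) - hop q x 1 (basis [i, j]) =
      scale ((-1) ^ (theta i * theta j) * inverse q) (scale (q\<^sup>2) (basis [j, i]) - hop q x 1 (basis [j, i]))
      + scale (if i = 2 \<and> j = 1 then (q\<^sup>2 - 1) * (q\<^sup>2 + 1) * x else 0)
        (basis [3, 4] + scale ((-1) ^ (theta 3 * theta 4) * inverse q) (basis [4, 3]))" (is "?l = ?r")
    proof
      have p: "1 \<le> j" "j < i" "i \<le> 4" using assms 2 by auto
      fix w show "?l w = ?r w"
        using pairs_cases[OF p] assms(3)
        by (elim disjE conjE; hypsubst; simp add: hop_basis_Suc theta_def tensor_apply;
            simp add: field_simps power_numeral_reduce)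
    qed
    also have "\<dots> \<in> V2 q" using 2 assms upper
      by (intro tensor.subspace_add tensor.subspace_scale subspace_V2 V2_gen) auto
    finally show ?thesis .
  next
    case 3
    then have "scale (q\<^sup>2) (basis [i, j]) - hop q x 1 (basis [i, j]) = scale (q\<^sup>2 + 1) (basis [i, j])"
      using assms by (simp add: hop_basis_Suc tensor.scale_left_distrib)
    moreover have "basis [i, j] \<in> V2 q"
    proof -
      have "i = 1 \<or> i = 2" using 3 assms by auto
      then show ?thesis using 3 unfolding V2_def by (intro tensor.span_base) auto
    qed
    ultimately show ?thesis by (simp add: tensor.subspace_scale subspace_V2)
  next
    case 4
    then have "scale (q\<^sup>2) (basis [i, j]) - hop q x 1 (basis [i, j]) = 0" using assms by (simp add: hop_basis_Suc)
    then show ?thesis by (simp add: tensor.subspace_0 subspace_V2)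
  qed
qed

lemma W2_lin_closed:
  assumes "tensor.subspace U" "lin L" "\<And>i j. i \<in> {1..4} \<Longrightarrow> j \<in> {1..4} \<Longrightarrow> L (basis [i, j]) \<in> U"
    and "t \<in> W 2"
  shows "L t \<in> U"
proof -
  have "L t = (\<Sum>w\<in>words 2. scale (t w) (L (basis w)))"
    by (subst W_expand[OF assms(4)]) (simp add: lin_sum[OF assms(2)] linD[OF assms(2)])
  also have "\<dots> \<in> U"
    using assms(3) by (intro tensor.subspace_sum tensor.subspace_scale assms(1)) (auto elim: W_2_cases)
  finally show ?thesis .
qed

lemma proj_along_V:
  assumes "q \<noteq> 0" "q\<^sup>2 + 1 \<noteq> 0" "t \<in> W 2"
  shows "proj_along (W 2) (V1 q x) (V2 q) t = scale (inverse (q\<^sup>2 + 1)) (hop q x 1 t + t)" (is "_ = ?p")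
    and "proj_along (W 2) (V2 q) (V1 q x) t = scale (inverse (q\<^sup>2 + 1)) (scale (q\<^sup>2) t - hop q x 1 t)" (is "_ = ?r")
proof -
  have "scale 1 (hop q x 1 t) + scale 1 t \<in> V1 q x"
    by (rule W2_lin_closed[OF subspace_V1 lin_lincomb[OF lin_hop lin_id] _ assms(3)])
      (use hop_plus_one_basis_in_V1 in simp)
  then have "hop q x 1 t + t \<in> V1 q x" by simp
  then have p: "?p \<in> V1 q x" by (intro tensor.subspace_scale subspace_V1)
  have "scale (q\<^sup>2) t + scale (- 1) (hop q x 1 t) \<in> V2 q"
    by (rule W2_lin_closed[OF subspace_V2 lin_lincomb[OF lin_id lin_hop] _ assms(3)])
      (use minus_hop_basis_in_V2[OF _ _ assms(1)] in simp)
  then have "scale (q\<^sup>2) t - hop q x 1 t \<in> V2 q" by simp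
  then have r: "?r \<in> V2 q" by (intro tensor.subspace_scale subspace_V2)
  have pr: "t = ?p + ?r"
  proof
    fix w
    have "(?p + ?r) w = (inverse (q\<^sup>2 + 1) * (q\<^sup>2 + 1)) * t w"
      unfolding tensor_apply by (simp only: algebra_simps) simp
    also have "\<dots> = t w" using assms(2) by simp
    finally show "t w = (?p + ?r) w" by simp
  qed
  have unique: "a = ?p" "b = ?r" if "a \<in> V1 q x" "b \<in> V2 q" "t = a + b" for a b
  proof -
    have "hop q x 1 a = scale (q\<^sup>2) a" "hop q x 1 b = scale (- 1) b"
      using that V1_subset_eigen V2_subset_eigen[OF assms(1)] by blast+
    then have "hop q x 1 t + t = scale (q\<^sup>2 + 1) a"
      "scale (q\<^sup>2) t - hop q x 1 t = scale (q\<^sup>2 + 1) b"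
      unfolding that(3) hop_linear by (simp_all add: fun_eq_iff tensor_apply algebra_simps)
    then show "a = ?p" "b = ?r" using assms(2) by simp_all
  qed
  show "proj_along (W 2) (V1 q x) (V2 q) t = ?p"
    unfolding proj_along_def restrict_apply' [OF assms(3)]
  proof (rule the_equality)
    show "?p \<in> V1 q x \<and> t - ?p \<in> V2 q" using p r pr by (metis add_diff_cancel_left')
    show "a = ?p" if "a \<in> V1 q x \<and> t - a \<in> V2 q" for a
      using unique(1)[of a "t - a"] that by simp
  qed
  show "proj_along (W 2) (V2 q) (V1 q x) t = ?r"
    unfolding proj_along_def restrict_apply' [OF assms(3)]
  proof (rule the_equality)
    show "?r \<in> V2 q \<and> t - ?r \<in> V1 q x" using p r pr by (metis add_diff_cancel_right')
    show "a = ?r" if "a \<in> V2 q \<and> t - a \<in> V1 q x" for a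
      using unique(2)[of "t - a" a] that by simp
  qed
qed

text \<open>
  The operator \<open>(u - v) h + v (q\<^sup>2 - 1)\<close> is \<open>u h - v q\<^sup>2 h\<^sup>-\<^sup>1\<close>.
\<close>

definition R_coeffs :: "complex \<Rightarrow> complex \<Rightarrow> complex \<Rightarrow> complex \<times> complex" where
  "R_coeffs q u v = (u - v, v * (q\<^sup>2 - 1))"

lemma R_box_eq:
  assumes "q \<noteq> 0" "q\<^sup>2 + 1 \<noteq> 0"
  shows "R_box q u v x = restrict (strand_op q x (R_coeffs q) u v 1) (W 2)"
proof
  fix t show "R_box q u v x t = restrict (strand_op q x (R_coeffs q) u v 1) (W 2) t"
  proof (cases "t \<in> W 2")
    case True
    show ?thesis
    proof
      fix w
      have "R_box q u v x t w = (inverse (q\<^sup>2 + 1) * (q\<^sup>2 + 1)) *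
          ((u - v) * hop q x 1 t w + v * (q\<^sup>2 - 1) * t w)"
        unfolding R_box_def restrict_apply'[OF True] proj_along_V[OF assms True] tensor_apply
        by (simp only: algebra_simps) simp
      also have "\<dots> = restrict (strand_op q x (R_coeffs q) u v 1) (W 2) t w"
        using assms(2) True by (simp add: strand_op_def R_coeffs_def tensor_apply)
      finally show "R_box q u v x t w = restrict (strand_op q x (R_coeffs q) u v 1) (W 2) t w" .
    qed
  qed (simp add: R_box_def)
qed

lemma R_adj_eq:
  assumes "q \<noteq> 0" "q\<^sup>2 + 1 \<noteq> 0" "i \<in> {1..<m}"
  shows "R_adj m q i u v x = restrict (strand_op q x (R_coeffs q) u v i) (W m)"
proof -
  let ?S = "\<lambda>x. strand_op q x (R_coeffs q) u v" and ?y = "q ^ (i - 1) * x"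
  let ?l = "m - i - 1"
  have dims: "2 + ?l = m - i + 1" "(i - 1) + (m - i + 1) = m" "(i - 1) + 1 = i" using assms(3) by auto
  have inner: "op_tensor (W 2) (R_box q u v ?y) (W ?l) (ident (W ?l)) =
      restrict (?S ?y 1) (W (m - i + 1))"
  proof (rule op_tensor_eqI)
    show "restrict (?S ?y 1) (W (m - i + 1)) \<in> endos (tensor_space (W 2) (W ?l))"
      unfolding tensor_space_W dims
      using assms(3) by (intro restrict_in_endos subspace_W lin_strand_op strand_op_in_W) auto
    fix s t assume st: "s \<in> W 2" "t \<in> W ?l"
    then have "conc s t \<in> W (m - i + 1)" using conc_in_W[OF st] dims by simp
    then show "restrict (?S ?y 1) (W (m - i + 1)) (conc s t) = conc (R_box q u v ?y s) (ident (W ?l) t)"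
      using st by (simp add: R_box_eq[OF assms(1,2)] ident_def strand_op_conc_left)
  qed
  show ?thesis unfolding R_adj_def inner
  proof (rule op_tensor_eqI)
    show "restrict (?S x i) (W m) \<in> endos (tensor_space (W (i - 1)) (W (m - i + 1)))"
      unfolding tensor_space_W dims
      using assms(3) by (intro restrict_in_endos subspace_W lin_strand_op strand_op_in_W) auto
    fix s t assume st: "s \<in> W (i - 1)" "t \<in> W (m - i + 1)"
    then have "conc s t \<in> W m" using conc_in_W[OF st] dims by simp
    moreover have "?S x i (conc s t) = conc s (?S ?y 1 t)"
      using strand_op_conc_right[OF st(1), of 1 q x "R_coeffs q" u v t] unfolding dims by simp
    ultimately show "restrict (?S x i) (W m) (conc s t) =
        conc (ident (W (i - 1)) s) (restrict (?S ?y 1) (W (m - i + 1)) t)"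
      using st by (simp add: ident_def)
  qed
qed

lemma yang_baxter_R_coeffs: "yang_baxter_coeffs q (R_coeffs q)"
  unfolding yang_baxter_coeffs_def R_coeffs_def by (simp add: algebra_simps)

text \<open>
  Every way of building an operator for \<open>\<sigma>\<close> is the ordered product along some reduced word of \<open>\<sigma>\<close>, so
  Matsumoto's theorem makes the operator unique.
\<close>

lemma R_perm_eq:
  assumes "q \<noteq> 0" "q\<^sup>2 + 1 \<noteq> 0" "reduced_word m is \<sigma>"
  shows "R_perm m q a x \<sigma> = restrict (run (strand_op q x (R_coeffs q)) a is) (W m)"
proof -
  let ?run = "run (strand_op q x (R_coeffs q))"
  interpret word_action m "W m" "strand_op q x (R_coeffs q)"
    by (rule word_action_strand_op[OF yang_baxter_R_coeffs])
  have word: "\<exists>js. reduced_word m js \<rho> \<and> A = restrict (?run b js) (W m)"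
    if "R_perm_rel m q x b \<rho> A" for b \<rho> A
    using that
  proof (induction rule: R_perm_rel.induct)
    case (one a)
    have "reduced_word m [] id" by (simp add: reduced_word_def inv_count_id)
    then show ?case by (intro exI[of _ "[]"]) (auto simp: ident_def)
  next
    case (adj i a)
    have "reduced_word m [] id" by (simp add: reduced_word_def inv_count_id)
    then have "reduced_word m [i] (adj i)"
      using adj adj_permutes[of i m] by (simp add: reduced_word_Cons adj_comp_adj)
    moreover have "R_adj m q i (a i) (a (i + 1)) x = restrict (?run a [i]) (W m)"
      unfolding R_adj_eq[OF assms(1,2) adj] by (intro restrict_ext) simp
    ultimately show ?case by blast
  next
    case (mult a \<sigma> A \<sigma>' B)
    then obtain js ks where js: "reduced_word m js \<sigma>" "A = restrict (?run a js) (W m)"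
      and ks: "reduced_word m ks \<sigma>'" "B = restrict (?run (act \<sigma> a) ks) (W m)" by blast
    have p: "\<sigma> permutes {1..m}" "\<sigma>' permutes {1..m}" using js ks reduced_word_permutes by blast+
    have "reduced_word m (js @ ks) (\<sigma>' \<circ> \<sigma>)"
      using mult.hyps(3) perm_length_eq_inv_count[OF p(1)] perm_length_eq_inv_count[OF p(2)]
        perm_length_eq_inv_count[OF permutes_compose[OF p]]
      by (intro reduced_word_appendI js ks) simp
    moreover have "compose (W m) B A = restrict (?run a (js @ ks)) (W m)"
    proof -
      have set: "set js \<subseteq> {1..<m}" and w: "word_perm js = \<sigma>" using js by (simp_all add: reduced_word_def)
      have act_eq: "act \<sigma> a = a \<circ> inv_into UNIV (word_perm js)" by (simp add: act_def w comp_def)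
      show ?thesis unfolding js(2) ks(2) act_eq
        by (subst compose_restrict) (auto simp: run_append[OF set] run_closed[OF set] intro!: restrict_ext)
    qed
    ultimately show ?case by blast
  qed
  have build: "R_perm_rel m q x b \<rho> (restrict (?run b js) (W m))" if "reduced_word m js \<rho>" for b js \<rho>
    using that
  proof (induction js arbitrary: b \<rho>)
    case Nil
    then have "\<rho> = id" by (simp add: reduced_word_def)
    moreover have "restrict (?run b []) (W m) = ident (W m)" by (simp add: ident_def fun_eq_iff restrict_def)
    ultimately show ?case using R_perm_rel.one[of m q x b] by metis
  next
    case (Cons i js)
    then have i: "i \<in> {1..<m}" "reduced_word m js (\<rho> \<circ> adj i)" "\<rho> permutes {1..m}"
      by (simp_all add: reduced_word_Cons)
    have len: "length (i # js) = inv_count \<rho>" "length js = inv_count (\<rho> \<circ> adj i)"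
      using Cons.prems i(2) by (simp_all add: reduced_word_def)
    have "R_perm_rel m q x b (\<rho> \<circ> adj i \<circ> adj i)
        (compose (W m) (restrict (?run (act (adj i) b) js) (W m)) (R_adj m q i (b i) (b (i + 1)) x))"
    proof (rule R_perm_rel.mult)
      show "R_perm_rel m q x b (adj i) (R_adj m q i (b i) (b (i + 1)) x)" by (rule R_perm_rel.adj[OF i(1)])
      show "R_perm_rel m q x (act (adj i) b) (\<rho> \<circ> adj i) (restrict (?run (act (adj i) b) js) (W m))"
        by (rule Cons.IH[OF i(2)])
      have "inv_count (adj i) = 1"
        using inv_count_up[OF permutes_id, of i] by (simp add: inv_count_id id_apply)
      then show "perm_length m (\<rho> \<circ> adj i \<circ> adj i) = perm_length m (\<rho> \<circ> adj i) + perm_length m (adj i)"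
        using len i(1,3) permutes_compose[OF adj_permutes[OF i(1)] i(3)] adj_permutes[OF i(1)]
        by (simp add: comp_adj_adj perm_length_eq_inv_count)
    qed
    moreover have "compose (W m) (restrict (?run (act (adj i) b) js) (W m)) (R_adj m q i (b i) (b (i + 1)) x)
        = restrict (?run b (i # js)) (W m)"
      unfolding R_adj_eq[OF assms(1,2) i(1)] act_adj
      by (subst compose_restrict) (use i(1) in \<open>auto simp: strand_op_in_W\<close>)
    ultimately show ?case by (simp only: comp_adj_adj)
  qed
  show ?thesis unfolding R_perm_def
  proof (rule the_equality)
    show "R_perm_rel m q x a \<sigma> (restrict (?run a is) (W m))" by (rule build[OF assms(3)])
    fix A assume "R_perm_rel m q x a \<sigma> A"
    then obtain js where "reduced_word m js \<sigma>" "A = restrict (?run a js) (W m)" using word by blast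
    then show "A = restrict (?run a is) (W m)"
      using run_reduced_unique[OF assms(3)] by (auto simp: restrict_def fun_eq_iff)
  qed
qed

section \<open>Symmetrisers and the Poincare polynomial of the symmetric group\<close>

lemma inv_count_inv:
  assumes "\<sigma> permutes {1..m}"
  shows "inv_count (inv_into UNIV \<sigma>) = inv_count \<sigma>"
proof -
  note inv = permutes_inverses[OF assms]
  have "bij_betw (\<lambda>(a, b). (\<sigma> b, \<sigma> a)) (inversions \<sigma>) (inversions (inv_into UNIV \<sigma>))"
    by (rule bij_betwI[where g = "\<lambda>(a, b). (inv_into UNIV \<sigma> b, inv_into UNIV \<sigma> a)"])
      (auto simp: inversions_def inv)
  then show ?thesis unfolding inv_count_def by (simp add: bij_betw_same_card)
qed

lemma inv_count_adj_comp:
  assumes "\<sigma> permutes {1..m}" "inv_into UNIV \<sigma> i < inv_into UNIV \<sigma> (i + 1)" "i \<in> {1..<m}"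
  shows "inv_count (adj i \<circ> \<sigma>) = Suc (inv_count \<sigma>)"
proof -
  have p: "inv_into UNIV \<sigma> permutes {1..m}" using permutes_inv[OF assms(1)] .
  have p': "adj i \<circ> \<sigma> permutes {1..m}" using permutes_compose[OF assms(1) adj_permutes[OF assms(3)]] .
  have "inv_into UNIV (adj i \<circ> \<sigma>) = inv_into UNIV \<sigma> \<circ> adj i"
    using permutes_bij[OF assms(1)] permutes_bij[OF adj_permutes[OF assms(3)]]
    by (simp add: o_inv_distrib)
  then have "inv_count (adj i \<circ> \<sigma>) = inv_count (inv_into UNIV \<sigma> \<circ> adj i)"
    using inv_count_inv[OF p'] by simp
  then show ?thesis using inv_count_up[OF p assms(2)] inv_count_inv[OF assms(1)] by simp
qed

text \<open>
  The cycle that sends \<open>k\<close> to \<open>n + 1\<close> and lowers \<open>k + 1, \<dots>, n + 1\<close> by one. For \<open>k = 1, \<dots>, n + 1\<close> these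
  cycles are the shortest representatives of the cosets \<open>S\<^sub>n \<sigma>\<close> in \<open>S\<^sub>n\<^sub>+\<^sub>1\<close>.
\<close>

definition cycle_perm :: "nat \<Rightarrow> nat \<Rightarrow> nat \<Rightarrow> nat" where
  "cycle_perm n k = word_perm [k..<n + 1]"

lemma cycle_perm_top: "cycle_perm n (n + 1) = id"
  by (simp add: cycle_perm_def)

lemma cycle_perm_step: "k \<le> n \<Longrightarrow> cycle_perm n k = cycle_perm n (Suc k) \<circ> adj k"
  unfolding cycle_perm_def by (subst upt_rec) simp

lemma cycle_perm_permutes: "1 \<le> k \<Longrightarrow> cycle_perm n k permutes {1..n + 1}"
  unfolding cycle_perm_def by (rule word_perm_permutes) auto

lemma inv_count_comp_cycle:
  assumes "\<rho> permutes {1..n}" "1 \<le> k" "k \<le> n + 1"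
  shows "(\<rho> \<circ> cycle_perm n k) k = n + 1 \<and>
    inv_count (\<rho> \<circ> cycle_perm n k) = inv_count \<rho> + (n + 1 - k)"
  using assms(3,2)
proof (induction k rule: inc_induct)
  case base
  have "\<rho> \<circ> cycle_perm n (n + 1) = \<rho>" by (simp only: cycle_perm_top o_id)
  then show ?case using permutes_not_in[OF assms(1), of "n + 1"] by simp
next
  case (step k)
  let ?\<sigma> = "\<rho> \<circ> cycle_perm n (Suc k)"
  have perm: "?\<sigma> permutes {1..n + 1}"
    using permutes_subset[OF assms(1), of "{1..n + 1}"]
    by (intro permutes_compose cycle_perm_permutes) auto
  have IH: "?\<sigma> (Suc k) = n + 1" "inv_count ?\<sigma> = inv_count \<rho> + (n - k)" using step by simp_all
  have "?\<sigma> k \<in> {1..n + 1}" using permutes_in_image[OF perm, of k] step by simp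
  moreover have "?\<sigma> k \<noteq> ?\<sigma> (Suc k)" using inj_eq[OF permutes_inj[OF perm]] by simp
  ultimately have less: "?\<sigma> k < ?\<sigma> (k + 1)" using IH(1) by simp
  have "\<rho> \<circ> cycle_perm n k = ?\<sigma> \<circ> adj k" using step by (simp add: cycle_perm_step o_assoc)
  moreover have "(?\<sigma> \<circ> adj k) k = ?\<sigma> (Suc k)" by (simp only: comp_apply[of _ "adj k"] adj_simps Suc_eq_plus1)
  ultimately show ?case using inv_count_up[OF perm less] IH step by simp
qed

lemma sum_inv_count_Suc:
  fixes Q :: complex
  shows "(\<Sum>\<sigma> | \<sigma> permutes {1..n + 1}. Q ^ inv_count \<sigma>) =
    (\<Sum>\<sigma> | \<sigma> permutes {1..n}. Q ^ inv_count \<sigma>) * (\<Sum>j<n + 1. Q ^ j)"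
proof -
  let ?S = "\<lambda>n. {\<sigma>. \<sigma> permutes {1..n}}" and ?F = "\<lambda>(\<rho>, k). \<rho> \<circ> cycle_perm n k"
  let ?D = "?S n \<times> {1..n + 1}"
  have inj: "inj_on ?F ?D"
  proof (rule inj_onI, clarify)
    fix \<rho> k \<rho>' k'
    assume *: "\<rho> permutes {1..n}" "\<rho>' permutes {1..n}" "k \<in> {1..n + 1}" "k' \<in> {1..n + 1}"
      and eq: "\<rho> \<circ> cycle_perm n k = \<rho>' \<circ> cycle_perm n k'"
    have cyc: "cycle_perm n k permutes {1..n + 1}" using * by (intro cycle_perm_permutes) auto
    have perm: "\<rho> \<circ> cycle_perm n k permutes {1..n + 1}"
      by (rule permutes_compose[OF cyc permutes_subset[OF *(1)]]) auto
    have "(\<rho> \<circ> cycle_perm n k) k = (\<rho> \<circ> cycle_perm n k) k'"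
      using inv_count_comp_cycle[of \<rho> n k] inv_count_comp_cycle[of \<rho>' n k'] * eq by simp
    then have k: "k = k'" using inj_eq[OF permutes_inj[OF perm]] by blast
    have eq': "\<rho> \<circ> cycle_perm n k = \<rho>' \<circ> cycle_perm n k" using eq k by simp
    have cancel: "\<theta> \<circ> cycle_perm n k \<circ> inv_into UNIV (cycle_perm n k) = \<theta>" for \<theta> :: "nat \<Rightarrow> nat"
      by (simp only: o_assoc[symmetric] permutes_inv_o[OF cyc] o_id)
    have "\<rho> = \<rho>' \<circ> cycle_perm n k \<circ> inv_into UNIV (cycle_perm n k)"
      using cancel[of \<rho>] by (simp only: eq')
    also have "\<dots> = \<rho>'" by (rule cancel)
    finally show "\<rho> = \<rho>' \<and> k = k'" using k by simp
  qed
  have fin: "finite (?S m)" for m :: nat by (simp add: finite_permutations)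
  have sub: "?F ` ?D \<subseteq> ?S (n + 1)"
  proof (clarify, rule permutes_compose)
    fix \<rho> k assume *: "\<rho> permutes {1..n}" "k \<in> {1..n + 1}"
    show "cycle_perm n k permutes {1..n + 1}" using * by (intro cycle_perm_permutes) auto
    show "\<rho> permutes {1..n + 1}" using permutes_subset[OF *(1)] by auto
  qed
  have "card (?F ` ?D) = card (?S (n + 1))"
    unfolding card_image[OF inj] by (simp add: card_cartesian_product card_permutations[OF refl] id_apply)
  then have image: "?F ` ?D = ?S (n + 1)" using card_subset_eq[OF fin sub] by blast
  have "(\<Sum>\<sigma>\<in>?S (n + 1). Q ^ inv_count \<sigma>) = (\<Sum>p\<in>?D. Q ^ inv_count (?F p))"
    unfolding image[symmetric] sum.reindex[OF inj] comp_apply[of "\<lambda>\<sigma>. Q ^ inv_count \<sigma>"] ..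
  also have "\<dots> = (\<Sum>(\<rho>, k)\<in>?D. Q ^ inv_count \<rho> * Q ^ (n + 1 - k))"
    by (intro sum.cong) (auto simp: inv_count_comp_cycle simp flip: power_add)
  also have "\<dots> = (\<Sum>\<rho>\<in>?S n. Q ^ inv_count \<rho>) * (\<Sum>k = 1..n + 1. Q ^ (n + 1 - k))"
    by (simp only: sum_product sum.cartesian_product)
  also have "(\<Sum>k = 1..n + 1. Q ^ (n + 1 - k)) = (\<Sum>k<n + 1. Q ^ (n + 1 - Suc k))"
    using sum.atLeast1_atMost_eq[of "\<lambda>k. Q ^ (n + 1 - k)" "n + 1"] by simp
  also have "\<dots> = (\<Sum>j<n + 1. Q ^ j)"
    by (rule sum.nat_diff_reindex)
  finally show ?thesis .
qed

lemma sum_inv_count_nonzero: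
  fixes Q :: complex
  assumes "\<And>r. r > 0 \<Longrightarrow> Q ^ r \<noteq> 1"
  shows "(\<Sum>\<sigma> | \<sigma> permutes {1..n}. Q ^ inv_count \<sigma>) \<noteq> 0"
proof (induction n)
  case 0
  have "{\<sigma>. \<sigma> permutes {1..0::nat}} = {id}" by simp
  then show ?case by (simp add: inv_count_id)
next
  case (Suc n)
  have "(Q - 1) * (\<Sum>j<n + 1. Q ^ j) = Q ^ (n + 1) - 1"
    by (rule power_diff_1_eq[symmetric])
  then have "(\<Sum>j<n + 1. Q ^ j) \<noteq> 0" using assms[of "n + 1"] by force
  then show ?case using Suc sum_inv_count_Suc[of Q n] by simp
qed

text \<open>
  The product of the \<open>h_i\<close> along a word, the head of the word acting first.
\<close>

definition hecke_op :: "complex \<Rightarrow> complex \<Rightarrow> nat list \<Rightarrow> tensor \<Rightarrow> tensor" where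
  "hecke_op q x is = run (\<lambda>_ _. hop q x) (\<lambda>_. ()) is"

lemma hecke_op_strand_op: "hecke_op q x is = run (strand_op q x (\<lambda>_ _. (1, 0))) (\<lambda>_. ()) is"
proof -
  have "(\<lambda>_ _. hop q x) = strand_op q x (\<lambda>(_ :: unit) _. (1, 0))"
    by (simp add: fun_eq_iff strand_op_def)
  then show ?thesis by (simp add: hecke_op_def)
qed

lemma hecke_op_Nil [simp]: "hecke_op q x [] t = t"
  and hecke_op_Cons: "hecke_op q x (i # is) t = hecke_op q x is (hop q x i t)"
proof -
  have "(\<lambda>_. ()) \<circ> adj i = (\<lambda>_. ())" by (simp add: fun_eq_iff)
  then show "hecke_op q x [] t = t" "hecke_op q x (i # is) t = hecke_op q x is (hop q x i t)"
    by (simp_all add: hecke_op_def)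
qed

lemma hecke_op_append: "hecke_op q x (is @ js) t = hecke_op q x js (hecke_op q x is t)"
  by (induction "is" arbitrary: t) (simp_all add: hecke_op_Cons)

lemma lin_hecke_op: "lin (hecke_op q x is)"
  unfolding hecke_op_strand_op by (rule lin_run_strand_op)

lemma hecke_op_in_W: "t \<in> W m \<Longrightarrow> set is \<subseteq> {1..<m} \<Longrightarrow> hecke_op q x is t \<in> W m"
  unfolding hecke_op_strand_op by (rule run_strand_op_in_W)

lemma hecke_op_reduced:
  assumes "reduced_word m is \<sigma>" "reduced_word m js \<sigma>" "t \<in> W m"
  shows "hecke_op q x is t = hecke_op q x js t"
proof -
  interpret word_action m "W m" "strand_op q x (\<lambda>(_ :: unit) _. (1, 0))"
    by (rule word_action_strand_op) (simp add: yang_baxter_coeffs_def)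
  show ?thesis unfolding hecke_op_strand_op by (rule run_reduced_unique[OF assms])
qed

lemma hecke_op_eigen:
  assumes "\<And>i. i \<in> set is \<Longrightarrow> hop q x i t = scale l t"
  shows "hecke_op q x is t = scale (l ^ length is) t"
  using assms
proof (induction "is")
  case (Cons i "is")
  then show ?case by (simp add: hecke_op_Cons linD[OF lin_hecke_op] mult.commute)
qed simp

definition some_word :: "nat \<Rightarrow> (nat \<Rightarrow> nat) \<Rightarrow> nat list" where
  "some_word m \<sigma> = (SOME is. reduced_word m is \<sigma>)"

lemma reduced_some_word: "\<sigma> permutes {1..m} \<Longrightarrow> reduced_word m (some_word m \<sigma>) \<sigma>"
  unfolding some_word_def using reduced_word_ex by (rule someI_ex)

text \<open>
  The sum of \<open>c\<^sup>\<ell>\<^sup>(\<^sup>\<sigma>\<^sup>)\<close> times the operator of \<open>h(\<sigma>)\<close>. It is the operator of \<open>e\<^sub>+\<close> for \<open>c = 1\<close> and of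
  \<open>e\<^sub>-\<close> for \<open>c = -q\<^sup>-\<^sup>2\<close>.
\<close>

definition symmetriser :: "complex \<Rightarrow> complex \<Rightarrow> complex \<Rightarrow> nat \<Rightarrow> tensor \<Rightarrow> tensor" where
  "symmetriser c q x n t =
    (\<Sum>\<sigma> | \<sigma> permutes {1..n}. scale (c ^ inv_count \<sigma>) (hecke_op q x (some_word n \<sigma>) t))"

lemma symmetriser_in_W: "t \<in> W n \<Longrightarrow> symmetriser c q x n t \<in> W n"
  unfolding symmetriser_def
proof (intro tensor.subspace_sum subspace_W tensor.subspace_scale)
  fix \<sigma> assume "t \<in> W n" "\<sigma> \<in> {\<sigma>. \<sigma> permutes {1..n}}"
  then show "hecke_op q x (some_word n \<sigma>) t \<in> W n"
    using reduced_some_word[of \<sigma> n] by (intro hecke_op_in_W) (auto simp: reduced_word_def)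
qed

text \<open>
  The assumption says that \<open>c\<close> is \<open>1\<close> or \<open>-q\<^sup>-\<^sup>2\<close>. The terms of the symmetriser are paired as \<open>\<sigma>\<close>
  and \<open>\<sigma>\<^sub>i \<sigma>\<close> with \<open>\<ell>(\<sigma>\<^sub>i \<sigma>) = \<ell>(\<sigma>) + 1\<close>; each pair contributes a multiple of \<open>(1 + c h_i) h(\<sigma>)\<close>, and
  \<open>h_i (1 + c h_i) = c q\<^sup>2 (1 + c h_i)\<close>.
\<close>

lemma hop_symmetriser:
  assumes "(c - 1) * (q\<^sup>2 * c + 1) = 0" "t \<in> W n" "i \<in> {1..<n}"
  shows "hop q x i (symmetriser c q x n t) = scale (c * q\<^sup>2) (symmetriser c q x n t)"
proof -
  \<comment> \<open>\<open>U\<close> contains the \<open>\<sigma>\<close> with \<open>\<ell>(\<sigma>\<^sub>i \<sigma>) > \<ell>(\<sigma>)\<close>.\<close>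
  define S where "S = {\<sigma>. \<sigma> permutes {1..n}}"
  define U where "U = {\<sigma> \<in> S. inv_into UNIV \<sigma> i < inv_into UNIV \<sigma> (i + 1)}"
  define T where "T \<sigma> = hecke_op q x (some_word n \<sigma>) t" for \<sigma>
  have finS: "finite S" by (simp add: S_def finite_permutations)
  have adjS: "adj i \<circ> \<sigma> \<in> S" if "\<sigma> \<in> S" for \<sigma>
    using that permutes_compose[OF _ adj_permutes[OF assms(3)]] by (simp add: S_def)
  have inv_adj_comp: "inv_into UNIV (adj i \<circ> \<sigma>) = inv_into UNIV \<sigma> \<circ> adj i" if "\<sigma> \<in> S" for \<sigma>
    using that permutes_bij[of \<sigma>] permutes_bij[OF adj_permutes[OF assms(3)]]
    by (simp add: S_def o_inv_distrib[of "adj i" \<sigma>])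
  have cancel: "adj i \<circ> (adj i \<circ> \<sigma>) = \<sigma>" for \<sigma> by (simp add: fun_eq_iff comp_apply)
  have ne: "inv_into UNIV \<sigma> i \<noteq> inv_into UNIV \<sigma> (i + 1)" if "\<sigma> \<in> S" for \<sigma>
    using that by (simp add: S_def inj_eq[OF permutes_inj[OF permutes_inv]])
  have D: "S - U = (\<lambda>\<sigma>. adj i \<circ> \<sigma>) ` U"
  proof (intro equalityI subsetI)
    fix \<sigma> assume "\<sigma> \<in> S - U"
    then have "\<sigma> \<in> S" "inv_into UNIV \<sigma> (i + 1) < inv_into UNIV \<sigma> i"
      using ne[of \<sigma>] by (auto simp: U_def linorder_not_less le_less)
    then have "adj i \<circ> \<sigma> \<in> U" using adjS by (simp add: U_def inv_adj_comp comp_apply)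
    then show "\<sigma> \<in> (\<lambda>\<sigma>. adj i \<circ> \<sigma>) ` U" using cancel[of \<sigma>] by (intro image_eqI) auto
  next
    fix \<rho> assume "\<rho> \<in> (\<lambda>\<sigma>. adj i \<circ> \<sigma>) ` U"
    then obtain \<sigma> where \<sigma>: "\<rho> = adj i \<circ> \<sigma>" "\<sigma> \<in> S" "inv_into UNIV \<sigma> i < inv_into UNIV \<sigma> (i + 1)"
      by (auto simp: U_def)
    then show "\<rho> \<in> S - U" using adjS by (simp add: U_def inv_adj_comp comp_apply)
  qed
  have inj: "inj_on (\<lambda>\<sigma>. adj i \<circ> \<sigma>) U" by (rule inj_on_inverseI[of _ "\<lambda>\<sigma>. adj i \<circ> \<sigma>"]) (rule cancel)
  have step: "inv_count (adj i \<circ> \<sigma>) = Suc (inv_count \<sigma>) \<and> T (adj i \<circ> \<sigma>) = hop q x i (T \<sigma>)"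
    if "\<sigma> \<in> U" for \<sigma>
  proof -
    have \<sigma>: "\<sigma> permutes {1..n}" using that by (simp add: U_def S_def)
    have len: "inv_count (adj i \<circ> \<sigma>) = Suc (inv_count \<sigma>)"
      using inv_count_adj_comp[OF \<sigma> _ assms(3)] that by (simp add: U_def)
    have "reduced_word n (some_word n \<sigma> @ [i]) (adj i \<circ> \<sigma>)"
      using reduced_some_word[OF \<sigma>] len assms(3) by (auto simp: reduced_word_def word_perm_append)
    then have "T (adj i \<circ> \<sigma>) = hecke_op q x (some_word n \<sigma> @ [i]) t"
      unfolding T_def using hecke_op_reduced[OF reduced_some_word _ assms(2)] adjS that
      by (simp add: U_def S_def)
    then show ?thesis using len by (simp add: T_def hecke_op_append hecke_op_Cons)
  qed
  have TW: "T \<sigma> \<in> W n" if "\<sigma> \<in> S" for \<sigma>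
    unfolding T_def using reduced_some_word[of \<sigma> n] that assms(2)
    by (intro hecke_op_in_W) (auto simp: reduced_word_def S_def)
  have "symmetriser c q x n t = (\<Sum>\<sigma>\<in>S - U. scale (c ^ inv_count \<sigma>) (T \<sigma>)) + (\<Sum>\<sigma>\<in>U. scale (c ^ inv_count \<sigma>) (T \<sigma>))"
    unfolding symmetriser_def S_def[symmetric] T_def
    by (rule sum.subset_diff[OF _ finS]) (auto simp: U_def)
  also have "(\<Sum>\<sigma>\<in>S - U. scale (c ^ inv_count \<sigma>) (T \<sigma>)) =
      (\<Sum>\<sigma>\<in>U. scale (c ^ Suc (inv_count \<sigma>)) (hop q x i (T \<sigma>)))"
    unfolding D sum.reindex[OF inj]
    by (rule sum.cong[OF refl]) (simp only: comp_apply[of _ "\<lambda>\<sigma>. adj i \<circ> \<sigma>"] step)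
  finally have sym: "symmetriser c q x n t =
      (\<Sum>\<sigma>\<in>U. scale (c ^ inv_count \<sigma>) (scale c (hop q x i (T \<sigma>)) + T \<sigma>))"
    by (simp add: sum.distrib tensor.scale_right_distrib mult.commute)
  have "hop q x i (scale c (hop q x i s) + s) = scale (c * q\<^sup>2) (scale c (hop q x i s) + s)"
    if "s \<in> W n" for s
  proof
    fix w
    have "1 + c * (q\<^sup>2 - 1) - c\<^sup>2 * q\<^sup>2 = 0" using assms(1) by (simp add: algebra_simps power2_eq_square)
    moreover have "hop q x i (scale c (hop q x i s) + s) w - scale (c * q\<^sup>2) (scale c (hop q x i s) + s) w
        = (1 + c * (q\<^sup>2 - 1) - c\<^sup>2 * q\<^sup>2) * hop q x i s w"
      unfolding hop_linear hop_quadratic[OF that assms(3)] tensor_apply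
      by (simp add: algebra_simps power2_eq_square)
    ultimately show "hop q x i (scale c (hop q x i s) + s) w = scale (c * q\<^sup>2) (scale c (hop q x i s) + s) w"
      by simp
  qed
  then have "hop q x i (scale c (hop q x i (T \<sigma>)) + T \<sigma>) = scale (c * q\<^sup>2) (scale c (hop q x i (T \<sigma>)) + T \<sigma>)"
    if "\<sigma> \<in> U" for \<sigma> using TW that by (simp add: U_def)
  then show ?thesis
    unfolding sym lin_sum[OF lin_hop] linD(2)[OF lin_hop] tensor.scale_sum_right
    by (intro sum.cong refl) (simp add: mult.commute)
qed

lemma symmetriser_eigen:
  assumes "\<And>i. i \<in> {1..<n} \<Longrightarrow> hop q x i t = scale l t"
  shows "symmetriser c q x n t = scale (\<Sum>\<sigma> | \<sigma> permutes {1..n}. (c * l) ^ inv_count \<sigma>) t"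
proof -
  have "hecke_op q x (some_word n \<sigma>) t = scale (l ^ inv_count \<sigma>) t" if "\<sigma> permutes {1..n}" for \<sigma>
    using reduced_some_word[OF that] assms
    by (subst hecke_op_eigen[where l = l]) (auto simp: reduced_word_def)
  then show ?thesis
    unfolding symmetriser_def by (simp add: tensor.scale_sum_left power_mult_distrib)
qed

section \<open>The Hecke algebra and its representation\<close>

text \<open>
  The finitely supported tensors are the elements of the free algebra on all natural numbers.
\<close>

definition fin_supp :: "tensor \<Rightarrow> bool" where
  "fin_supp f \<longleftrightarrow> finite {w. f w \<noteq> 0}"

lemma fin_supp_add: "fin_supp f \<Longrightarrow> fin_supp g \<Longrightarrow> fin_supp (f + g)"
  unfolding fin_supp_def
  by (rule finite_subset[of _ "{w. f w \<noteq> 0} \<union> {w. g w \<noteq> 0}"]) (auto simp: tensor_apply)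

lemma fin_supp_scale: "fin_supp f \<Longrightarrow> fin_supp (scale c f)"
  unfolding fin_supp_def by (rule finite_subset[of _ "{w. f w \<noteq> 0}"]) (auto simp: tensor_apply)

lemma fin_supp_zero: "fin_supp 0"
  by (simp add: fin_supp_def tensor_apply)

lemma fin_supp_sum: "(\<And>i. i \<in> I \<Longrightarrow> fin_supp (F i)) \<Longrightarrow> fin_supp (\<Sum>i\<in>I. F i)"
  by (induction I rule: infinite_finite_induct) (auto simp: fin_supp_zero fin_supp_add)

lemma fin_supp_basis: "fin_supp (basis w)"
  by (simp add: fin_supp_def basis_def)

lemma fin_supp_expand:
  assumes "fin_supp f"
  shows "f = (\<Sum>w | f w \<noteq> 0. scale (f w) (basis w))"
proof
  fix v
  have "(\<Sum>w | f w \<noteq> 0. scale (f w) (basis w)) v = (\<Sum>w | f w \<noteq> 0. if w = v then f v else 0)"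
    by (auto simp: sum_tensor_apply basis_def scale_apply intro!: sum.cong)
  also have "\<dots> = f v" using assms by (simp add: fin_supp_def)
  finally show "f v = (\<Sum>w | f w \<noteq> 0. scale (f w) (basis w)) v" by simp
qed

text \<open>
  The representation of the free algebra that sends the \<open>i\<close>-th generator to \<open>h_i\<close>. In a monomial the
  last generator acts first, whereas \<^const>\<open>hecke_op\<close> starts with the head of its word.
\<close>

definition free_rep :: "complex \<Rightarrow> complex \<Rightarrow> tensor \<Rightarrow> tensor \<Rightarrow> tensor" where
  "free_rep q x f t = (\<Sum>w | f w \<noteq> 0. scale (f w) (hecke_op q x (rev w) t))"

lemma free_rep_superset:
  assumes "finite S" "{w. f w \<noteq> 0} \<subseteq> S"
  shows "free_rep q x f t = (\<Sum>w\<in>S. scale (f w) (hecke_op q x (rev w) t))"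
  unfolding free_rep_def using assms by (intro sum.mono_neutral_left) auto

lemma free_rep_add:
  assumes "fin_supp f" "fin_supp g"
  shows "free_rep q x (f + g) t = free_rep q x f t + free_rep q x g t"
proof -
  let ?S = "{w. f w \<noteq> 0} \<union> {w. g w \<noteq> 0}"
  have fin: "finite ?S" using assms by (simp add: fin_supp_def)
  have "free_rep q x (f + g) t = (\<Sum>w\<in>?S. scale ((f + g) w) (hecke_op q x (rev w) t))"
    by (rule free_rep_superset[OF fin]) (auto simp: tensor_apply)
  also have "\<dots> = (\<Sum>w\<in>?S. scale (f w) (hecke_op q x (rev w) t)) + (\<Sum>w\<in>?S. scale (g w) (hecke_op q x (rev w) t))"
    by (simp add: plus_fun_apply tensor.scale_left_distrib sum.distrib)
  finally show ?thesis using free_rep_superset[OF fin, of f q x t] free_rep_superset[OF fin, of g q x t] by auto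
qed

lemma free_rep_scale:
  assumes "fin_supp f"
  shows "free_rep q x (scale c f) t = scale c (free_rep q x f t)"
proof -
  have "free_rep q x (scale c f) t = (\<Sum>w | f w \<noteq> 0. scale (scale c f w) (hecke_op q x (rev w) t))"
    by (rule free_rep_superset) (use assms in \<open>auto simp: fin_supp_def tensor_apply\<close>)
  then show ?thesis by (simp add: free_rep_def tensor.scale_sum_right scale_apply)
qed

lemma free_rep_zero: "free_rep q x 0 t = 0"
  by (simp add: free_rep_def zero_fun_apply)

lemma free_rep_diff:
  assumes "fin_supp f" "fin_supp g"
  shows "free_rep q x (f - g) t = free_rep q x f t - free_rep q x g t"
  using free_rep_add[OF assms(1) fin_supp_scale[OF assms(2), of "- 1"]] free_rep_scale[OF assms(2), of q x "- 1"]
  by simp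

lemma free_rep_sum:
  assumes "\<And>i. i \<in> I \<Longrightarrow> fin_supp (F i)"
  shows "free_rep q x (\<Sum>i\<in>I. F i) t = (\<Sum>i\<in>I. free_rep q x (F i) t)"
  using assms
  by (induction I rule: infinite_finite_induct) (auto simp: free_rep_zero free_rep_add fin_supp_sum)

lemma free_rep_basis: "free_rep q x (basis w) t = hecke_op q x (rev w) t"
  using free_rep_superset[of "{w}" "basis w"] by (simp add: basis_def)

lemma lin_free_rep: "lin (free_rep q x f)"
  unfolding lin_def free_rep_def
  by (simp add: linD[OF lin_hecke_op] tensor.scale_right_distrib sum.distrib tensor.scale_sum_right mult.commute)

lemma conc_expand:
  assumes "fin_supp f" "fin_supp g"
  shows "conc f g = (\<Sum>u | f u \<noteq> 0. \<Sum>v | g v \<noteq> 0. scale (f u * g v) (basis (u @ v)))"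
proof -
  have "conc f g = conc (\<Sum>u | f u \<noteq> 0. scale (f u) (basis u)) (\<Sum>v | g v \<noteq> 0. scale (g v) (basis v))"
    using fin_supp_expand[OF assms(1)] fin_supp_expand[OF assms(2)] by simp
  then show ?thesis
    by (subst sum.swap)
      (simp add: conc_sum_left conc_sum_right conc_scale_left conc_scale_right conc_basis
        tensor.scale_sum_right mult.commute)
qed

lemma free_rep_conc:
  assumes "fin_supp f" "fin_supp g"
  shows "free_rep q x (conc f g) t = free_rep q x f (free_rep q x g t)"
proof -
  have "free_rep q x (conc f g) t =
      (\<Sum>u | f u \<noteq> 0. \<Sum>v | g v \<noteq> 0. scale (f u * g v) (hecke_op q x (rev (u @ v)) t))"
    unfolding conc_expand[OF assms]
    by (simp add: free_rep_sum free_rep_scale free_rep_basis fin_supp_sum fin_supp_scale fin_supp_basis)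
  also have "\<dots> = (\<Sum>u | f u \<noteq> 0. scale (f u) (hecke_op q x (rev u) (free_rep q x g t)))"
    unfolding free_rep_def[of q x g]
    by (simp add: lin_sum[OF lin_hecke_op] linD[OF lin_hecke_op] hecke_op_append tensor.scale_sum_right)
  finally show ?thesis by (simp add: free_rep_def[of q x f])
qed

lemma free_alg_carrier:
  "f \<in> carrier (free_alg n) \<longleftrightarrow> fin_supp f \<and> (\<forall>w. f w \<noteq> 0 \<longrightarrow> set w \<subseteq> {1..<n})"
  by (simp add: free_alg_def fin_supp_def)

lemma free_alg_simps:
  "monoid.mult (free_alg n) = conc" "\<one>\<^bsub>free_alg n\<^esub> = basis []" "\<zero>\<^bsub>free_alg n\<^esub> = 0" "add (free_alg n) = (+)"
  by (simp_all add: free_alg_def)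

lemma free_alg_scale: "f \<in> carrier (free_alg n) \<Longrightarrow> scale c f \<in> carrier (free_alg n)"
  by (simp add: free_alg_carrier fin_supp_scale scale_apply)

lemma free_alg_add: "f \<in> carrier (free_alg n) \<Longrightarrow> g \<in> carrier (free_alg n) \<Longrightarrow> f + g \<in> carrier (free_alg n)"
  unfolding free_alg_carrier by (metis add.right_neutral fin_supp_add plus_fun_apply)

lemma free_alg_zero: "0 \<in> carrier (free_alg n)"
  by (simp add: free_alg_carrier fin_supp_zero zero_fun_apply)

lemma free_alg_diff: "f \<in> carrier (free_alg n) \<Longrightarrow> g \<in> carrier (free_alg n) \<Longrightarrow> f - g \<in> carrier (free_alg n)"
  using free_alg_add[of f n "scale (- 1) g"] free_alg_scale[of g n "- 1"] by simp

lemma free_alg_sum: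
  "(\<And>i. i \<in> I \<Longrightarrow> F i \<in> carrier (free_alg n)) \<Longrightarrow> (\<Sum>i\<in>I. F i) \<in> carrier (free_alg n)"
  by (induction I rule: infinite_finite_induct) (auto simp: free_alg_zero free_alg_add)

lemma free_alg_basis: "set w \<subseteq> {1..<n} \<Longrightarrow> basis w \<in> carrier (free_alg n)"
  by (auto simp: free_alg_carrier fin_supp_basis basis_apply)

lemma free_alg_conc:
  assumes "f \<in> carrier (free_alg n)" "g \<in> carrier (free_alg n)"
  shows "conc f g \<in> carrier (free_alg n)"
proof -
  have "basis (u @ v) \<in> carrier (free_alg n)" if "f u \<noteq> 0" "g v \<noteq> 0" for u v
    using assms that by (intro free_alg_basis) (auto simp: free_alg_carrier)
  then show ?thesis
    using assms unfolding free_alg_carrier[of f] free_alg_carrier[of g]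
    by (subst conc_expand) (auto intro!: free_alg_sum free_alg_scale)
qed

lemma ring_free_alg: "ring (free_alg n)"
proof (rule ringI)
  show "abelian_group (free_alg n)"
  proof (rule abelian_groupI)
    fix f assume f: "f \<in> carrier (free_alg n)"
    then have "scale (- 1) f \<in> carrier (free_alg n)" by (rule free_alg_scale)
    then show "\<exists>g\<in>carrier (free_alg n). g \<oplus>\<^bsub>free_alg n\<^esub> f = \<zero>\<^bsub>free_alg n\<^esub>"
      by (intro bexI[of _ "scale (- 1) f"]) (simp_all add: free_alg_simps)
  qed (simp_all add: free_alg_simps free_alg_add free_alg_zero ac_simps)
  show "monoid (free_alg n)"
    by (rule monoidI) (simp_all add: free_alg_simps free_alg_conc conc_assoc free_alg_basis)
qed (simp_all add: free_alg_simps conc_add_left conc_add_right)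

lemma free_rep_in_W:
  assumes "f \<in> carrier (free_alg n)" "t \<in> W n"
  shows "free_rep q x f t \<in> W n"
  unfolding free_rep_def using assms
  by (intro tensor.subspace_sum tensor.subspace_scale subspace_W hecke_op_in_W) (auto simp: free_alg_carrier)

lemma hecke_relators_subset: "hecke_relators n q \<subseteq> carrier (free_alg n)"
  unfolding hecke_relators_def
  by (auto intro!: free_alg_conc free_alg_diff free_alg_add free_alg_scale free_alg_basis)

lemma free_rep_relator:
  assumes "f \<in> hecke_relators n q" "t \<in> W n"
  shows "free_rep q x f t = 0"
  using assms(1) unfolding hecke_relators_def
proof (elim UnE CollectE exE conjE)
  note fs = fin_supp_basis fin_supp_scale fin_supp_add
  note rep = free_rep_diff free_rep_add free_rep_scale free_rep_basis hecke_op_Cons fs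
  fix i assume f: "f = conc (basis [i] - scale (q\<^sup>2) (basis [])) (basis [i] + basis [])" and i: "i \<in> {1..<n}"
  have fs': "fin_supp (basis [i] - scale (q\<^sup>2) (basis []))"
    using fin_supp_add[OF fin_supp_basis fin_supp_scale[OF fin_supp_basis, of "- (q\<^sup>2)"], of "[i]" "[]"] by simp
  show ?thesis
    unfolding f free_rep_conc[OF fs' fin_supp_add[OF fin_supp_basis fin_supp_basis]]
    by (simp add: rep hop_linear hop_quadratic[OF assms(2) i] fun_eq_iff tensor_apply algebra_simps)
next
  fix i assume "f = basis [i, i + 1, i] - basis [i + 1, i, i + 1]" "i \<in> {1..<n}" "i + 1 \<in> {1..<n}"
  then show ?thesis
    using hop_braid[OF assms(2), of i q x]
    by (simp add: free_rep_diff free_rep_basis hecke_op_Cons fin_supp_basis)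
next
  fix i j assume f: "f = basis [i, j] - basis [j, i]" "i \<in> {1..<n}" "j \<in> {1..<n}" "i + 2 \<le> j \<or> j + 2 \<le> i"
  then have "hop q x i (hop q x j t) = hop q x j (hop q x i t)"
    using hop_commute[of i j q x t] hop_commute[of j i q x t] by auto
  then show ?thesis
    unfolding f(1) by (simp add: free_rep_diff free_rep_basis hecke_op_Cons fin_supp_basis)
qed

lemma ideal_hecke: "ideal (hecke_ideal n q) (free_alg n)"
  unfolding hecke_ideal_def by (rule ring.genideal_ideal[OF ring_free_alg hecke_relators_subset])

lemma ring_hecke: "ring (hecke n q)"
  unfolding hecke_def by (rule ideal.quotient_is_ring[OF ideal_hecke])

lemma hecke_class_hom: "ring_hom_ring (free_alg n) (hecke n q) (hecke_class n q)"
proof -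
  have "hecke_class n q = (+>\<^bsub>free_alg n\<^esub>) (hecke_ideal n q)"
    by (simp add: fun_eq_iff hecke_class_def)
  then show ?thesis
    unfolding hecke_def using ideal.rcos_ring_hom_ring[OF ideal_hecke, of n q] by simp
qed

lemma hecke_carrier: "carrier (hecke n q) = hecke_class n q ` carrier (free_alg n)"
  unfolding hecke_def FactRing_simps A_RCOSETS_def' by (auto simp: hecke_class_def)

text \<open>
  The elements acting as zero form an ideal that contains the relators.
\<close>

lemma hecke_ideal_annihilates:
  assumes "f \<in> hecke_ideal n q" "t \<in> W n"
  shows "free_rep q x f t = 0"
proof -
  define K where "K = {f \<in> carrier (free_alg n). \<forall>t\<in>W n. free_rep q x f t = 0}"
  have fs: "fin_supp f" if "f \<in> carrier (free_alg n)" for f using that by (simp add: free_alg_carrier)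
  interpret ring "free_alg n" by (rule ring_free_alg)
  have minus: "\<ominus>\<^bsub>free_alg n\<^esub> f = scale (- 1) f" if "f \<in> carrier (free_alg n)" for f
    by (rule minus_equality) (use that in \<open>simp_all add: free_alg_simps free_alg_scale del: tensor.scale_minus_left\<close>, simp)
  have "ideal K (free_alg n)"
  proof (rule idealI[OF ring_free_alg])
    show "subgroup K (add_monoid (free_alg n))"
    proof (rule add.subgroupI)
      show "K \<subseteq> carrier (free_alg n)" by (auto simp: K_def)
      have "0 \<in> K" by (simp add: K_def free_alg_zero free_rep_zero)
      then show "K \<noteq> {}" by blast
      show "\<ominus>\<^bsub>free_alg n\<^esub> f \<in> K" if "f \<in> K" for f
        using that minus[of f] free_alg_scale[of f n "- 1"] free_rep_scale[of f q x "- 1"] fs[of f]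
        by (auto simp: K_def)
      show "f \<oplus>\<^bsub>free_alg n\<^esub> g \<in> K" if "f \<in> K" "g \<in> K" for f g
        using that by (auto simp: K_def free_alg_simps free_alg_add free_rep_add fs)
    qed
    show "g \<otimes>\<^bsub>free_alg n\<^esub> f \<in> K" if "f \<in> K" "g \<in> carrier (free_alg n)" for f g
      using that by (auto simp: K_def free_alg_simps free_alg_conc free_rep_conc fs lin_zero[OF lin_free_rep])
    show "f \<otimes>\<^bsub>free_alg n\<^esub> g \<in> K" if "f \<in> K" "g \<in> carrier (free_alg n)" for f g
      using that by (auto simp: K_def free_alg_simps free_alg_conc free_rep_conc fs free_rep_in_W)
  qed
  moreover have "hecke_relators n q \<subseteq> K"
    using hecke_relators_subset free_rep_relator by (auto simp: K_def)
  ultimately have "hecke_ideal n q \<subseteq> K" unfolding hecke_ideal_def by (rule genideal_minimal)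
  then show ?thesis using assms by (auto simp: K_def)
qed

lemma hecke_class_eqI:
  assumes "f \<in> carrier (free_alg n)" "g \<in> carrier (free_alg n)" "f - g \<in> hecke_ideal n q"
  shows "hecke_class n q f = hecke_class n q g"
proof -
  interpret ideal "hecke_ideal n q" "free_alg n" by (rule ideal_hecke)
  have "f \<in> hecke_ideal n q +>\<^bsub>free_alg n\<^esub> g"
    using a_rcosI[OF assms(3) a_subset assms(2)] by (simp add: free_alg_simps)
  from a_repr_independence'[OF this assms(2)] show ?thesis by (simp add: hecke_class_def)
qed

lemma hecke_class_eq_free_rep:
  assumes "f \<in> carrier (free_alg n)" "g \<in> carrier (free_alg n)"
    and "hecke_class n q f = hecke_class n q g" "t \<in> W n"
  shows "free_rep q x f t = free_rep q x g t"
proof -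
  interpret ideal "hecke_ideal n q" "free_alg n" by (rule ideal_hecke)
  have "f \<in> hecke_ideal n q +>\<^bsub>free_alg n\<^esub> g"
    using a_rcos_self[OF assms(1)] assms(3) by (simp add: hecke_class_def)
  then obtain h where h: "h \<in> hecke_ideal n q" "f = h + g"
    by (auto simp: a_r_coset_def' free_alg_simps)
  then have "h \<in> carrier (free_alg n)" using a_subset by auto
  then show ?thesis
    using h assms(2) hecke_ideal_annihilates[OF h(1) assms(4)] by (simp add: free_rep_add free_alg_carrier)
qed

lemma hecke_class_simps:
  assumes "f \<in> carrier (free_alg n)" "g \<in> carrier (free_alg n)"
  shows "hecke_class n q f \<otimes>\<^bsub>hecke n q\<^esub> hecke_class n q g = hecke_class n q (conc f g)"
    and "hecke_class n q f \<oplus>\<^bsub>hecke n q\<^esub> hecke_class n q g = hecke_class n q (f + g)"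
    and "hecke_class n q f \<ominus>\<^bsub>hecke n q\<^esub> hecke_class n q g = hecke_class n q (f - g)"
    and "hecke_class n q f \<in> carrier (hecke n q)"
    and "hecke_scale n q c (hecke_class n q f) = hecke_class n q (scale c f)"
proof -
  interpret ring_hom_ring "free_alg n" "hecke n q" "hecke_class n q" by (rule hecke_class_hom)
  have mult: "hecke_class n q f \<otimes>\<^bsub>hecke n q\<^esub> hecke_class n q g = hecke_class n q (conc f g)"
    if "f \<in> carrier (free_alg n)" "g \<in> carrier (free_alg n)" for f g
    using hom_mult[OF that] by (simp add: free_alg_simps)
  then show "hecke_class n q f \<otimes>\<^bsub>hecke n q\<^esub> hecke_class n q g = hecke_class n q (conc f g)"
    using assms by blast
  show add: "hecke_class n q f \<oplus>\<^bsub>hecke n q\<^esub> hecke_class n q g = hecke_class n q (f + g)"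
    using hom_add[OF assms] by (simp add: free_alg_simps)
  show "hecke_class n q f \<in> carrier (hecke n q)" using hom_closed assms by blast
  have d: "f - g \<in> carrier (free_alg n)" using assms by (rule free_alg_diff)
  have "hecke_class n q f = hecke_class n q (f - g) \<oplus>\<^bsub>hecke n q\<^esub> hecke_class n q g"
    using hom_add[OF d assms(2)] by (simp add: free_alg_simps)
  then show "hecke_class n q f \<ominus>\<^bsub>hecke n q\<^esub> hecke_class n q g = hecke_class n q (f - g)"
    using hom_closed[OF d] hom_closed[OF assms(2)] by (simp add: S.minus_eq S.a_assoc S.r_neg)
  show "hecke_scale n q c (hecke_class n q f) = hecke_class n q (scale c f)"
    unfolding hecke_scale_def
    by (subst mult) (simp_all add: assms free_alg_scale free_alg_basis conc_scale_left)
qed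

lemma hecke_one: "\<one>\<^bsub>hecke n q\<^esub> = hecke_class n q (basis [])"
proof -
  interpret ring_hom_ring "free_alg n" "hecke n q" "hecke_class n q" by (rule hecke_class_hom)
  show ?thesis using hom_one by (simp add: free_alg_simps)
qed

lemma hecke_relator_in_ideal: "f \<in> hecke_relators n q \<Longrightarrow> f \<in> hecke_ideal n q"
  unfolding hecke_ideal_def using ring.genideal_self[OF ring_free_alg hecke_relators_subset] by blast

lemma hecke_gen_inverse:
  assumes "i \<in> {1..<n}" "q \<noteq> 0"
  shows "inv\<^bsub>hecke n q\<^esub> hecke_gen n q i =
    hecke_class n q (scale (inverse (q\<^sup>2)) (basis [i] - scale (q\<^sup>2 - 1) (basis [])))"
proof -
  let ?b = "basis [i]" and ?k = "basis [i] - scale (q\<^sup>2 - 1) (basis [])"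
  have b: "?b \<in> carrier (free_alg n)" using assms by (intro free_alg_basis) auto
  have e: "basis [] \<in> carrier (free_alg n)" by (rule free_alg_basis) simp
  have k: "scale (inverse (q\<^sup>2)) ?k \<in> carrier (free_alg n)"
    by (intro free_alg_scale free_alg_diff b e)
  interpret ideal "hecke_ideal n q" "free_alg n" by (rule ideal_hecke)
  interpret H: ring "hecke n q" by (rule ring_hecke)
  let ?r = "conc (basis [i] - scale (q\<^sup>2) (basis [])) (basis [i] + basis [])"
  have "?r \<in> hecke_ideal n q"
    using assms(1) by (intro hecke_relator_in_ideal) (auto simp: hecke_relators_def)
  then have "conc (scale (inverse (q\<^sup>2)) (basis [])) ?r \<in> hecke_ideal n q"
    using I_l_closed[of ?r "scale (inverse (q\<^sup>2)) (basis [])"] free_alg_scale[OF e]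
    by (simp add: free_alg_simps)
  moreover have "conc (scale (inverse (q\<^sup>2)) (basis [])) ?r = scale (inverse (q\<^sup>2)) ?r"
    by (simp add: conc_scale_left)
  moreover have cd: "conc (f - g) h = conc f h - conc g h" "conc h (f - g) = conc h f - conc h g" for f g h
    using conc_add_left[of "f - g" g h] conc_add_right[of h "f - g" g] by simp_all
  have "conc ?b (scale (inverse (q\<^sup>2)) ?k) - basis [] = scale (inverse (q\<^sup>2)) ?r"
    "conc (scale (inverse (q\<^sup>2)) ?k) ?b - basis [] = scale (inverse (q\<^sup>2)) ?r"
    using assms(2)
    by (simp_all add: cd conc_add_left conc_add_right conc_scale_left conc_scale_right conc_basis
        fun_eq_iff tensor_apply field_simps)
  ultimately have "hecke_class n q (conc ?b (scale (inverse (q\<^sup>2)) ?k)) = \<one>\<^bsub>hecke n q\<^esub>"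
    "hecke_class n q (conc (scale (inverse (q\<^sup>2)) ?k) ?b) = \<one>\<^bsub>hecke n q\<^esub>"
    unfolding hecke_one by (intro hecke_class_eqI free_alg_conc b k e; simp)+
  then show ?thesis
    unfolding hecke_gen_def using hecke_class_simps(1,4) b k
    by (intro H.inv_unique'[symmetric]) auto
qed

text \<open>
  The representation exists because the ideal of relations acts as zero. It is unique because its
  values on the generators are prescribed by the case \<open>u = 1\<close>, \<open>v = 0\<close>.
\<close>

lemma hecke_rep_class:
  assumes "q \<noteq> 0" "q\<^sup>2 + 1 \<noteq> 0" "f \<in> carrier (free_alg n)"
  shows "hecke_rep n q x (hecke_class n q f) = restrict (free_rep q x f) (W n)"
proof -
  let ?C = "carrier (free_alg n)" and ?cls = "hecke_class n q"
  define P where "P \<pi> \<longleftrightarrow>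
     \<pi> \<in> extensional (carrier (hecke n q)) \<and>
     \<pi> \<in> ring_hom (hecke n q) (endo_ring (W n)) \<and>
     (\<forall>c. \<forall>h\<in>carrier (hecke n q). \<forall>t\<in>W n. \<pi> (hecke_scale n q c h) t = scale c (\<pi> h t)) \<and>
     (\<forall>i\<in>{1..<n}. \<forall>u v. R_adj n q i u v x =
        \<pi> (hecke_scale n q u (hecke_gen n q i) \<ominus>\<^bsub>hecke n q\<^esub>
             hecke_scale n q (v * q\<^sup>2) (inv\<^bsub>hecke n q\<^esub> (hecke_gen n q i))))" for \<pi>
  define \<pi> where "\<pi> = (\<lambda>X\<in>carrier (hecke n q). restrict (free_rep q x (SOME f. f \<in> ?C \<and> X = ?cls f)) (W n))"
  have fs: "fin_supp f" if "f \<in> ?C" for f using that by (simp add: free_alg_carrier)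
  have e: "basis [] \<in> ?C" by (rule free_alg_basis) simp
  have gen: "basis [i] \<in> ?C" if "i \<in> {1..<n}" for i using that by (intro free_alg_basis) auto
  have gen_expr: "hecke_scale n q u (hecke_gen n q i) \<ominus>\<^bsub>hecke n q\<^esub>
      hecke_scale n q (v * q\<^sup>2) (inv\<^bsub>hecke n q\<^esub> (hecke_gen n q i)) =
      ?cls (scale (u - v) (basis [i]) + scale (v * (q\<^sup>2 - 1)) (basis []))"
    if i: "i \<in> {1..<n}" for i u v
  proof -
    let ?k = "scale (inverse (q\<^sup>2)) (basis [i] - scale (q\<^sup>2 - 1) (basis []))"
    have k: "?k \<in> ?C" by (intro free_alg_scale free_alg_diff gen[OF i] e)
    have "scale u (basis [i]) - scale (v * q\<^sup>2) ?k =
        scale (u - v) (basis [i]) + scale (v * (q\<^sup>2 - 1)) (basis [])"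
      using assms(1) by (simp add: fun_eq_iff tensor_apply field_simps)
    moreover have "hecke_scale n q u (hecke_gen n q i) = ?cls (scale u (basis [i]))"
      unfolding hecke_gen_def using hecke_class_simps(5)[OF gen[OF i] e] by simp
    moreover have "hecke_scale n q (v * q\<^sup>2) (inv\<^bsub>hecke n q\<^esub> (hecke_gen n q i)) = ?cls (scale (v * q\<^sup>2) ?k)"
      unfolding hecke_gen_inverse[OF i assms(1)] by (rule hecke_class_simps(5)[OF k e])
    ultimately show ?thesis
      using hecke_class_simps(3)[OF free_alg_scale[OF gen[OF i]] free_alg_scale[OF k]] by simp
  qed
  have \<pi>_class: "\<pi> (?cls f) = restrict (free_rep q x f) (W n)" if f: "f \<in> ?C" for f
  proof -
    define g where "g = (SOME g. g \<in> ?C \<and> ?cls f = ?cls g)"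
    have "g \<in> ?C \<and> ?cls f = ?cls g" unfolding g_def by (rule someI[of _ f]) (use f in simp)
    then have "restrict (free_rep q x g) (W n) = restrict (free_rep q x f) (W n)"
      using hecke_class_eq_free_rep[of g n f q] f by (intro restrict_ext) auto
    moreover have "\<pi> (?cls f) = restrict (free_rep q x g) (W n)"
      using hecke_class_simps(4)[OF f f] by (simp add: \<pi>_def g_def)
    ultimately show ?thesis by simp
  qed
  have "\<pi> \<in> ring_hom (hecke n q) (endo_ring (W n))"
  proof (rule ring_hom_memI)
    fix X assume "X \<in> carrier (hecke n q)"
    then obtain f where f: "f \<in> ?C" "X = ?cls f" by (auto simp: hecke_carrier)
    show "\<pi> X \<in> carrier (endo_ring (W n))"
      unfolding f(2) \<pi>_class[OF f(1)] endo_ring_def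
      by (simp add: restrict_in_endos subspace_W lin_free_rep free_rep_in_W[OF f(1)])
    fix Y assume "Y \<in> carrier (hecke n q)"
    then obtain g where g: "g \<in> ?C" "Y = ?cls g" by (auto simp: hecke_carrier)
    show "\<pi> (X \<otimes>\<^bsub>hecke n q\<^esub> Y) = \<pi> X \<otimes>\<^bsub>endo_ring (W n)\<^esub> \<pi> Y"
      unfolding f(2) g(2) hecke_class_simps(1)[OF f(1) g(1)] \<pi>_class[OF f(1)] \<pi>_class[OF g(1)]
        \<pi>_class[OF free_alg_conc[OF f(1) g(1)]] endo_ring_def monoid.simps
      by (subst compose_restrict)
        (auto simp: free_rep_in_W[OF g(1)] free_rep_conc[OF fs[OF f(1)] fs[OF g(1)]] intro!: restrict_ext)
    show "\<pi> (X \<oplus>\<^bsub>hecke n q\<^esub> Y) = \<pi> X \<oplus>\<^bsub>endo_ring (W n)\<^esub> \<pi> Y"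
      unfolding f(2) g(2) hecke_class_simps(2)[OF f(1) g(1)] \<pi>_class[OF f(1)] \<pi>_class[OF g(1)]
        \<pi>_class[OF free_alg_add[OF f(1) g(1)]] endo_ring_def ring.simps
      by (rule restrict_ext) (simp add: free_rep_add[OF fs[OF f(1)] fs[OF g(1)]])
  next
    show "\<pi> \<one>\<^bsub>hecke n q\<^esub> = \<one>\<^bsub>endo_ring (W n)\<^esub>"
      unfolding hecke_one \<pi>_class[OF e] endo_ring_def monoid.simps ident_def
      by (rule restrict_ext) (simp add: free_rep_basis)
  qed
  moreover have "\<pi> (hecke_scale n q c h) t = scale c (\<pi> h t)"
    if h: "h \<in> carrier (hecke n q)" and t: "t \<in> W n" for c h t
  proof -
    obtain f where f: "f \<in> ?C" "h = ?cls f" using h by (auto simp: hecke_carrier)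
    show ?thesis
      unfolding f(2) hecke_class_simps(5)[OF f(1) f(1)] \<pi>_class[OF f(1)] \<pi>_class[OF free_alg_scale[OF f(1)]]
      using t by (simp add: free_rep_scale[OF fs[OF f(1)]])
  qed
  moreover have "R_adj n q i u v x =
        \<pi> (hecke_scale n q u (hecke_gen n q i) \<ominus>\<^bsub>hecke n q\<^esub>
             hecke_scale n q (v * q\<^sup>2) (inv\<^bsub>hecke n q\<^esub> (hecke_gen n q i)))"
    if i: "i \<in> {1..<n}" for i u v
    unfolding gen_expr[OF i] \<pi>_class[OF free_alg_add[OF free_alg_scale[OF gen[OF i]] free_alg_scale[OF e]]]
      R_adj_eq[OF assms(1,2) i]
    by (rule restrict_ext)
      (simp add: strand_op_def R_coeffs_def free_rep_add free_rep_scale free_rep_basis fin_supp_scale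
        fin_supp_basis hecke_op_Cons)
  ultimately have P: "P \<pi>" by (simp add: P_def) (simp add: \<pi>_def)
  have unique: "\<rho> (?cls f) = restrict (free_rep q x f) (W n)" if "P \<rho>" "f \<in> ?C" for \<rho> f
  proof -
    have hom: "\<rho> \<in> ring_hom (hecke n q) (endo_ring (W n))"
      and scl: "\<And>c h t. h \<in> carrier (hecke n q) \<Longrightarrow> t \<in> W n \<Longrightarrow> \<rho> (hecke_scale n q c h) t = scale c (\<rho> h t)"
      and R: "\<And>i u v. i \<in> {1..<n} \<Longrightarrow> R_adj n q i u v x =
        \<rho> (hecke_scale n q u (hecke_gen n q i) \<ominus>\<^bsub>hecke n q\<^esub>
             hecke_scale n q (v * q\<^sup>2) (inv\<^bsub>hecke n q\<^esub> (hecke_gen n q i)))"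
      using that(1) unfolding P_def by blast+
    have cl: "?cls f \<in> carrier (hecke n q)" if "f \<in> ?C" for f using hecke_class_simps(4)[OF that that] .
    have word: "\<rho> (?cls (basis w)) t = hecke_op q x (rev w) t" if "set w \<subseteq> {1..<n}" "t \<in> W n" for w t
      using that
    proof (induction w)
      case Nil
      have "\<rho> (?cls (basis [])) = ident (W n)"
        using ring_hom_one[OF hom] unfolding hecke_one by (simp add: endo_ring_def)
      then show ?case using Nil by (simp add: ident_def)
    next
      case (Cons i w)
      have i: "i \<in> {1..<n}" using Cons.prems by simp
      have w: "basis w \<in> ?C" by (rule free_alg_basis) (use Cons.prems in simp)
      have "\<rho> (?cls (basis [i])) = restrict (hop q x i) (W n)"
      proof -
        have "strand_op q x (R_coeffs q) 1 0 i = hop q x i"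
          by (simp add: fun_eq_iff strand_op_def R_coeffs_def)
        then show ?thesis using R[OF i, of 1 0] unfolding gen_expr[OF i] R_adj_eq[OF assms(1,2) i] by simp
      qed
      moreover have "?cls (basis (i # w)) = ?cls (basis [i]) \<otimes>\<^bsub>hecke n q\<^esub> ?cls (basis w)"
        unfolding hecke_class_simps(1)[OF gen[OF i] w] conc_basis by simp
      ultimately have "\<rho> (?cls (basis (i # w))) = compose (W n) (restrict (hop q x i) (W n)) (\<rho> (?cls (basis w)))"
        using ring_hom_mult[OF hom cl[OF gen[OF i]] cl[OF w]] by (simp add: endo_ring_def)
      then show ?case
        using Cons hecke_op_in_W[of t n "rev w" q x] by (simp add: compose_def hecke_op_append hecke_op_Cons)
    qed
    have "\<rho> (?cls f) t = free_rep q x f t" if f: "f \<in> ?C" "finite S" "{w. f w \<noteq> 0} \<subseteq> S" and t: "t \<in> W n" for f S t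
      using f(2,1,3)
    proof (induction S arbitrary: f rule: finite_induct)
      case empty
      then have "f = scale 0 (basis [])" by (auto simp: fun_eq_iff tensor_apply)
      then show ?case
        using scl[OF cl[OF e] t, of 0] hecke_class_simps(5)[OF e e, of q 0] by (simp add: free_rep_zero)
    next
      case (insert w S)
      define g where "g = f - scale (f w) (basis w)"
      show ?case
      proof (cases "f w = 0")
        case True
        then show ?thesis using insert by (intro insert.IH) auto
      next
        case False
        then have w: "basis w \<in> ?C" using insert.prems(1) by (intro free_alg_basis) (auto simp: free_alg_carrier)
        have g: "g \<in> ?C" unfolding g_def by (intro free_alg_diff free_alg_scale w insert.prems)
        have sw: "scale (f w) (basis w) \<in> ?C" using w by (rule free_alg_scale)
        have "{v. g v \<noteq> 0} \<subseteq> S" using insert.prems(2) by (auto simp: g_def tensor_apply basis_apply split: if_splits)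
        then have IH: "\<rho> (?cls g) t = free_rep q x g t" using insert.IH g by blast
        have f: "f = g + scale (f w) (basis w)" by (simp add: g_def)
        have "set w \<subseteq> {1..<n}" using False insert.prems(1) by (auto simp: free_alg_carrier)
        then have "\<rho> (?cls (scale (f w) (basis w))) t = free_rep q x (scale (f w) (basis w)) t"
          using scl[OF cl[OF w] t, of "f w"] hecke_class_simps(5)[OF w w, of q "f w"] word[OF _ t]
          by (simp add: free_rep_scale fin_supp_basis free_rep_basis)
        moreover have "\<rho> (?cls (g + scale (f w) (basis w))) t = \<rho> (?cls g) t + \<rho> (?cls (scale (f w) (basis w))) t"
          using ring_hom_add[OF hom cl[OF g] cl[OF sw]] hecke_class_simps(2)[OF g sw] t
          by (simp add: endo_ring_def)
        moreover have "free_rep q x (g + scale (f w) (basis w)) t =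
            free_rep q x g t + free_rep q x (scale (f w) (basis w)) t"
          using fs[OF g] fs[OF sw] by (rule free_rep_add)
        ultimately show ?thesis using IH f by metis
      qed
    qed
    then have eq: "\<rho> (?cls f) t = free_rep q x f t" if "t \<in> W n" for t
      using that fs[OF \<open>f \<in> ?C\<close>] \<open>f \<in> ?C\<close> by (auto simp: fin_supp_def)
    have "\<rho> (?cls f) \<in> extensional (W n)"
      using ring_hom_closed[OF hom cl[OF \<open>f \<in> ?C\<close>]] by (simp add: endo_ring_def endos_def PiE_def)
    then show ?thesis using eq by (auto simp: extensional_def restrict_def fun_eq_iff)
  qed
  have "\<rho> = \<pi>" if "P \<rho>" for \<rho>
  proof
    fix X show "\<rho> X = \<pi> X"
    proof (cases "X \<in> carrier (hecke n q)")
      case True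
      then obtain f where "f \<in> ?C" "X = ?cls f" by (auto simp: hecke_carrier)
      then show ?thesis using unique[OF that] unique[OF P] by simp
    next
      case False
      moreover have "\<rho> \<in> extensional (carrier (hecke n q))" "\<pi> \<in> extensional (carrier (hecke n q))"
        using that P unfolding P_def by blast+
      ultimately show ?thesis by (simp add: extensional_def)
    qed
  qed
  with P have "hecke_rep n q x = \<pi>"
    unfolding hecke_rep_def P_def[symmetric] by (rule the_equality)
  then show ?thesis using \<pi>_class[OF assms(3)] by simp
qed

text \<open>
  Left multiplication by the generators satisfies the braid and commutation relations in the Hecke
  algebra, so Matsumoto's theorem applies with the algebra as set of states and with labels that play
  no role.
\<close>

lemma hecke_basis_eq:
  assumes "reduced_word n is \<sigma>"
  shows "hecke_basis n q \<sigma> = hecke_class n q (basis (rev is))"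
proof -
  let ?cls = "hecke_class n q" and ?C = "carrier (free_alg n)"
  define step where "step = (\<lambda>(_::nat) (_::nat) i y. hecke_gen n q i \<otimes>\<^bsub>hecke n q\<^esub> y)"
  interpret H: ring "hecke n q" by (rule ring_hecke)
  have gen: "basis [i] \<in> ?C" if "i \<in> {1..<n}" for i using that by (intro free_alg_basis) auto
  have genH: "hecke_gen n q i \<in> carrier (hecke n q)" if "i \<in> {1..<n}" for i
    unfolding hecke_gen_def using hecke_class_simps(4)[OF gen[OF that] gen[OF that]] .
  have word_mult: "?cls (basis v) \<otimes>\<^bsub>hecke n q\<^esub> ?cls (basis w) = ?cls (basis (v @ w))"
    if "set v \<subseteq> {1..<n}" "set w \<subseteq> {1..<n}" for v w
    using hecke_class_simps(1)[OF free_alg_basis[OF that(1)] free_alg_basis[OF that(2)], of q]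
    by (simp add: conc_basis)
  interpret word_action n "carrier (hecke n q)" step
  proof
    fix i j y a b c d assume i: "i \<in> {1..<n}" and y: "y \<in> carrier (hecke n q)"
    show "step a b i y \<in> carrier (hecke n q)" using genH[OF i] y by (simp add: step_def)
    show "step b c i (step a c (i + 1) (step a b i y)) = step a b (i + 1) (step a c i (step b c (i + 1) y))"
      if i': "i + 1 \<in> {1..<n}"
    proof -
      have "basis [i, i + 1, i] - basis [i + 1, i, i + 1] \<in> hecke_relators n q"
        using i i' unfolding hecke_relators_def by blast
      then have "?cls (basis [i, i + 1, i]) = ?cls (basis [i + 1, i, i + 1])"
        using i i' by (intro hecke_class_eqI free_alg_basis hecke_relator_in_ideal) auto
      then have "hecke_gen n q i \<otimes>\<^bsub>hecke n q\<^esub> (hecke_gen n q (i + 1) \<otimes>\<^bsub>hecke n q\<^esub> hecke_gen n q i) =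
          hecke_gen n q (i + 1) \<otimes>\<^bsub>hecke n q\<^esub> (hecke_gen n q i \<otimes>\<^bsub>hecke n q\<^esub> hecke_gen n q (i + 1))"
        using i i' by (simp add: hecke_gen_def word_mult)
      then show ?thesis
        using genH[OF i] genH[OF i'] y unfolding step_def by (simp add: H.m_assoc[symmetric])
    qed
    show "step a b i (step c d j y) = step c d j (step a b i y)" if j: "j \<in> {1..<n}" and "i + 2 \<le> j"
    proof -
      have "basis [i, j] - basis [j, i] \<in> hecke_relators n q"
        using i that unfolding hecke_relators_def by blast
      then have "?cls (basis [i, j]) = ?cls (basis [j, i])"
        using i j by (intro hecke_class_eqI free_alg_basis hecke_relator_in_ideal) auto
      then have "hecke_gen n q i \<otimes>\<^bsub>hecke n q\<^esub> hecke_gen n q j = hecke_gen n q j \<otimes>\<^bsub>hecke n q\<^esub> hecke_gen n q i"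
        using i j by (simp add: hecke_gen_def word_mult)
      then show ?thesis
        using genH[OF i] genH[OF j] y unfolding step_def by (simp add: H.m_assoc[symmetric])
    qed
  qed
  have run: "run step a js (?cls (basis w)) = ?cls (basis (rev js @ w))"
    if "set js \<subseteq> {1..<n}" "set w \<subseteq> {1..<n}" for js w a
    using that
  proof (induction js arbitrary: w a)
    case (Cons i js)
    then have "step (a i) (a (i + 1)) i (?cls (basis w)) = ?cls (basis (i # w))"
      using word_mult[of "[i]" w] by (simp add: step_def hecke_gen_def)
    then show ?case using Cons.IH[of "i # w" "a \<circ> adj i"] Cons.prems unfolding run.simps by simp
  qed simp
  have red: "?cls (basis (rev js)) = ?cls (basis (rev ks))"
    if "reduced_word n js \<rho>" "reduced_word n ks \<rho>" for js ks \<rho>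
    using run_reduced_unique[OF that hecke_class_simps(4)[OF free_alg_basis free_alg_basis, of "[]" n "[]" q],
        of "\<lambda>_. 0"]
      run[of js "[]" "\<lambda>_. 0"] run[of ks "[]" "\<lambda>_. 0"] that by (simp add: reduced_word_def)
  have nil: "reduced_word n [] id" by (simp add: reduced_word_def inv_count_id)
  have single: "reduced_word n [i] (adj i)" if "i \<in> {1..<n}" for i
    using nil that adj_permutes[of i n] by (simp add: reduced_word_Cons adj_comp_adj)
  have word: "\<exists>js. reduced_word n js \<rho> \<and> h = ?cls (basis (rev js))" if "hecke_basis_rel n q \<rho> h" for \<rho> h
    using that
  proof (induction rule: hecke_basis_rel.induct)
    case one
    then show ?case using nil by (intro exI[of _ "[]"]) (simp add: hecke_one)
  next
    case (adj i)
    then show ?case using single by (intro exI[of _ "[i]"]) (simp add: hecke_gen_def)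
  next
    case (mult \<sigma>' h' \<sigma> h)
    then obtain ks js where ks: "reduced_word n ks \<sigma>'" "h' = ?cls (basis (rev ks))"
      and js: "reduced_word n js \<sigma>" "h = ?cls (basis (rev js))" by blast
    have p: "\<sigma> permutes {1..n}" "\<sigma>' permutes {1..n}" using js ks reduced_word_permutes by blast+
    have "reduced_word n (js @ ks) (\<sigma>' \<circ> \<sigma>)"
      using mult.hyps(3) perm_length_eq_inv_count[OF p(1)] perm_length_eq_inv_count[OF p(2)]
        perm_length_eq_inv_count[OF permutes_compose[OF p]]
      by (intro reduced_word_appendI js ks) simp
    moreover have "h' \<otimes>\<^bsub>hecke n q\<^esub> h = ?cls (basis (rev (js @ ks)))"
      unfolding ks(2) js(2) using ks(1) js(1) by (subst word_mult) (auto simp: reduced_word_def)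
    ultimately show ?case by blast
  qed
  have build: "hecke_basis_rel n q \<rho> (?cls (basis (rev js)))" if "reduced_word n js \<rho>" for js \<rho>
    using that
  proof (induction js arbitrary: \<rho>)
    case Nil
    then have "\<rho> = id" by (simp add: reduced_word_def)
    then show ?case using hecke_basis_rel.one[of n q] by (simp add: hecke_one)
  next
    case (Cons i js)
    then have i: "i \<in> {1..<n}" "reduced_word n js (\<rho> \<circ> adj i)" "\<rho> permutes {1..n}"
      by (simp_all add: reduced_word_Cons)
    have len: "length (i # js) = inv_count \<rho>" "length js = inv_count (\<rho> \<circ> adj i)"
      using Cons.prems i(2) by (simp_all add: reduced_word_def)
    have "hecke_basis_rel n q (\<rho> \<circ> adj i \<circ> adj i) (?cls (basis (rev js)) \<otimes>\<^bsub>hecke n q\<^esub> hecke_gen n q i)"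
    proof (rule hecke_basis_rel.mult)
      show "hecke_basis_rel n q (adj i) (hecke_gen n q i)" by (rule hecke_basis_rel.adj[OF i(1)])
      show "hecke_basis_rel n q (\<rho> \<circ> adj i) (?cls (basis (rev js)))" by (rule Cons.IH[OF i(2)])
      have "inv_count (adj i) = 1"
        using inv_count_up[OF permutes_id, of i] by (simp add: inv_count_id id_apply)
      then show "perm_length n (\<rho> \<circ> adj i \<circ> adj i) = perm_length n (\<rho> \<circ> adj i) + perm_length n (adj i)"
        using len i(1,3) permutes_compose[OF adj_permutes[OF i(1)] i(3)] adj_permutes[OF i(1)]
        by (simp add: comp_adj_adj perm_length_eq_inv_count)
    qed
    moreover have "?cls (basis (rev js)) \<otimes>\<^bsub>hecke n q\<^esub> hecke_gen n q i = ?cls (basis (rev (i # js)))"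
      unfolding hecke_gen_def using i by (subst word_mult) (auto simp: reduced_word_def)
    ultimately show ?case by (simp only: comp_adj_adj)
  qed
  show ?thesis unfolding hecke_basis_def
  proof (rule the_equality)
    show "hecke_basis_rel n q \<sigma> (?cls (basis (rev is)))" by (rule build[OF assms])
    fix h assume "hecke_basis_rel n q \<sigma> h"
    then show "h = ?cls (basis (rev is))" using word red[OF _ assms] by blast
  qed
qed

text \<open>
  The number whose power \<open>\<ell>(\<sigma>)\<close> is the coefficient of \<open>h(\<sigma>)\<close> in \<open>e\<^sub>\<plusminus>\<close>.
\<close>

definition sign_weight :: "sign \<Rightarrow> complex \<Rightarrow> complex" where
  "sign_weight s q = (case s of Plus \<Rightarrow> 1 | Minus \<Rightarrow> - inverse (q\<^sup>2))"

lemma fused_space_eq: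
  assumes "q \<noteq> 0" "q\<^sup>2 + 1 \<noteq> 0"
  shows "fused_space s n q x = symmetriser (sign_weight s q) q x n ` W n"
proof -
  let ?cls = "hecke_class n q" and ?C = "carrier (free_alg n)" and ?S = "{\<sigma>. \<sigma> permutes {1..n}}"
  define F where "F \<sigma> = scale (sign_weight s q ^ inv_count \<sigma>) (basis (rev (some_word n \<sigma>)))" for \<sigma>
  have FC: "F \<sigma> \<in> ?C" if "\<sigma> \<in> ?S" for \<sigma>
    unfolding F_def using reduced_some_word[of \<sigma> n] that
    by (intro free_alg_scale free_alg_basis) (auto simp: reduced_word_def)
  interpret H: ring "hecke n q" by (rule ring_hecke)
  have zero: "\<zero>\<^bsub>hecke n q\<^esub> = ?cls 0"
  proof -
    interpret ring_hom_ring "free_alg n" "hecke n q" "?cls" by (rule hecke_class_hom)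
    show ?thesis using hom_zero by (simp add: free_alg_simps)
  qed
  have sum: "(\<Oplus>\<^bsub>hecke n q\<^esub>\<sigma>\<in>A. ?cls (F \<sigma>)) = ?cls (\<Sum>\<sigma>\<in>A. F \<sigma>)" if "finite A" "A \<subseteq> ?S" for A
    using that
  proof (induction A rule: finite_induct)
    case empty
    then show ?case by (simp add: zero)
  next
    case (insert \<sigma> A)
    have c: "?cls (F \<rho>) \<in> carrier (hecke n q)" if "\<rho> \<in> ?S" for \<rho>
      using hecke_class_simps(4)[OF FC[OF that] FC[OF that]] .
    have sC: "(\<Sum>\<sigma>\<in>A. F \<sigma>) \<in> ?C" using insert.prems FC by (intro free_alg_sum) auto
    have "(\<Oplus>\<^bsub>hecke n q\<^esub>\<sigma>\<in>insert \<sigma> A. ?cls (F \<sigma>)) =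
        ?cls (F \<sigma>) \<oplus>\<^bsub>hecke n q\<^esub> (\<Oplus>\<^bsub>hecke n q\<^esub>\<sigma>\<in>A. ?cls (F \<sigma>))"
      using insert c by (intro H.finsum_insert) auto
    then show ?case using insert hecke_class_simps(2)[OF FC sC] by simp
  qed
  have summand: "hecke_scale n q (case s of Plus \<Rightarrow> 1 | Minus \<Rightarrow> (- inverse (q\<^sup>2)) ^ perm_length n \<sigma>)
      (hecke_basis n q \<sigma>) = ?cls (F \<sigma>)" if "\<sigma> \<in> ?S" for \<sigma>
  proof -
    have \<sigma>: "\<sigma> permutes {1..n}" using that by simp
    have b: "basis (rev (some_word n \<sigma>)) \<in> ?C"
      using reduced_some_word[OF \<sigma>] by (intro free_alg_basis) (auto simp: reduced_word_def)
    have "(case s of Plus \<Rightarrow> 1 | Minus \<Rightarrow> (- inverse (q\<^sup>2)) ^ perm_length n \<sigma>) = sign_weight s q ^ inv_count \<sigma>"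
      by (cases s) (simp_all add: sign_weight_def perm_length_eq_inv_count[OF \<sigma>])
    then show ?thesis
      unfolding hecke_basis_eq[OF reduced_some_word[OF \<sigma>]] F_def using hecke_class_simps(5)[OF b b] by simp
  qed
  have cF: "?cls (F \<sigma>) \<in> carrier (hecke n q)" if "\<sigma> \<in> ?S" for \<sigma>
    using hecke_class_simps(4)[OF FC[OF that] FC[OF that]] .
  have e: "hecke_e s n q = ?cls (\<Sum>\<sigma>\<in>?S. F \<sigma>)"
  proof -
    have "hecke_e s n q = (\<Oplus>\<^bsub>hecke n q\<^esub>\<sigma>\<in>?S. ?cls (F \<sigma>))"
      unfolding hecke_e_def by (rule H.finsum_cong') (use summand cF in auto)
    then show ?thesis using sum[of ?S] by (simp add: finite_permutations)
  qed
  have "free_rep q x (\<Sum>\<sigma>\<in>?S. F \<sigma>) t = symmetriser (sign_weight s q) q x n t" for t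
    unfolding symmetriser_def F_def
    by (simp add: free_rep_sum free_rep_scale free_rep_basis fin_supp_scale fin_supp_basis)
  moreover have "hecke_rep n q x (?cls (\<Sum>\<sigma>\<in>?S. F \<sigma>)) = restrict (free_rep q x (\<Sum>\<sigma>\<in>?S. F \<sigma>)) (W n)"
    using FC by (intro hecke_rep_class[OF assms] free_alg_sum) auto
  ultimately show ?thesis unfolding fused_space_def e by auto
qed

section \<open>The fused spaces as common eigenspaces\<close>

text \<open>
  The eigenvalue of every \<open>h_i\<close> on \<open>V\<^sub>\<plusminus>\<close>.
\<close>

definition sign_eigenvalue :: "sign \<Rightarrow> complex \<Rightarrow> complex" where
  "sign_eigenvalue s q = (case s of Plus \<Rightarrow> q\<^sup>2 | Minus \<Rightarrow> - 1)"

text \<open>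
  The tensors in \<^term>\<open>W m\<close> on which the \<open>h_i\<close> with \<open>i\<close> in \<open>I\<close> act as multiplication by \<open>l\<close>.
\<close>

definition eigenspace :: "complex \<Rightarrow> complex \<Rightarrow> complex \<Rightarrow> nat \<Rightarrow> nat set \<Rightarrow> tensor set" where
  "eigenspace l q x m I = {t \<in> W m. \<forall>i\<in>I. hop q x i t = scale l t}"

lemma subspace_eigenspace: "tensor.subspace (eigenspace l q x m I)"
proof (rule tensor.subspaceI)
  show "0 \<in> eigenspace l q x m I"
    by (simp add: eigenspace_def lin_zero[OF lin_hop] tensor.subspace_0[OF subspace_W])
  show "s + t \<in> eigenspace l q x m I" if "s \<in> eigenspace l q x m I" "t \<in> eigenspace l q x m I" for s t
    using that tensor.subspace_add[OF subspace_W]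
    by (simp add: eigenspace_def hop_linear tensor.scale_right_distrib)
  show "scale c t \<in> eigenspace l q x m I" if "t \<in> eigenspace l q x m I" for c t
    using that tensor.subspace_scale[OF subspace_W]
    by (simp add: eigenspace_def hop_linear mult.commute)
qed

lemma not_root_of_unity_square:
  fixes q :: complex
  assumes "\<forall>r::nat. r > 0 \<longrightarrow> q ^ r \<noteq> 1"
  shows "q\<^sup>2 + 1 \<noteq> 0" "q\<^sup>2 - 1 \<noteq> 0"
proof -
  show "q\<^sup>2 - 1 \<noteq> 0" using assms[rule_format, of 2] by simp
  show "q\<^sup>2 + 1 \<noteq> 0"
  proof
    assume "q\<^sup>2 + 1 = 0"
    then have "q\<^sup>2 = - 1" by (simp add: eq_neg_iff_add_eq_0)
    then have "q ^ 4 = 1" using power_mult[of q 2 2] by simp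
    then show False using assms[rule_format, of 4] by simp
  qed
qed

text \<open>
  The scalar by which \<open>e\<^sub>\<plusminus>\<close> acts on \<open>V\<^sub>\<plusminus>\<close>: the Poincare polynomial of the symmetric group at \<open>q\<^sup>2\<close> or
  \<open>q\<^sup>-\<^sup>2\<close>.
\<close>

definition sign_norm :: "sign \<Rightarrow> complex \<Rightarrow> nat \<Rightarrow> complex" where
  "sign_norm s q n = (\<Sum>\<sigma> | \<sigma> permutes {1..n}. (sign_weight s q * sign_eigenvalue s q) ^ inv_count \<sigma>)"

lemma sign_norm_nonzero:
  assumes "\<forall>r::nat. r > 0 \<longrightarrow> q ^ r \<noteq> 1"
  shows "sign_norm s q n \<noteq> 0"
  unfolding sign_norm_def
proof (rule sum_inv_count_nonzero)
  fix r :: nat assume "r > 0"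
  then have "(q\<^sup>2) ^ r \<noteq> 1" using assms[rule_format, of "2 * r"] by (simp add: power_mult)
  then show "(sign_weight s q * sign_eigenvalue s q) ^ r \<noteq> 1"
    by (cases s) (simp_all add: sign_weight_def sign_eigenvalue_def power_inverse)
qed

lemma fused_space_eigenspace:
  assumes "q \<noteq> 0" "\<forall>r::nat. r > 0 \<longrightarrow> q ^ r \<noteq> 1"
  shows "fused_space s n q x = eigenspace (sign_eigenvalue s q) q x n {1..<n}"
proof -
  let ?c = "sign_weight s q" and ?l = "sign_eigenvalue s q"
  have c: "(?c - 1) * (q\<^sup>2 * ?c + 1) = 0" "?c * q\<^sup>2 = ?l"
    using assms(1) by (cases s; simp add: sign_weight_def sign_eigenvalue_def)+
  have "symmetriser ?c q x n t \<in> eigenspace ?l q x n {1..<n}" if "t \<in> W n" for t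
    using hop_symmetriser[OF c(1) that] symmetriser_in_W[OF that] by (simp add: eigenspace_def c(2))
  moreover have "t \<in> symmetriser ?c q x n ` W n" if t: "t \<in> eigenspace ?l q x n {1..<n}" for t
  proof -
    let ?t = "scale (inverse (sign_norm s q n)) t"
    have t': "?t \<in> eigenspace ?l q x n {1..<n}" using t by (rule tensor.subspace_scale[OF subspace_eigenspace])
    then have "symmetriser ?c q x n ?t = scale (sign_norm s q n) ?t"
      unfolding sign_norm_def by (intro symmetriser_eigen) (simp add: eigenspace_def)
    then have "symmetriser ?c q x n ?t = t" using sign_norm_nonzero[OF assms(2)] by simp
    then show ?thesis using t' by (intro image_eqI[of _ _ ?t]) (auto simp: eigenspace_def)
  qed
  ultimately show ?thesis
    unfolding fused_space_eq[OF assms(1) not_root_of_unity_square(1)[OF assms(2)]] by blast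
qed

lemma hecke_op_conc_left:
  "s \<in> W m \<Longrightarrow> set is \<subseteq> {1..<m} \<Longrightarrow> hecke_op q x is (conc s t) = conc (hecke_op q x is s) t"
  unfolding hecke_op_strand_op by (rule run_conc_left)

lemma hecke_op_conc_right:
  "s \<in> W m \<Longrightarrow> 0 \<notin> set is \<Longrightarrow>
    hecke_op q x (map ((+) m) is) (conc s t) = conc s (hecke_op q (q ^ m * x) is t)"
  unfolding hecke_op_strand_op by (subst run_conc_right) auto

lemma lin_symmetriser: "lin (symmetriser c q x n)"
  unfolding lin_def symmetriser_def
  by (simp add: linD[OF lin_hecke_op] tensor.scale_right_distrib sum.distrib tensor.scale_sum_right mult.commute)

text \<open>
  A common eigenvector in the \<open>2n\<close>-fold tensor power is, up to a nonzero scalar, its own image under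
  the symmetriser of the first \<open>n\<close> factors times that of the last \<open>n\<close> factors. Expanding it in the
  basis exhibits it as a sum of products of elements of the two fused spaces.
\<close>

lemma tensor_fused_eigenspace:
  assumes "q \<noteq> 0" "\<forall>r::nat. r > 0 \<longrightarrow> q ^ r \<noteq> 1"
  shows "tensor_space (fused_space s n q x) (fused_space s n q (q ^ n * x)) =
    eigenspace (sign_eigenvalue s q) q x (2 * n) ({1..<2 * n} - {n})"
proof
  let ?l = "sign_eigenvalue s q" and ?c = "sign_weight s q"
  note eig = fused_space_eigenspace[OF assms]
  show "tensor_space (fused_space s n q x) (fused_space s n q (q ^ n * x)) \<subseteq> eigenspace ?l q x (2 * n) ({1..<2 * n} - {n})"
  proof (rule tensor_space_minimal[OF subspace_eigenspace])
    fix a b assume a: "a \<in> fused_space s n q x" and b: "b \<in> fused_space s n q (q ^ n * x)"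
    have aW: "a \<in> W n" and bW: "b \<in> W n" using a b by (simp_all add: eig eigenspace_def)
    have "hop q x i (conc a b) = scale ?l (conc a b)" if i: "i \<in> {1..<2 * n} - {n}" for i
    proof (cases "i < n")
      case True
      then show ?thesis using i a hop_conc_left[OF aW, of i q x b]
        by (simp add: eig eigenspace_def conc_scale_left)
    next
      case False
      then obtain j where j: "i = n + j" "j \<in> {1..<n}" using i by (intro that[of "i - n"]) auto
      then show ?thesis using b hop_conc_right[OF aW, of j q x b]
        by (simp add: eig eigenspace_def conc_scale_right)
    qed
    then show "conc a b \<in> eigenspace ?l q x (2 * n) ({1..<2 * n} - {n})"
      using conc_in_W[OF aW bW] by (simp add: eigenspace_def mult_2)
  qed
  show "eigenspace ?l q x (2 * n) ({1..<2 * n} - {n}) \<subseteq> tensor_space (fused_space s n q x) (fused_space s n q (q ^ n * x))"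
  proof
    fix t assume t: "t \<in> eigenspace ?l q x (2 * n) ({1..<2 * n} - {n})"
    then have tW: "t \<in> W (2 * n)" by (simp add: eigenspace_def)
    define E where "E = symmetriser ?c q x n"
    define E' where "E' r = (\<Sum>\<sigma> | \<sigma> permutes {1..n}.
      scale (?c ^ inv_count \<sigma>) (hecke_op q x (map ((+) n) (some_word n \<sigma>)) r))" for r
    have word: "set (some_word n \<sigma>) \<subseteq> {1..<n}" "length (some_word n \<sigma>) = inv_count \<sigma>"
      if "\<sigma> permutes {1..n}" for \<sigma>
      using reduced_some_word[OF that] by (simp_all add: reduced_word_def)
    have linE: "lin E" unfolding E_def by (rule lin_symmetriser)
    have linE': "lin E'"
      unfolding lin_def E'_def
      by (simp add: linD[OF lin_hecke_op] tensor.scale_right_distrib sum.distrib tensor.scale_sum_right mult.commute)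
    have "E t = scale (sign_norm s q n) t"
      unfolding E_def sign_norm_def using t by (intro symmetriser_eigen) (auto simp: eigenspace_def)
    moreover have "hecke_op q x (map ((+) n) (some_word n \<sigma>)) t = scale (?l ^ inv_count \<sigma>) t"
      if "\<sigma> permutes {1..n}" for \<sigma>
      using t word[OF that] by (subst hecke_op_eigen[where l = ?l]) (auto simp: eigenspace_def)
    then have "E' t = scale (sign_norm s q n) t"
      unfolding E'_def sign_norm_def by (simp add: tensor.scale_sum_left power_mult_distrib)
    ultimately have EE: "E (E' t) = scale (sign_norm s q n * sign_norm s q n) t"
      by (simp add: linD[OF linE])
    have E_conc: "E (conc a b) = conc (E a) b" if "a \<in> W n" for a b
      unfolding E_def symmetriser_def using hecke_op_conc_left[OF that] word(1)
      by (simp add: conc_sum_left conc_scale_left)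
    have E'_conc: "E' (conc a b) = conc a (symmetriser ?c q (q ^ n * x) n b)" if "a \<in> W n" for a b
    proof -
      have "hecke_op q x (map ((+) n) (some_word n \<sigma>)) (conc a b) = conc a (hecke_op q (q ^ n * x) (some_word n \<sigma>) b)"
        if "\<sigma> permutes {1..n}" for \<sigma>
        using word(1)[OF that] by (intro hecke_op_conc_right[OF \<open>a \<in> W n\<close>]) auto
      then show ?thesis
        unfolding E'_def symmetriser_def by (simp add: conc_sum_right conc_scale_right)
    qed
    have "E (E' (basis w)) \<in> tensor_space (fused_space s n q x) (fused_space s n q (q ^ n * x))"
      if "w \<in> words (2 * n)" for w
    proof -
      have "set w = set (take n w) \<union> set (drop n w)" by (simp flip: set_append)
      then have w: "take n w \<in> words n" "drop n w \<in> words n" using that by (auto simp: words_def)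
      then have b: "basis (take n w) \<in> W n" "basis (drop n w) \<in> W n" by (simp_all add: basis_in_W)
      have "basis w = conc (basis (take n w)) (basis (drop n w))" by (simp add: conc_basis)
      then have "E (E' (basis w)) = conc (E (basis (take n w))) (symmetriser ?c q (q ^ n * x) n (basis (drop n w)))"
        by (simp add: E'_conc[OF b(1)] E_conc[OF b(1)])
      also have "\<dots> \<in> tensor_space (fused_space s n q x) (fused_space s n q (q ^ n * x))"
        using b unfolding E_def fused_space_eq[OF assms(1) not_root_of_unity_square(1)[OF assms(2)]]
        by (intro conc_in_tensor_space) auto
      finally show ?thesis .
    qed
    then have "(\<Sum>w\<in>words (2 * n). scale (t w) (E (E' (basis w)))) \<in>
        tensor_space (fused_space s n q x) (fused_space s n q (q ^ n * x))"
      by (intro tensor.subspace_sum tensor.subspace_scale subspace_tensor_space)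
    also have "(\<Sum>w\<in>words (2 * n). scale (t w) (E (E' (basis w)))) = E (E' t)"
      by (subst (2) W_expand[OF tW]) (simp add: lin_sum[OF linE] lin_sum[OF linE'] linD[OF linE] linD[OF linE'])
    finally have "scale (inverse (sign_norm s q n * sign_norm s q n)) (E (E' t)) \<in>
        tensor_space (fused_space s n q x) (fused_space s n q (q ^ n * x))"
      by (rule tensor.subspace_scale[OF subspace_tensor_space])
    then show "t \<in> tensor_space (fused_space s n q x) (fused_space s n q (q ^ n * x))"
      unfolding EE tensor.scale_scale
      by (subst (asm) left_inverse) (use sign_norm_nonzero[OF assms(2)] in simp_all)
  qed
qed

section \<open>Exchange of two blocks of strands\<close>

text \<open>
  The \<open>i\<close>-th entry of \<open>\<gamma>\<^sub>n[p\<^sub>\<plusminus>]\<close> for \<open>1 \<le> i \<le> n\<close>.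
\<close>

definition zeta :: "sign \<Rightarrow> complex \<Rightarrow> nat \<Rightarrow> nat \<Rightarrow> complex" where
  "zeta s q n i = p_vec s q (n + 1 - i)"

lemma act_gamma_perm:
  assumes "i \<in> {1..n}"
  shows "act (gamma_perm n) (\<lambda>i. u * p_vec s q i) i = u * zeta s q n i"
proof -
  have "gamma_perm n \<circ> gamma_perm n = id" by (auto simp: fun_eq_iff gamma_perm_def comp_apply id_apply)
  then have "inv_into UNIV (gamma_perm n) = gamma_perm n" by (intro inv_unique_comp)
  then show ?thesis using assms by (simp add: act_def gamma_perm_def zeta_def Suc_diff_le)
qed

text \<open>
  Consecutive entries have ratio \<open>q\<^sup>\<plusminus>\<^sup>2\<close>, which is where the basic operator degenerates to a multiple
  of \<open>h - \<lambda>\<close>.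
\<close>

lemma strand_op_zeta:
  assumes "q \<noteq> 0" "q\<^sup>2 - 1 \<noteq> 0" "i \<in> {1..<n}"
  obtains c where "c \<noteq> 0"
    "\<And>x j t. strand_op q x (R_coeffs q) (zeta s q n i) (zeta s q n (i + 1)) j t =
      scale c (hop q x j t - scale (sign_eigenvalue s q) t)"
proof -
  \<comment> \<open>The ratio of consecutive entries of \<open>p\<^sub>\<plusminus>\<close>.\<close>
  define p where "p = (case s of Plus \<Rightarrow> inverse (q\<^sup>2) | Minus \<Rightarrow> q\<^sup>2)"
  define z where "z = zeta s q n (i + 1)"
  have "n + 1 - i - 1 = Suc (n + 1 - (i + 1) - 1)" using assms(3) by auto
  then have z: "zeta s q n i = p * z"
    unfolding z_def zeta_def p_vec_def p_def by simp
  have p0: "p \<noteq> 0" "p - 1 \<noteq> 0" using assms(1,2) by (cases s; simp add: p_def field_simps)+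
  have z0: "z \<noteq> 0" using p0 by (simp add: z_def zeta_def p_vec_def p_def[symmetric])
  have eq: "q\<^sup>2 - 1 = - ((p - 1) * sign_eigenvalue s q)"
    using assms(1) by (cases s; simp add: p_def sign_eigenvalue_def field_simps)
  show ?thesis
  proof (rule that)
    show "(p - 1) * z \<noteq> 0" using p0 z0 by simp
    fix x j t
    show "strand_op q x (R_coeffs q) (zeta s q n i) (zeta s q n (i + 1)) j t =
        scale ((p - 1) * z) (hop q x j t - scale (sign_eigenvalue s q) t)"
      unfolding z z_def[symmetric] strand_op_def R_coeffs_def eq
      by (simp add: fun_eq_iff tensor_apply algebra_simps)
  qed
qed

text \<open>
  Along a reduced word exactly the strands that form an inversion of the permutation cross, so only the
  coefficients of those pairs of strands matter.
\<close>

lemma run_inversions_cong: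
  assumes "reduced_word m is \<sigma>"
    and "\<And>i j. (i, j) \<in> inversions \<sigma> \<Longrightarrow> f (a i) (a j) = g (b i) (b j)"
  shows "run (strand_op q x f) a is t = run (strand_op q x g) b is t"
  using assms
proof (induction "is" arbitrary: \<sigma> a b t)
  case (Cons i "is")
  then have i: "i \<in> {1..<m}" "reduced_word m is (\<sigma> \<circ> adj i)" "\<sigma> (i + 1) < \<sigma> i"
    by (simp_all add: reduced_word_Cons)
  have "(\<sigma> \<circ> adj i) i < (\<sigma> \<circ> adj i) (i + 1)" using i(3) by (simp add: comp_apply)
  from inversions_comp_adj[OF this]
  have inv: "inversions \<sigma> = insert (i, i + 1) (map_prod (adj i) (adj i) ` inversions (\<sigma> \<circ> adj i))"
    by (simp add: comp_adj_adj)
  have "strand_op q x f (a i) (a (i + 1)) i t = strand_op q x g (b i) (b (i + 1)) i t"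
    using Cons.prems(2)[of i "i + 1"] by (simp add: inv strand_op_def)
  moreover have "run (strand_op q x f) (a \<circ> adj i) is r = run (strand_op q x g) (b \<circ> adj i) is r" for r
  proof (rule Cons.IH[OF i(2)])
    fix k l assume "(k, l) \<in> inversions (\<sigma> \<circ> adj i)"
    then have "(adj i k, adj i l) \<in> inversions \<sigma>" unfolding inv by force
    then show "f ((a \<circ> adj i) k) ((a \<circ> adj i) l) = g ((b \<circ> adj i) k) ((b \<circ> adj i) l)"
      using Cons.prems(2) by (simp add: comp_apply)
  qed
  ultimately show ?case by simp
qed simp

lemma tau_perm_tau_perm: "tau_perm n (tau_perm n i) = i"
  by (auto simp: tau_perm_def)

lemma inv_tau_perm: "inv_into UNIV (tau_perm n) = tau_perm n"
  by (rule inv_unique_comp) (simp_all add: fun_eq_iff comp_apply id_apply tau_perm_tau_perm)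

lemma tau_perm_permutes: "tau_perm n permutes {1..2 * n}"
proof (rule bij_imp_permutes)
  show "bij_betw (tau_perm n) {1..2 * n} {1..2 * n}"
    by (rule bij_betwI[of _ _ _ "tau_perm n"]) (auto simp: tau_perm_tau_perm, auto simp: tau_perm_def)
  show "tau_perm n i = i" if "i \<notin> {1..2 * n}" for i using that by (auto simp: tau_perm_def)
qed

lemma inversions_tau_perm: "inversions (tau_perm n) = {1..n} \<times> {n + 1..2 * n}"
proof -
  have tau: "i = 0 \<and> tau_perm n i = 0 \<or> 1 \<le> i \<and> i \<le> n \<and> tau_perm n i = i + n \<or>
      n < i \<and> i \<le> 2 * n \<and> tau_perm n i + n = i \<or> 2 * n < i \<and> tau_perm n i = i" for i
    by (auto simp: tau_perm_def)
  have "(i, j) \<in> inversions (tau_perm n) \<longleftrightarrow> (i, j) \<in> {1..n} \<times> {n + 1..2 * n}" for i j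
    using tau[of i] tau[of j] by (elim disjE conjE) (auto simp: inversions_def)
  then show ?thesis by auto
qed

text \<open>
  The strands are divided into two blocks by \<open>B\<close>, and a strand \<open>a\<close> has the parameter \<open>U (B a) * y a\<close>.
  Dropping the common factor \<open>U (B a)\<close> when two strands of one block cross divides both sides of the
  Yang--Baxter equation by the same factor if \<open>U\<close> has no zero; the polynomial identity then holds for
  every \<open>U\<close>.
\<close>

lemma yang_baxter_blocks:
  fixes U :: "bool \<Rightarrow> complex"
  shows "yang_baxter_coeffs q (\<lambda>a b. if B a = B b then R_coeffs q (y a) (y b)
    else R_coeffs q (U (B a) * y a) (U (B b) * y b))"
  unfolding yang_baxter_coeffs_def
  apply (intro allI)
  subgoal for a b c
    by (cases "B a"; cases "B b"; cases "B c"; simp add: R_coeffs_def; simp add: algebra_simps)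
  done

text \<open>
  The vector \<open>u z \<union> v z \<union> w z\<close> for \<open>z\<close> of length \<open>n\<close>.
\<close>

definition block_labels :: "nat \<Rightarrow> (nat \<Rightarrow> complex) \<Rightarrow> complex \<Rightarrow> complex \<Rightarrow> complex \<Rightarrow> nat \<Rightarrow> complex" where
  "block_labels n z u v w i =
    (if i \<le> n then u * z i else if i \<le> 2 * n then v * z (i - n) else w * z (i - 2 * n))"

abbreviation (input) tau_word :: "nat \<Rightarrow> nat list" where
  "tau_word n \<equiv> some_word (2 * n) (tau_perm n)"

text \<open>
  The value of \<open>w\<close> is irrelevant, as the word involves the first \<open>2n\<close> strands only.
\<close>

lemma run_tau_word_invariant:
  assumes "q \<noteq> 0" "\<forall>r::nat. r > 0 \<longrightarrow> q ^ r \<noteq> 1"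
    and t: "t \<in> tensor_space (fused_space s n q x) (fused_space s n q (q ^ n * x))"
  shows "run (strand_op q x (R_coeffs q)) (block_labels n (zeta s q n) u v w) (tau_word n) t \<in>
    tensor_space (fused_space s n q x) (fused_space s n q (q ^ n * x))"
proof -
  let ?l = "sign_eigenvalue s q" and ?z = "zeta s q n" and ?I = "{1..<2 * n} - {n}"
  define B where "B i \<longleftrightarrow> i \<le> n" for i
  define U where "U b = (if b then u else v)" for b
  define y where "y i = ?z (if i \<le> n then i else i - n)" for i
  define f where "f = (\<lambda>a b. if B a = B b then R_coeffs q (y a) (y b)
    else R_coeffs q (U (B a) * y a) (U (B b) * y b))"
  have word: "reduced_word (2 * n) (tau_word n) (tau_perm n)"
    by (rule reduced_some_word[OF tau_perm_permutes])
  have set: "set (tau_word n) \<subseteq> {1..<2 * n}" and wp: "word_perm (tau_word n) = tau_perm n"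
    using word by (simp_all add: reduced_word_def)
  interpret word_action "2 * n" "W (2 * n)" "strand_op q x f"
    unfolding f_def by (rule word_action_strand_op[OF yang_baxter_blocks])
  have tE: "t \<in> eigenspace ?l q x (2 * n) ?I" using t by (simp add: tensor_fused_eigenspace[OF assms(1,2)])
  then have tW: "t \<in> W (2 * n)" by (simp add: eigenspace_def)
  define r where "r = run (strand_op q x f) id (tau_word n) t"
  \<comment> \<open>Only strands of different blocks cross, and there the coefficients agree.\<close>
  have same: "run (strand_op q x (R_coeffs q)) (block_labels n ?z u v w) (tau_word n) t = r"
    unfolding r_def
    by (rule run_inversions_cong[OF word])
      (auto simp: inversions_tau_perm f_def B_def U_def y_def block_labels_def id_apply)
  have rW: "r \<in> W (2 * n)" unfolding r_def using run_closed[OF set tW] .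
  have "hop q x j r = scale ?l r" if j: "j \<in> ?I" for j
  proof -
    \<comment> \<open>The strands that end at \<open>j\<close> and \<open>j + 1\<close> start at \<open>i\<close> and \<open>i + 1\<close>.\<close>
    define i where "i = (if j < n then j + n else j - n)"
    have i: "i \<in> {1..<2 * n}" "i \<noteq> n" and ij: "tau_perm n i = j" "tau_perm n (i + 1) = j + 1"
      using j by (auto simp: i_def tau_perm_def)
    have comm: "adj j \<circ> tau_perm n = tau_perm n \<circ> adj i"
    proof
      fix k
      have "tau_perm n k = j \<longleftrightarrow> k = i" "tau_perm n k = j + 1 \<longleftrightarrow> k = i + 1"
        using ij tau_perm_tau_perm by metis+
      then show "(adj j \<circ> tau_perm n) k = (tau_perm n \<circ> adj i) k"
        using ij by (auto simp: comp_apply adj_apply)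
    qed
    have red1: "reduced_word (2 * n) (i # tau_word n) (tau_perm n \<circ> adj i)"
      unfolding reduced_word_Cons using word i(1) ij
        permutes_compose[OF adj_permutes[OF i(1)] tau_perm_permutes] by (simp add: comp_adj_adj comp_apply)
    then have "inv_count (tau_perm n \<circ> adj i) = Suc (inv_count (tau_perm n))"
      using word by (simp add: reduced_word_def)
    then have red2: "reduced_word (2 * n) (tau_word n @ [j]) (tau_perm n \<circ> adj i)"
      using word j by (auto simp: reduced_word_def word_perm_append comm)
    have labels: "(id \<circ> inv_into UNIV (tau_perm n)) j = i" "(id \<circ> inv_into UNIV (tau_perm n)) (j + 1) = i + 1"
      using ij tau_perm_tau_perm[of n i] tau_perm_tau_perm[of n "i + 1"]
      by (simp_all add: inv_tau_perm comp_apply id_apply)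
    have "run (strand_op q x f) id (tau_word n @ [j]) t = strand_op q x f i (i + 1) j r"
      unfolding run_append[OF set] wp r_def run.simps labels ..
    moreover have "run (strand_op q x f) id (i # tau_word n) t =
        run (strand_op q x f) (id \<circ> adj i) (tau_word n) (strand_op q x f i (i + 1) i t)"
      by (simp add: id_apply)
    moreover obtain c where c: "c \<noteq> 0" "\<And>k t. strand_op q x f i (i + 1) k t = scale c (hop q x k t - scale ?l t)"
    proof -
      \<comment> \<open>The position of the strand within its block.\<close>
      define i' where "i' = (if i < n then i else i - n)"
      have i': "i' \<in> {1..<n}" using i by (auto simp: i'_def)
      have "f i (i + 1) = R_coeffs q (?z i') (?z (i' + 1))"
        using i by (auto simp: f_def B_def y_def i'_def Suc_diff_le)
      then have "strand_op q x f i (i + 1) k t = strand_op q x (R_coeffs q) (?z i') (?z (i' + 1)) k t" for k t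
        by (simp add: strand_op_def)
      then show ?thesis
        using that strand_op_zeta[OF assms(1) not_root_of_unity_square(2)[OF assms(2)] i', of s] by metis
    qed
    moreover have "hop q x i t = scale ?l t" using tE i by (simp add: eigenspace_def)
    moreover have "run (strand_op q x f) (id \<circ> adj i) (tau_word n) 0 = 0"
      by (rule lin_zero[OF lin_run_strand_op])
    \<comment> \<open>The first word starts with an operator that kills \<open>t\<close>; the second one ends with a nonzero multiple of \<open>h_j - \<lambda>\<close>.\<close>
    ultimately have "scale c (hop q x j r - scale ?l r) = 0"
      using run_reduced_unique[OF red1 red2 tW, of id] by simp
    then show ?thesis using c(1) by simp
  qed
  then have "r \<in> eigenspace ?l q x (2 * n) ?I" using rW by (simp add: eigenspace_def)
  then show ?thesis unfolding same tensor_fused_eigenspace[OF assms(1,2)] .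
qed

lemma fused_R_eq:
  assumes "q \<noteq> 0" "\<forall>r::nat. r > 0 \<longrightarrow> q ^ r \<noteq> 1"
  shows "fused_R s n q u v x =
    restrict (run (strand_op q x (R_coeffs q)) (block_labels n (zeta s q n) u v w) (tau_word n))
      (tensor_space (fused_space s n q x) (fused_space s n q (q ^ n * x)))"
proof -
  let ?T = "tensor_space (fused_space s n q x) (fused_space s n q (q ^ n * x))"
  let ?a = "join n (act (gamma_perm n) (\<lambda>i. u * p_vec s q i)) (act (gamma_perm n) (\<lambda>i. v * p_vec s q i))"
  have word: "reduced_word (2 * n) (tau_word n) (tau_perm n)"
    by (rule reduced_some_word[OF tau_perm_permutes])
  have "run (strand_op q x (R_coeffs q)) ?a (tau_word n) t =
      run (strand_op q x (R_coeffs q)) (block_labels n (zeta s q n) u v w) (tau_word n) t" for t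
  proof (rule run_cong[of _ "2 * n"])
    show "set (tau_word n) \<subseteq> {1..<2 * n}" using word by (simp add: reduced_word_def)
    fix i assume "i \<in> {1..2 * n}"
    then consider "i \<in> {1..n}" | "\<not> i \<le> n" "i \<le> 2 * n" "i - n \<in> {1..n}" by fastforce
    then show "?a i = block_labels n (zeta s q n) u v w i"
      by cases (simp_all add: join_def block_labels_def act_gamma_perm del: atLeastAtMost_iff, simp)
  qed
  moreover have "?T \<subseteq> W (2 * n)" unfolding tensor_fused_eigenspace[OF assms] by (auto simp: eigenspace_def)
  ultimately show ?thesis
    unfolding fused_R_def R_perm_eq[OF assms(1) not_root_of_unity_square(1)[OF assms(2)] word]
    by (intro restrict_ext) auto
qed

section \<open>The fused Yang--Baxter equation\<close>

lemma word_perm_shift: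
  assumes "0 \<notin> set is"
  shows "word_perm (map ((+) n) is) i = (if i \<le> n then i else n + word_perm is (i - n))"
  using assms
proof (induction "is" arbitrary: i)
  case (Cons k "is")
  have "adj (n + k) i = (if i \<le> n then i else n + adj k (i - n))"
    and "i > n \<Longrightarrow> adj k (i - n) > 0"
    using Cons.prems by (auto simp: adj_apply)
  then show ?case using Cons by (auto simp: comp_apply)
qed (simp add: id_apply)

text \<open>
  The permutation that reverses the order of three blocks of \<open>n\<close> strands.
\<close>

definition block_reversal :: "nat \<Rightarrow> nat \<Rightarrow> nat" where
  "block_reversal n i = (if i \<in> {1..n} then i + 2 * n else if i \<in> {2 * n + 1..3 * n} then i - 2 * n else i)"

lemma inv_count_tau_perm: "inv_count (tau_perm n) = n * n"
  by (simp add: inv_count_def inversions_tau_perm card_cartesian_product)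

lemma inv_count_block_reversal: "inv_count (block_reversal n) = 3 * n * n"
proof -
  have "inversions (block_reversal n) = {1..n} \<times> {n + 1..3 * n} \<union> {n + 1..2 * n} \<times> {2 * n + 1..3 * n}"
  proof -
    have rev: "i = 0 \<and> block_reversal n i = 0 \<or> 1 \<le> i \<and> i \<le> n \<and> block_reversal n i = i + 2 * n \<or>
        n < i \<and> i \<le> 2 * n \<and> block_reversal n i = i \<or>
        2 * n < i \<and> i \<le> 3 * n \<and> block_reversal n i + 2 * n = i \<or> 3 * n < i \<and> block_reversal n i = i" for i
      by (auto simp: block_reversal_def)
    have "(i, j) \<in> inversions (block_reversal n) \<longleftrightarrow>
        (i, j) \<in> {1..n} \<times> {n + 1..3 * n} \<union> {n + 1..2 * n} \<times> {2 * n + 1..3 * n}" for i j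
      using rev[of i] rev[of j] by (elim disjE conjE) (auto simp: inversions_def)
    then show ?thesis by auto
  qed
  moreover have "card ({1..n} \<times> {n + 1..3 * n} \<union> {n + 1..2 * n} \<times> {2 * n + 1..3 * n}) =
      card ({1..n} \<times> {n + 1..3 * n}) + card ({n + 1..2 * n} \<times> {2 * n + 1..3 * n})"
    by (rule card_Un_disjoint) auto
  ultimately show ?thesis by (simp add: inv_count_def card_cartesian_product algebra_simps)
qed

lemma block_words_reduced:
  fixes n i :: nat
  defines "A \<equiv> tau_word n" and "B \<equiv> map ((+) n) (tau_word n)"
  shows "set A \<subseteq> {1..<3 * n}" "set B \<subseteq> {1..<3 * n}"
    and "word_perm A = tau_perm n"
    and "word_perm B i = (if i \<le> n then i else n + tau_perm n (i - n))"
    and "reduced_word (3 * n) (A @ B @ A) (block_reversal n)"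
    and "reduced_word (3 * n) (B @ A @ B) (block_reversal n)"
proof -
  have word: "reduced_word (2 * n) (tau_word n) (tau_perm n)"
    by (rule reduced_some_word[OF tau_perm_permutes])
  then have w: "set (tau_word n) \<subseteq> {1..<2 * n}" "length (tau_word n) = n * n"
    and wp: "word_perm (tau_word n) = tau_perm n"
    by (simp_all add: reduced_word_def inv_count_tau_perm)
  show A: "set A \<subseteq> {1..<3 * n}" using w(1) by (auto simp: A_def)
  show B: "set B \<subseteq> {1..<3 * n}" using w(1) by (fastforce simp: B_def)
  show pA: "word_perm A = tau_perm n" unfolding A_def by (rule wp)
  have "0 \<notin> set (tau_word n)" using w(1) by auto
  then show pB: "word_perm B i = (if i \<le> n then i else n + tau_perm n (i - n))" for i
    unfolding B_def by (simp add: word_perm_shift wp)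
  have "word_perm (A @ B @ A) = block_reversal n" "word_perm (B @ A @ B) = block_reversal n"
  proof -
    have "tau_perm n (word_perm B (tau_perm n i)) = block_reversal n i \<and>
        word_perm B (tau_perm n (word_perm B i)) = block_reversal n i" for i
    proof -
      consider "i = 0" | k where "i = k" "k \<in> {1..n}" | k where "i = n + k" "k \<in> {1..n}"
        | k where "i = 2 * n + k" "k \<in> {1..n}" | "3 * n < i"
      proof -
        have "i = 0 \<or> i \<in> {1..n} \<or> (i = n + (i - n) \<and> i - n \<in> {1..n}) \<or>
            (i = 2 * n + (i - 2 * n) \<and> i - 2 * n \<in> {1..n}) \<or> 3 * n < i"
          by auto
        then show ?thesis using that by blast
      qed
      then show ?thesis
        by cases (auto simp: pB tau_perm_def block_reversal_def)
    qed
    then show "word_perm (A @ B @ A) = block_reversal n" "word_perm (B @ A @ B) = block_reversal n"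
      unfolding word_perm_append pA by (simp_all add: fun_eq_iff comp_apply)
  qed
  then show "reduced_word (3 * n) (A @ B @ A) (block_reversal n)"
    "reduced_word (3 * n) (B @ A @ B) (block_reversal n)"
    using A B w(2) by (auto simp: reduced_word_def inv_count_block_reversal A_def B_def)
qed

theorem theorem2:
  fixes q x u v w :: complex and n :: nat and s :: sign
  assumes "q \<noteq> 0"
    and "\<forall>r::nat. r > 0 \<longrightarrow> q ^ r \<noteq> 1"
    and "n \<ge> 1"
  shows
    "let A = fused_space s n q x;
         B = fused_space s n q (q ^ n * x);
         C = fused_space s n q (q ^ (2 * n) * x);
         U = tensor_space (tensor_space A B) C;
         R_I = (\<lambda>u v. op_tensor (tensor_space A B) (fused_R s n q u v x) C (ident C));
         I_R = (\<lambda>u v. op_tensor A (ident A) (tensor_space B C) (fused_R s n q u v (q ^ n * x)));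
         lhs = compose U (R_I v w) (compose U (I_R u w) (R_I u v));
         rhs = compose U (I_R u v) (compose U (R_I u w) (I_R v w))
     in lhs \<in> endos U \<and> lhs = rhs"
proof -
  define A where "A = fused_space s n q x"
  define B where "B = fused_space s n q (q ^ n * x)"
  define C where "C = fused_space s n q (q ^ (2 * n) * x)"
  define U where "U = tensor_space (tensor_space A B) C"
  define R_I where "R_I u v = op_tensor (tensor_space A B) (fused_R s n q u v x) C (ident C)" for u v
  define I_R where "I_R u v = op_tensor A (ident A) (tensor_space B C) (fused_R s n q u v (q ^ n * x))" for u v
  let ?S = "\<lambda>x. strand_op q x (R_coeffs q)"
  let ?L = "block_labels n (zeta s q n)"
  let ?a = "tau_word n" and ?b = "map ((+) n) (tau_word n)"
  have word: "reduced_word (2 * n) ?a (tau_perm n)" by (rule reduced_some_word[OF tau_perm_permutes])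
  then have wa: "set ?a \<subseteq> {1..<2 * n}" "0 \<notin> set ?a" by (auto simp: reduced_word_def)
  note words = block_words_reduced[of n]
  have C_alt: "C = fused_space s n q (q ^ n * (q ^ n * x))"
    unfolding C_def by (simp add: mult_2 power_add mult.assoc)
  have AW: "A \<subseteq> W n" and CW: "C \<subseteq> W n"
    unfolding A_def C_def fused_space_eigenspace[OF assms(1,2)] by (auto simp: eigenspace_def)
  have ABW: "tensor_space A B \<subseteq> W (2 * n)"
    unfolding A_def B_def tensor_fused_eigenspace[OF assms(1,2)] by (auto simp: eigenspace_def)
  have UW: "U \<subseteq> W (3 * n)"
    unfolding U_def using conc_in_W[of _ "2 * n" _ n] ABW CW
    by (intro tensor_space_minimal[OF subspace_W]) (auto simp: numeral_3_eq_3)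
  have U_alt: "U = tensor_space A (tensor_space B C)" unfolding U_def by (rule tensor_space_assoc)
  have subU: "tensor.subspace U" unfolding U_def by (rule subspace_tensor_space)
  have left: "run (?S x) a ?a (conc r c) = conc (run (?S x) a ?a r) c" if "r \<in> tensor_space A B" for a r c
    using that ABW wa by (intro run_conc_left) auto
  have right: "run (?S x) (?L u' v' w') ?b (conc a r) = conc a (run (?S (q ^ n * x)) (?L v' w' 0) ?a r)"
    if "a \<in> A" for a r u' v' w'
  proof -
    have "run (?S (q ^ n * x)) (\<lambda>i. ?L u' v' w' (n + i)) ?a r = run (?S (q ^ n * x)) (?L v' w' 0) ?a r"
      by (rule run_cong[OF wa(1)]) (auto simp: block_labels_def)
    then show ?thesis using run_conc_right[of a n ?a q x "R_coeffs q" "?L u' v' w'" r] that AW wa by auto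
  qed
  have inv_left: "run (?S x) (?L u' v' w') ?a t \<in> U" if "t \<in> U" for t u' v' w'
  proof -
    have "U \<subseteq> {t. run (?S x) (?L u' v' w') ?a t \<in> U}"
      unfolding U_def
    proof (rule tensor_space_minimal)
      show "tensor.subspace {t. run (?S x) (?L u' v' w') ?a t \<in> tensor_space (tensor_space A B) C}"
        by (rule subspace_lin_vimage[OF lin_run_strand_op subspace_tensor_space])
      fix r c assume "r \<in> tensor_space A B" "c \<in> C"
      then show "conc r c \<in> {t. run (?S x) (?L u' v' w') ?a t \<in> tensor_space (tensor_space A B) C}"
        using run_tau_word_invariant[OF assms(1,2), of r s n x u' v' w']
        by (auto simp: left A_def B_def intro!: conc_in_tensor_space)
    qed
    then show ?thesis using that by blast
  qed
  have inv_right: "run (?S x) (?L u' v' w') ?b t \<in> U" if "t \<in> U" for t u' v' w'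
  proof -
    have "U \<subseteq> {t. run (?S x) (?L u' v' w') ?b t \<in> U}"
      unfolding U_alt
    proof (rule tensor_space_minimal)
      show "tensor.subspace {t. run (?S x) (?L u' v' w') ?b t \<in> tensor_space A (tensor_space B C)}"
        by (rule subspace_lin_vimage[OF lin_run_strand_op subspace_tensor_space])
      fix a r assume "a \<in> A" "r \<in> tensor_space B C"
      then show "conc a r \<in> {t. run (?S x) (?L u' v' w') ?b t \<in> tensor_space A (tensor_space B C)}"
        using run_tau_word_invariant[OF assms(1,2), of r s n "q ^ n * x" v' w' 0]
        by (auto simp: right B_def C_alt intro!: conc_in_tensor_space)
    qed
    then show ?thesis using that by blast
  qed
  have endo: "restrict (run (?S x) (?L u' v' w') ?a) U \<in> endos U"
    "restrict (run (?S x) (?L u' v' w') ?b) U \<in> endos U" for u' v' w'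
    using restrict_in_endos[OF subU lin_run_strand_op inv_left]
      restrict_in_endos[OF subU lin_run_strand_op inv_right] by blast+
  have R_I: "R_I u' v' = restrict (run (?S x) (?L u' v' w') ?a) U" for u' v' w'
    unfolding R_I_def
  proof (rule op_tensor_eqI)
    show "restrict (run (?S x) (?L u' v' w') ?a) U \<in> endos (tensor_space (tensor_space A B) C)"
      using endo(1) by (simp add: U_def)
    fix r c assume "r \<in> tensor_space A B" "c \<in> C"
    then show "restrict (run (?S x) (?L u' v' w') ?a) U (conc r c) = conc (fused_R s n q u' v' x r) (ident C c)"
      unfolding fused_R_eq[OF assms(1,2), of s n u' v' x w']
      by (simp add: U_def conc_in_tensor_space left ident_def flip: A_def B_def)
  qed
  have I_R: "I_R v' w' = restrict (run (?S x) (?L u' v' w') ?b) U" for u' v' w'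
    unfolding I_R_def
  proof (rule op_tensor_eqI)
    show "restrict (run (?S x) (?L u' v' w') ?b) U \<in> endos (tensor_space A (tensor_space B C))"
      using endo(2) by (simp add: U_alt)
    fix a r assume "a \<in> A" "r \<in> tensor_space B C"
    then show "restrict (run (?S x) (?L u' v' w') ?b) U (conc a r) =
        conc (ident A a) (fused_R s n q v' w' (q ^ n * x) r)"
      unfolding fused_R_eq[OF assms(1,2), of s n v' w' "q ^ n * x" 0]
      by (simp add: U_alt conc_in_tensor_space right ident_def flip: B_def C_alt)
  qed
  \<comment> \<open>Passing the word of \<open>\<tau>\<close> permutes the three blocks of labels.\<close>
  have step_a: "run (?S x) (?L u' v' w') (?a @ ls) t = run (?S x) (?L v' u' w') ls (run (?S x) (?L u' v' w') ?a t)"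
    if "set ls \<subseteq> {1..<3 * n}" for ls t u' v' w'
    unfolding run_append[OF words(1)] words(3) inv_tau_perm
    by (rule run_cong[OF that]) (auto simp: block_labels_def comp_apply tau_perm_def)
  have inv_b: "inv_into UNIV (word_perm ?b) = word_perm ?b"
    by (rule inv_unique_comp)
      (auto simp: fun_eq_iff comp_apply id_apply words(4) tau_perm_tau_perm, auto simp: tau_perm_def)
  have step_b: "run (?S x) (?L u' v' w') (?b @ ls) t = run (?S x) (?L u' w' v') ls (run (?S x) (?L u' v' w') ?b t)"
    if "set ls \<subseteq> {1..<3 * n}" for ls t u' v' w'
    unfolding run_append[OF words(2)] inv_b
    by (rule run_cong[OF that]) (simp only: comp_apply words(4), auto simp: block_labels_def tau_perm_def mult_2)
  have lhs: "compose U (R_I v w) (compose U (I_R u w) (R_I u v)) =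
      restrict (run (?S x) (?L u v w) (?a @ ?b @ ?a)) U"
    unfolding R_I[of v w u] I_R[of u w v] R_I[of u v w]
    using words(1,2) by (subst compose_restrict, (auto intro: inv_left)[1])+
      (auto intro!: restrict_ext inv_left inv_right simp: step_a step_b compose_restrict)
  have rhs: "compose U (I_R u v) (compose U (R_I u w) (I_R v w)) =
      restrict (run (?S x) (?L u v w) (?b @ ?a @ ?b)) U"
    unfolding I_R[of u v w] R_I[of u w v] I_R[of v w u]
    using words(1,2) by (subst compose_restrict, (auto intro: inv_right)[1])+
      (auto intro!: restrict_ext inv_left inv_right simp: step_a step_b compose_restrict)
  interpret word_action "3 * n" "W (3 * n)" "?S x"
    by (rule word_action_strand_op[OF yang_baxter_R_coeffs])
  have "run (?S x) (?L u v w) (?a @ ?b @ ?a) t = run (?S x) (?L u v w) (?b @ ?a @ ?b) t" if "t \<in> U" for t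
    using run_reduced_unique[OF words(5,6)] that UW by blast
  then have "compose U (R_I v w) (compose U (I_R u w) (R_I u v)) =
      compose U (I_R u v) (compose U (R_I u w) (I_R v w))"
    unfolding lhs rhs by (rule restrict_ext)
  moreover have "compose U (R_I v w) (compose U (I_R u w) (R_I u v)) \<in> endos U"
    unfolding R_I[of v w u] I_R[of u w v] R_I[of u v w]
    by (intro compose_in_endos subU endo)
  ultimately show ?thesis
    unfolding Let_def A_def[symmetric] B_def[symmetric] C_def[symmetric]
      U_def[symmetric] R_I_def[symmetric] I_R_def[symmetric] by blast
qed

end
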